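(* Let $\alpha>0$ and let $\mu$ be a nonnegative Borel measure on $\mathbb{C}^n$ satisfying the admissibility condition $\int_{\mathbb{C}^n}|K_w(z)|^2e^{-\alpha|w|^2}\,d\mu(w)<\infty$ for every $z\in\mathbb{C}^n$. Then: (i) Let $1\le p\le\infty$. (a) $T_\mu:\mathcal{F}_\alpha^1\to\mathcal{F}_\alpha^p$ is bounded if and only if $\mu$ is a $(1,q)$ Fock--Carleson measure for some (equivalently, for every) finite $q\geq p$, where for $p=\infty$ the condition "finite $q\ge p$" is to be replaced by "finite $q\ge 1$". Furthermore, in this case $\|T_\mu\|\simeq\|I_\mu\|$, where $I_\mu$ is the embedding map $I_\mu:\mathcal{F}_\alpha^1\to L^p(\sigma_p)$ if $p<\infty$, and $I_\mu:\mathcal{F}_\alpha^1\to L^1(\sigma_1)$ if $p=\infty$. (b) $T_\mu:\mathcal{F}_\alpha^1\to\mathcal{F}_\alpha^p$ is compact if and only if $\mu$ is a $(1,q)$ vanishing Fock--Carleson measure for some (equivalently, for every) finite $q\geq p$, where for $p=\infty$ the condition "finite $q\ge p$" is again replaced by "finite $q\ge1$". (ii) Let $1<p\le\infty$. Then $T_\mu:\mathcal{F}_\alpha^p\to\mathcal{F}_\alpha^1$ is bounded if and only if $\mu$ is a $(p,1)$ Fock--Carleson measure, and $T_\mu:\mathcal{F}_\alpha^p\to\mathcal{F}_\alpha^1$ is compact if and only if $\mu$ is a $(p,1)$ Fock--Carleson measure. Moreover, in this case $\|T_\mu\|\simeq\|I_\mu\|$, where $I_\mu$ is the embedding map $I_\mu:\mathcal{F}_\alpha^p\to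 L^1(\sigma_1)$.
   Context: Fix $n\ge 1$ and $\alpha>0$. For $\langle z,w\rangle=\sum_{j=1}^n z_j\overline{w_j}$ and $|z|=\sqrt{\langle z,z\rangle}$ on $\mathbb{C}^n$, let $K_w(z)=e^{\alpha\langle z,w\rangle}$. Let $dV$ be Lebesgue measure on $\mathbb{C}^n$. Fock spaces: for $1\le p<\infty$, $\mathcal{F}_\alpha^p$ is the space of entire functions $f$ on $\mathbb{C}^n$ with $\|f\|_{(p,\alpha)}^p=\left(\frac{\alpha p}{2\pi}\right)^n\int_{\mathbb{C}^n}|f(z)|^pe^{-\frac{\alpha p}{2}|z|^2}\,dV(z)<\infty$; $\mathcal{F}_\alpha^\infty$ is the space of entire functions $f$ with $\|f\|_{(\infty,\alpha)}=\sup_{z\in\mathbb{C}^n}|f(z)|e^{-\frac{\alpha}{2}|z|^2}<\infty$. Toeplitz operator: $T_\mu f(z)=\int_{\mathbb{C}^n}K_w(z)f(w)e^{-\alpha|w|^2}\,d\mu(w)$. It is bounded from one Fock space $X$ to another $Y$ if for every $f\in X$ the integral converges absolutely for every $z$, $T_\mu f\in Y$, and $\|T_\mu f\|_Y\le C\|f\|_X$ with $C$ independent of $f$; $\|T_\mu\|$ is the operator norm. Compactness is in the usual sense of linear operators between Banach spaces. Fock--Carleson measures: for $0<p\le\infty$ (with $\mathcal{F}_\alpha^p$ and $\|\cdot\|_{(p,\alpha)}$ given by the same formula when $0<p<1$) and $0<q<\infty$, $\mu$ is a $(p,q)$ Fock--Carleson measure if there is a constant $C$ with $\int_{\mathbb{C}^n}|f(z)|^qe^{-\frac{\alpha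 q}{2}|z|^2}\,d\mu(z)\le C\|f\|_{(p,\alpha)}^q$ for all $f\in\mathcal{F}_\alpha^p$, i.e. the embedding map $I_\mu:\mathcal{F}_\alpha^p\to L^q(\sigma_q)$, $I_\mu f=f$, is bounded, where $d\sigma_q(z)=e^{-q\alpha|z|^2/2}\,d\mu(z)$. It is a $(p,q)$ vanishing Fock--Carleson measure if this embedding is compact. $A\simeq B$ means $C^{-1}B\le A\le CB$ for some constant $C>0$; in norm estimates the constant does not depend on $\mu$.
   Formalization: In (i)(a) for 1<p<∞, ‖T_μ‖≃‖I_μ‖ is replaced by ‖T_μ‖≃‖I_μ‖^p: as printed it fails with a constant independent of μ, since for μ = c·Lebesgue measure ‖T_μ‖ scales like c but ‖I_μ‖ like c^{1/p}. *)

theory Defs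
  imports "HOL-Analysis.Analysis"
begin

section \<open>Entire functions and Fock spaces on \<open>\<complex>\<^sup>n\<close>\<close>

text \<open>
  The space \<open>\<complex>\<^sup>n\<close> is \<open>complex ^ 'n\<close> with \<open>n = CARD('n)\<close>. Its library norm is the Hermitian norm,
  and \<open>lborel\<close> on it is Lebesgue measure in the \<open>2n\<close> real coordinates. The library's inner product on this
  type is real-valued, hence the separate Hermitian form.
\<close>

definition herm :: "complex ^ 'n \<Rightarrow> complex ^ 'n \<Rightarrow> complex" where
  "herm z w = (\<Sum>j\<in>UNIV. z $ j * cnj (w $ j))"

definition fock_kernel :: "real \<Rightarrow> complex ^ 'n \<Rightarrow> complex ^ 'n \<Rightarrow> complex" where
  "fock_kernel \<alpha> w z = exp (of_real \<alpha> * herm z w)"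

text \<open>
  The library's \<open>holomorphic_on\<close> is for one variable; here the real Frechet derivative is
  required to be complex linear at every point.
\<close>

definition entire :: "(complex ^ 'n \<Rightarrow> complex) \<Rightarrow> bool" where
  "entire f \<longleftrightarrow>
     (\<forall>z. \<exists>L. (f has_derivative L) (at z) \<and> (\<forall>c v. L (c *s v) = c * L v))"

definition fock_space :: "real \<Rightarrow> ennreal \<Rightarrow> (complex ^ 'n \<Rightarrow> complex) set" where
  "fock_space \<alpha> p = {f. entire f \<and>
     (if p = \<infinity>
      then bdd_above (range (\<lambda>z. norm (f z) * exp (- (\<alpha> / 2) * (norm z)\<^sup>2)))
      else integrable lborel
             (\<lambda>z. norm (f z) powr enn2real p * exp (- (\<alpha> * enn2real p / 2) * (norm z)\<^sup>2)))}"

definition fock_norm :: "real \<Rightarrow> ennreal \<Rightarrow> (complex ^ 'n \<Rightarrow> complex) \<Rightarrow> real" where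
  "fock_norm \<alpha> p f =
     (if p = \<infinity>
      then (SUP z. norm (f z) * exp (- (\<alpha> / 2) * (norm z)\<^sup>2))
      else ((\<alpha> * enn2real p / (2 * pi)) ^ CARD('n) *
              (LINT z|lborel. norm (f z) powr enn2real p *
                 exp (- (\<alpha> * enn2real p / 2) * (norm z)\<^sup>2))) powr (1 / enn2real p))"

section \<open>Bounded and compact operators between seminormed function spaces\<close>

text \<open>
  A space is given by its set of functions and its (semi-, for \<open>L\<^sup>q\<close>) norm; functions that agree
  almost everywhere are not identified, which affects none of the three notions below. They are
  applied to linear maps only.
\<close>

definition bounded_operator ::
  "('a \<Rightarrow> complex) set \<Rightarrow> (('a \<Rightarrow> complex) \<Rightarrow> real) \<Rightarrow>
   ('a \<Rightarrow> complex) set \<Rightarrow> (('a \<Rightarrow> complex) \<Rightarrow> real) \<Rightarrow>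
   (('a \<Rightarrow> complex) \<Rightarrow> ('a \<Rightarrow> complex)) \<Rightarrow> bool" where
  "bounded_operator X normX Y normY T \<longleftrightarrow>
     (\<forall>f\<in>X. T f \<in> Y) \<and> (\<exists>C. \<forall>f\<in>X. normY (T f) \<le> C * normX f)"

definition operator_norm ::
  "('a \<Rightarrow> complex) set \<Rightarrow> (('a \<Rightarrow> complex) \<Rightarrow> real) \<Rightarrow> (('a \<Rightarrow> complex) \<Rightarrow> real) \<Rightarrow>
   (('a \<Rightarrow> complex) \<Rightarrow> ('a \<Rightarrow> complex)) \<Rightarrow> real" where
  "operator_norm X normX normY T = Inf {C. 0 \<le> C \<and> (\<forall>f\<in>X. normY (T f) \<le> C * normX f)}"

definition compact_operator ::
  "('a \<Rightarrow> complex) set \<Rightarrow> (('a \<Rightarrow> complex) \<Rightarrow> real) \<Rightarrow>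
   ('a \<Rightarrow> complex) set \<Rightarrow> (('a \<Rightarrow> complex) \<Rightarrow> real) \<Rightarrow>
   (('a \<Rightarrow> complex) \<Rightarrow> ('a \<Rightarrow> complex)) \<Rightarrow> bool" where
  "compact_operator X normX Y normY T \<longleftrightarrow>
     (\<forall>f\<in>X. T f \<in> Y) \<and>
     (\<forall>s. (\<forall>k. s k \<in> X) \<and> (\<exists>B. \<forall>k. normX (s k) \<le> B) \<longrightarrow>
        (\<exists>(r :: nat \<Rightarrow> nat) g. strict_mono r \<and> g \<in> Y \<and>
           (\<lambda>k. normY (\<lambda>x. T (s (r k)) x - g x)) \<longlonglongrightarrow> 0))"

section \<open>Toeplitz operators\<close>

definition toeplitz_admissible :: "real \<Rightarrow> (complex ^ 'n) measure \<Rightarrow> bool" where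
  "toeplitz_admissible \<alpha> \<mu> \<longleftrightarrow>
     sets \<mu> = sets borel \<and>
     (\<forall>z. (\<integral>\<^sup>+ w. ennreal ((norm (fock_kernel \<alpha> w z))\<^sup>2 * exp (- \<alpha> * (norm w)\<^sup>2)) \<partial>\<mu>) < \<infinity>)"

definition toeplitz_integrand ::
  "real \<Rightarrow> (complex ^ 'n \<Rightarrow> complex) \<Rightarrow> complex ^ 'n \<Rightarrow> complex ^ 'n \<Rightarrow> complex" where
  "toeplitz_integrand \<alpha> f z w =
     fock_kernel \<alpha> w z * f w * of_real (exp (- \<alpha> * (norm w)\<^sup>2))"

definition toeplitz ::
  "real \<Rightarrow> (complex ^ 'n) measure \<Rightarrow> (complex ^ 'n \<Rightarrow> complex) \<Rightarrow> (complex ^ 'n \<Rightarrow> complex)" where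
  "toeplitz \<alpha> \<mu> f = (\<lambda>z. LINT w|\<mu>. toeplitz_integrand \<alpha> f z w)"

definition toeplitz_converges :: "real \<Rightarrow> (complex ^ 'n) measure \<Rightarrow> ennreal \<Rightarrow> bool" where
  "toeplitz_converges \<alpha> \<mu> p \<longleftrightarrow>
     (\<forall>f\<in>fock_space \<alpha> p. \<forall>z. integrable \<mu> (toeplitz_integrand \<alpha> f z))"

definition toeplitz_bounded ::
  "real \<Rightarrow> (complex ^ 'n) measure \<Rightarrow> ennreal \<Rightarrow> ennreal \<Rightarrow> bool" where
  "toeplitz_bounded \<alpha> \<mu> p r \<longleftrightarrow>
     toeplitz_converges \<alpha> \<mu> p \<and>
     bounded_operator (fock_space \<alpha> p) (fock_norm \<alpha> p) (fock_space \<alpha> r) (fock_norm \<alpha> r)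
       (toeplitz \<alpha> \<mu>)"

definition toeplitz_compact ::
  "real \<Rightarrow> (complex ^ 'n) measure \<Rightarrow> ennreal \<Rightarrow> ennreal \<Rightarrow> bool" where
  "toeplitz_compact \<alpha> \<mu> p r \<longleftrightarrow>
     toeplitz_converges \<alpha> \<mu> p \<and>
     compact_operator (fock_space \<alpha> p) (fock_norm \<alpha> p) (fock_space \<alpha> r) (fock_norm \<alpha> r)
       (toeplitz \<alpha> \<mu>)"

definition toeplitz_norm ::
  "real \<Rightarrow> (complex ^ 'n) measure \<Rightarrow> ennreal \<Rightarrow> ennreal \<Rightarrow> real" where
  "toeplitz_norm \<alpha> \<mu> p r =
     operator_norm (fock_space \<alpha> p) (fock_norm \<alpha> p) (fock_norm \<alpha> r) (toeplitz \<alpha> \<mu>)"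

section \<open>Fock--Carleson measures\<close>

definition fock_carleson :: "real \<Rightarrow> ennreal \<Rightarrow> real \<Rightarrow> (complex ^ 'n) measure \<Rightarrow> bool" where
  "fock_carleson \<alpha> p q \<mu> \<longleftrightarrow>
     (\<exists>C. \<forall>f\<in>fock_space \<alpha> p.
        (\<integral>\<^sup>+ z. ennreal (norm (f z) powr q * exp (- (\<alpha> * q / 2) * (norm z)\<^sup>2)) \<partial>\<mu>)
          \<le> ennreal (C * fock_norm \<alpha> p f powr q))"

definition weighted_measure :: "real \<Rightarrow> real \<Rightarrow> (complex ^ 'n) measure \<Rightarrow> (complex ^ 'n) measure"
  where "weighted_measure \<alpha> q \<mu> = density \<mu> (\<lambda>z. ennreal (exp (- (q * \<alpha> * (norm z)\<^sup>2 / 2))))"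

definition Lq_space :: "real \<Rightarrow> 'a measure \<Rightarrow> ('a \<Rightarrow> complex) set" where
  "Lq_space q M = {f \<in> borel_measurable M. integrable M (\<lambda>x. norm (f x) powr q)}"

definition Lq_norm :: "real \<Rightarrow> 'a measure \<Rightarrow> ('a \<Rightarrow> complex) \<Rightarrow> real" where
  "Lq_norm q M f = (LINT x|M. norm (f x) powr q) powr (1 / q)"

definition vanishing_fock_carleson ::
  "real \<Rightarrow> ennreal \<Rightarrow> real \<Rightarrow> (complex ^ 'n) measure \<Rightarrow> bool" where
  "vanishing_fock_carleson \<alpha> p q \<mu> \<longleftrightarrow>
     compact_operator (fock_space \<alpha> p) (fock_norm \<alpha> p)
       (Lq_space q (weighted_measure \<alpha> q \<mu>)) (Lq_norm q (weighted_measure \<alpha> q \<mu>)) (\<lambda>f. f)"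

text \<open>
  The operator norm of the embedding \<open>I\<^sub>\<mu>\<close>. It is homogeneous of degree \<open>1/q\<close> in \<open>\<mu>\<close>, and its \<open>q\<close>-th
  power is the least nonnegative constant admissible in \<open>fock_carleson\<close>. The Toeplitz operator is
  homogeneous of degree 1 in \<open>\<mu>\<close>, so \<open>\<mu>\<close>-independent comparisons involve this \<open>q\<close>-th power.
\<close>

definition embedding_norm ::
  "real \<Rightarrow> ennreal \<Rightarrow> real \<Rightarrow> (complex ^ 'n) measure \<Rightarrow> real" where
  "embedding_norm \<alpha> p q \<mu> =
     operator_norm (fock_space \<alpha> p) (fock_norm \<alpha> p) (Lq_norm q (weighted_measure \<alpha> q \<mu>)) (\<lambda>f. f)"

definition comparable :: "real \<Rightarrow> real \<Rightarrow> real \<Rightarrow> bool" where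
  "comparable C A B \<longleftrightarrow> inverse C * B \<le> A \<and> A \<le> C * B"

definition admissible_exponent :: "ennreal \<Rightarrow> real \<Rightarrow> bool" where
  "admissible_exponent p q \<longleftrightarrow> (if p = \<infinity> then 1 \<le> q else enn2real p \<le> q)"

end

theory Submission
  imports Defs "HOL-Probability.Distributions" "HOL-Complex_Analysis.Great_Picard"
    "HOL-Real_Asymp.Real_Asymp"
begin

unbundle no fps_syntax

text \<open>
Everything is expressed through two quantities. For an entire \<open>f\<close> the weighted modulus
\<open>wt \<alpha> f z = \<bar>f z\<bar> exp (- \<alpha>/2 \<bar>z\<bar>\<^sup>2)\<close> is the function whose Lebesgue norms are the Fock norms, and for a
measure \<open>\<mu>\<close> the Berezin transform \<open>berezin \<gamma> \<mu> z = \<integral> exp (- \<gamma> \<bar>w - z\<bar>\<^sup>2) d\<mu>(w)\<close> plays the part that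
averages over balls play elsewhere; admissibility says exactly that \<open>berezin \<alpha> \<mu>\<close> is finite.

Three facts about them carry the proof. First, the entire function \<open>f(u + z) exp (- \<alpha> \<langle>z, u\<rangle>)\<close> of \<open>z\<close> has the
mean value property against any Gaussian, because Lebesgue measure is rotation invariant. For every
\<open>\<gamma> > 0\<close> this gives \<open>wt \<alpha> f u \<le> C \<integral> wt \<alpha> f z exp (- \<gamma> \<bar>z - u\<bar>\<^sup>2) dz\<close>
(lemma \<open>wt_le_gauss_mean\<close>), and by Fubini \<open>\<integral> wt \<alpha> f d\<mu> \<le> C \<integral> wt \<alpha> f \<cdot> berezin \<gamma> \<mu> dz\<close>. Second, since
\<open>\<bar>K\<^sub>w(z)\<bar> exp (- \<alpha>/2 (\<bar>z\<bar>\<^sup>2 + \<bar>w\<bar>\<^sup>2)) = exp (- \<alpha>/2 \<bar>z - w\<bar>\<^sup>2)\<close>, Fubini also gives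
\<open>\<integral> wt \<alpha> (T\<^sub>\<mu> f) dz \<le> C \<integral> wt \<alpha> f d\<mu>\<close> (lemma \<open>toeplitz_into_fock_1\<close>): an operator into \<open>F\<^sup>1\<close> is controlled
by the embedding into \<open>L\<^sup>1\<close>. Third, the normalised kernel \<open>k\<^sub>a\<close>, whose weighted modulus is a Gaussian
centred at \<open>a\<close>, satisfies \<open>wt \<alpha> (T\<^sub>\<mu> k\<^sub>a) a = berezin \<alpha> \<mu> a\<close>.

For operators out of \<open>F\<^sup>1\<close> all the boundedness conditions are equivalent to boundedness of the Berezin
transform. Testing on \<open>k\<^sub>a\<close> bounds \<open>berezin \<gamma> \<mu>\<close> for some \<open>\<gamma>\<close>, and boundedness does not depend
on \<open>\<gamma>\<close> (lemma \<open>berezin_compare\<close>); the converse comes from the first two facts and the inclusions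
\<open>F\<^sup>1 \<subseteq> F\<^sup>p \<subseteq> F\<^sup>\<infinity>\<close>. In the same way all the compactness conditions are equivalent to
\<open>berezin \<alpha> \<mu> z\<close> tending to zero at infinity: the kernels \<open>k\<^sub>a\<close> tend to zero pointwise as \<open>a\<close> goes to infinity,
and conversely every bounded sequence has a pointwise convergent subsequence (lemma \<open>fock_normal_family\<close>).

For operators from \<open>F\<^sup>p\<close> with \<open>p > 1\<close> into \<open>F\<^sup>1\<close> the point is that boundedness forces the Berezin transform
into \<open>L\<^sup>q\<close> for the conjugate exponent \<open>q\<close>. The operator is tested on \<open>f = \<Sum> \<epsilon>\<^sub>a b\<^sub>a\<^sup>(\<^sup>q\<^sup>-\<^sup>1\<^sup>) k\<^sub>a\<close> over a finite set of
lattice points, where \<open>b\<^sub>a = berezin \<alpha> \<mu> a\<close>. For a good choice of signs the off-diagonal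
terms help, so sampling \<open>T\<^sub>\<mu> f\<close> at the lattice points yields \<open>\<Sum> b\<^sub>a\<^sup>q \<le> C \<parallel>T\<^sub>\<mu>\<parallel> \<parallel>f\<parallel>\<close>, while \<open>\<parallel>f\<parallel>\<close> is at most a
constant times the \<open>p\<close>-th root of \<open>\<Sum> b\<^sub>a\<^sup>q\<close> (lemma \<open>lattice_berezin_sum\<close>). Hoelder's inequality
then gives the Carleson estimate. Since \<open>q\<close> is finite, the integrability of \<open>berezin\<^sup>q\<close> also supplies a
dominating function for pointwise convergent sequences, and compactness is automatic.
\<close>

abbreviation (input) gauss :: "real \<Rightarrow> 'a::real_normed_vector \<Rightarrow> 'a \<Rightarrow> real" where
  "gauss \<gamma> x y \<equiv> exp (- \<gamma> * (norm (x - y))\<^sup>2)"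

section \<open>Lebesgue measure and linear isometries\<close>

lemma nn_integral_lborel_shift:
  fixes g :: "'a::euclidean_space \<Rightarrow> ennreal"
  assumes [measurable]: "g \<in> borel_measurable borel"
  shows "(\<integral>\<^sup>+ x. g (x + a) \<partial>lborel) = (\<integral>\<^sup>+ x. g x \<partial>lborel)"
proof -
  have "(\<integral>\<^sup>+ x. g x \<partial>lborel) = (\<integral>\<^sup>+ x. g x \<partial>distr lborel borel ((+) a))"
    by (simp add: lborel_distr_plus)
  also have "\<dots> = (\<integral>\<^sup>+ x. g (x + a) \<partial>lborel)"
    by (subst nn_integral_distr) (auto simp: add.commute)
  finally show ?thesis ..
qed

lemma nn_integral_lborel_reflect:
  fixes g :: "'a::euclidean_space \<Rightarrow> ennreal"
  assumes [measurable]: "g \<in> borel_measurable borel"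
  shows "(\<integral>\<^sup>+ x. g (a - x) \<partial>lborel) = (\<integral>\<^sup>+ x. g x \<partial>lborel)"
proof -
  have "(lborel :: 'a measure) = distr lborel borel (\<lambda>x. a + (-1) *\<^sub>R x)"
    by (subst lborel_affine[of "-1" a]) (auto simp: density_1)
  then have "(\<integral>\<^sup>+ x. g x \<partial>lborel) = (\<integral>\<^sup>+ x. g x \<partial>distr lborel borel (\<lambda>x. a + (-1) *\<^sub>R x))"
    by simp
  also have "\<dots> = (\<integral>\<^sup>+ x. g (a - x) \<partial>lborel)"
    by (subst nn_integral_distr) auto
  finally show ?thesis ..
qed

text \<open>
Uniqueness of Haar measure, specialised. For \<open>f\<close> the indicator of the unit ball, which \<open>U\<close> preserves,
translation and reflection invariance turn the product of the integrals of \<open>f\<close> and \<open>g\<close> into the product of the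
integrals of \<open>f\<close> and \<open>g \<circ> U\<close>; dividing by the volume of the ball gives the claim.
\<close>
lemma nn_integral_lborel_isometry:
  fixes U :: "'a::euclidean_space \<Rightarrow> 'a" and g :: "'a \<Rightarrow> ennreal"
  assumes lin: "linear U" and iso: "\<And>x. norm (U x) = norm x"
    and g[measurable]: "g \<in> borel_measurable borel"
  shows "(\<integral>\<^sup>+ x. g (U x) \<partial>lborel) = (\<integral>\<^sup>+ x. g x \<partial>lborel)"
proof -
  interpret L: linear U by fact
  have "inj U"
    using iso by (metis linear_injective_0[OF lin] norm_eq_zero)
  then have "surj U"
    using linear_injective_imp_surjective[OF lin] by blast
  then obtain V where V: "\<And>y. U (V y) = y"
    by (metis surj_f_inv_f)
  have contU: "continuous_on UNIV U"
    using lin linear_continuous_on linear_linear by blast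
  then have mU[measurable]: "U \<in> borel_measurable borel"
    by (rule borel_measurable_continuous_onI)
  \<comment> \<open>invariant under \<open>U\<close>, with an integral that is positive and finite\<close>
  define f :: "'a \<Rightarrow> ennreal" where "f = indicator (ball 0 1)"
  have f[measurable]: "f \<in> borel_measurable borel"
    unfolding f_def by (intro borel_measurable_indicator) simp
  have fU: "f (U x) = f x" for x
    by (simp add: f_def iso indicator_def)
  have fI: "(\<integral>\<^sup>+ x. f x \<partial>lborel) = emeasure lborel (ball (0::'a) 1)"
    unfolding f_def by simp
  have c: "emeasure lborel (ball (0::'a) 1) \<noteq> 0" "emeasure lborel (ball (0::'a) 1) \<noteq> \<infinity>"
  proof -
    have "emeasure lborel (ball (0::'a) 1) < \<infinity>"
      by (rule emeasure_bounded_finite) auto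
    then show "emeasure lborel (ball (0::'a) 1) \<noteq> \<infinity>" by simp
    show "emeasure lborel (ball (0::'a) 1) \<noteq> 0"
      using content_ball_pos[of 1 "0::'a"] by (auto simp: measure_def)
  qed
  have "(\<integral>\<^sup>+ x. f x \<partial>lborel) * (\<integral>\<^sup>+ y. g y \<partial>lborel) = (\<integral>\<^sup>+ x. f (U x) * (\<integral>\<^sup>+ y. g y \<partial>lborel) \<partial>lborel)"
    by (subst nn_integral_multc) (simp_all add: fU)
  also have "\<dots> = (\<integral>\<^sup>+ x. f (U x) * (\<integral>\<^sup>+ y. g (y + U x) \<partial>lborel) \<partial>lborel)"
    by (subst nn_integral_lborel_shift[OF g]) (rule refl)
  also have "\<dots> = (\<integral>\<^sup>+ x. (\<integral>\<^sup>+ y. f (U x) * g (y + U x) \<partial>lborel) \<partial>lborel)"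
    by (subst nn_integral_cmult) auto
  also have "\<dots> = (\<integral>\<^sup>+ y. (\<integral>\<^sup>+ x. f (U x) * g (y + U x) \<partial>lborel) \<partial>lborel)"
    by (rule lborel_pair.Fubini') measurable
  also have "\<dots> = (\<integral>\<^sup>+ y. (\<integral>\<^sup>+ x. f (U (x + - V y)) * g (y + U (x + - V y)) \<partial>lborel) \<partial>lborel)"
  proof (rule nn_integral_cong)
    fix y :: 'a
    show "(\<integral>\<^sup>+ x. f (U x) * g (y + U x) \<partial>lborel) =
        (\<integral>\<^sup>+ x. f (U (x + - V y)) * g (y + U (x + - V y)) \<partial>lborel)"
      by (rule nn_integral_lborel_shift[symmetric]) measurable
  qed
  also have "\<dots> = (\<integral>\<^sup>+ y. (\<integral>\<^sup>+ x. f (U x - y) * g (U x) \<partial>lborel) \<partial>lborel)"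
    by (simp add: L.diff V)
  also have "\<dots> = (\<integral>\<^sup>+ x. (\<integral>\<^sup>+ y. f (U x - y) * g (U x) \<partial>lborel) \<partial>lborel)"
    by (rule lborel_pair.Fubini'[symmetric]) measurable
  also have "\<dots> = (\<integral>\<^sup>+ x. (\<integral>\<^sup>+ y. f y \<partial>lborel) * g (U x) \<partial>lborel)"
    by (subst nn_integral_multc) (auto simp: nn_integral_lborel_reflect[OF f])
  also have "\<dots> = (\<integral>\<^sup>+ x. f x \<partial>lborel) * (\<integral>\<^sup>+ x. g (U x) \<partial>lborel)"
    by (subst nn_integral_cmult) auto
  finally show ?thesis
    using c unfolding fI by (simp add: ennreal_mult_cancel_left)
qed

lemma lborel_distr_isometry:
  fixes U :: "'a::euclidean_space \<Rightarrow> 'a"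
  assumes lin: "linear U" and iso: "\<And>x. norm (U x) = norm x"
  shows "distr lborel borel U = lborel"
proof -
  have "continuous_on UNIV U"
    using lin linear_continuous_on linear_linear by blast
  then have mU[measurable]: "U \<in> borel_measurable borel"
    by (rule borel_measurable_continuous_onI)
  show ?thesis
  proof (rule measure_eqI)
    fix A assume "A \<in> sets (distr lborel borel U)"
    then have A[measurable]: "A \<in> sets borel" by simp
    have "emeasure (distr lborel borel U) A = (\<integral>\<^sup>+ x. indicator A x \<partial>distr lborel borel U)"
      by simp
    also have "\<dots> = (\<integral>\<^sup>+ x. indicator A (U x) \<partial>lborel)"
      by (subst nn_integral_distr) auto
    also have "\<dots> = (\<integral>\<^sup>+ x. indicator A x \<partial>lborel)"
      by (rule nn_integral_lborel_isometry[OF lin iso]) measurable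
    finally show "emeasure (distr lborel borel U) A = emeasure lborel A" by simp
  qed simp
qed

section \<open>Gaussian integrals\<close>

lemma gauss_nn_integral_finite:
  fixes u :: "'a::euclidean_space"
  assumes "\<gamma> > 0"
  shows "(\<integral>\<^sup>+ z. ennreal (gauss \<gamma> z u) \<partial>lborel) < \<infinity>"
proof -
  define \<sigma> where "\<sigma> = sqrt (1 / (2 * \<gamma>))"
  have \<sigma>: "\<sigma> > 0" "2 * \<sigma>\<^sup>2 = 1 / \<gamma>"
    using assms by (auto simp: \<sigma>_def)
  have "integrable lborel (\<lambda>x::real. exp (- \<gamma> * x\<^sup>2))"
  proof -
    have "integrable lborel (\<lambda>x::real. sqrt (2 * pi * \<sigma>\<^sup>2) * normal_density 0 \<sigma> x)"
      using \<sigma> by (intro integrable_mult_right) auto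
    also have "(\<lambda>x::real. sqrt (2 * pi * \<sigma>\<^sup>2) * normal_density 0 \<sigma> x) = (\<lambda>x. exp (- \<gamma> * x\<^sup>2))"
      using \<sigma> by (auto simp: normal_density_def fun_eq_iff)
    finally show ?thesis .
  qed
  then have 1: "(\<integral>\<^sup>+ x. ennreal (exp (- \<gamma> * (x::real)\<^sup>2)) \<partial>lborel) < \<infinity>"
    by (simp add: integrable_iff_bounded)
  have "(\<integral>\<^sup>+ z. ennreal (gauss \<gamma> z u) \<partial>lborel)
      = (\<integral>\<^sup>+ z. ennreal (gauss \<gamma> (z + u) u) \<partial>lborel)"
    by (rule nn_integral_lborel_shift[symmetric]) measurable
  also have "\<dots> = (\<integral>\<^sup>+ z. (\<Prod>b\<in>Basis. ennreal (exp (- \<gamma> * ((z::'a) \<bullet> b)\<^sup>2))) \<partial>lborel)"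
  proof (rule nn_integral_cong)
    fix z :: 'a
    have "exp (- \<gamma> * (norm z)\<^sup>2) = exp (\<Sum>b\<in>Basis. - \<gamma> * (z \<bullet> b)\<^sup>2)"
      by (subst power2_norm_eq_inner, subst euclidean_inner)
        (simp add: sum_distrib_left sum_negf power2_eq_square)
    also have "\<dots> = (\<Prod>b\<in>Basis. exp (- \<gamma> * (z \<bullet> b)\<^sup>2))"
      by (simp add: exp_sum)
    finally show "ennreal (gauss \<gamma> (z + u) u) = (\<Prod>b\<in>Basis. ennreal (exp (- \<gamma> * (z \<bullet> b)\<^sup>2)))"
      by (simp add: prod_ennreal)
  qed
  also have "\<dots> = (\<Prod>b\<in>(Basis::'a set). (\<integral>\<^sup>+ x. ennreal (exp (- \<gamma> * x\<^sup>2)) \<partial>lborel))"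
    by (rule nn_integral_lborel_prod) auto
  also have "\<dots> < \<infinity>"
    using 1 by (simp add: ennreal_prod_eq_top power_less_top_ennreal)
  finally show ?thesis .
qed

lemma gauss_integrable:
  fixes u :: "'a::euclidean_space"
  assumes "\<gamma> > 0"
  shows "integrable lborel (\<lambda>z. gauss \<gamma> z u)"
  using gauss_nn_integral_finite[OF assms, of u] by (auto simp: integrable_iff_bounded)

text \<open>
The constant \<open>(\<pi> / \<gamma>)\<^sup>d\<^sup>/\<^sup>2\<close> in real dimension \<open>d\<close>.
\<close>
definition gauss_mass :: "'a::euclidean_space itself \<Rightarrow> real \<Rightarrow> real" where
  "gauss_mass _ \<gamma> = (LINT z|lborel. exp (- \<gamma> * (norm (z::'a))\<^sup>2))"

lemma gauss_nn_integral:
  fixes u :: "'a::euclidean_space"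
  assumes "\<gamma> > 0"
  shows "(\<integral>\<^sup>+ z. ennreal (gauss \<gamma> z u) \<partial>lborel) = ennreal (gauss_mass TYPE('a) \<gamma>)"
proof -
  have "(\<integral>\<^sup>+ z. ennreal (gauss \<gamma> z u) \<partial>lborel)
      = (\<integral>\<^sup>+ z. ennreal (gauss \<gamma> (z + u) u) \<partial>lborel)"
    by (rule nn_integral_lborel_shift[symmetric]) measurable
  also have "\<dots> = ennreal (gauss_mass TYPE('a) \<gamma>)"
    unfolding gauss_mass_def
    using gauss_integrable[OF assms, of "0::'a"] by (simp add: nn_integral_eq_integral)
  finally show ?thesis .
qed

lemma gauss_mass_pos:
  assumes "\<gamma> > 0"
  shows "gauss_mass TYPE('a::euclidean_space) \<gamma> > 0"
proof -
  have "gauss_mass TYPE('a) \<gamma> \<ge> 0"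
    unfolding gauss_mass_def by simp
  moreover have "gauss_mass TYPE('a) \<gamma> \<noteq> 0"
  proof
    assume "gauss_mass TYPE('a) \<gamma> = 0"
    then have "(\<integral>\<^sup>+ z. ennreal (gauss \<gamma> z (0::'a)) \<partial>lborel) = 0"
      by (subst gauss_nn_integral[OF assms]) simp
    then have "AE z::'a in lborel. ennreal (gauss \<gamma> z 0) = 0"
      by (subst (asm) nn_integral_0_iff_AE) auto
    then have "AE z::'a in lborel. False" by simp
    then show False
      using AE_iff_measurable[of "UNIV::'a set" lborel "\<lambda>_. False"] by simp
  qed
  ultimately show ?thesis by simp
qed

lemma gauss_integral:
  fixes u :: "'a::euclidean_space"
  assumes "\<gamma> > 0"
  shows "(LINT z|lborel. gauss \<gamma> z u) = gauss_mass TYPE('a) \<gamma>"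
  using gauss_nn_integral[OF assms, of u] gauss_mass_pos[OF assms, where 'a='a]
  by (subst integral_eq_nn_integral) auto

section \<open>The Hermitian form and entire functions\<close>

lemma herm_add_left: "herm (z + z') w = herm z w + herm z' w"
  by (simp add: herm_def algebra_simps sum.distrib)
lemma herm_scale_left: "herm (c *s z) w = c * herm z w"
  by (simp add: herm_def sum_distrib_left mult.assoc)
lemma herm_minus_left: "herm (- z) w = - herm z w"
  by (simp add: herm_def sum_negf)
lemma herm_diff_left: "herm (z - z') w = herm z w - herm z' w"
  using herm_add_left[of z "- z'" w] by (simp add: herm_minus_left)
lemma herm_scaleR_left: "herm (r *\<^sub>R z) w = r *\<^sub>R herm z w"
  by (simp add: herm_def scaleR_sum_right)
lemma cnj_herm: "cnj (herm z w) = herm w z"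
  by (simp add: herm_def mult.commute)
lemma Re_herm: "Re (herm z w) = z \<bullet> w"
  by (simp add: herm_def inner_vec_def inner_complex_def)
lemma herm_self: "herm z z = of_real ((norm z)\<^sup>2)"
proof (rule complex_eqI)
  show "Re (herm z z) = Re (of_real ((norm z)\<^sup>2))"
    by (simp add: Re_herm power2_norm_eq_inner)
  have "Im (herm z z) = - Im (herm z z)"
    using arg_cong[OF cnj_herm[of z z], of Im] by simp
  then show "Im (herm z z) = Im (of_real ((norm z)\<^sup>2))" by simp
qed
lemma norm_herm_le: "norm (herm z w) \<le> norm z * norm w"
proof -
  have "norm (herm z w) \<le> (\<Sum>j\<in>UNIV. norm (z $ j) * norm (w $ j))"
    unfolding herm_def by (rule order_trans[OF norm_sum]) (simp add: norm_mult)
  also have "\<dots> \<le> norm z * norm w"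
    unfolding norm_vec_def using L2_set_mult_ineq[of "\<lambda>j. norm (z $ j)" "\<lambda>j. norm (w $ j)" UNIV]
    by simp
  finally show ?thesis .
qed
lemma norm_vec_scale: "norm (c *s (z::complex^'n)) = norm c * norm z"
  by (simp add: norm_vec_def L2_set_def norm_mult power_mult_distrib sum_distrib_left[symmetric] real_sqrt_mult)

lemma bounded_linear_herm: "bounded_linear (\<lambda>z. herm z w)"
  by (rule bounded_linear_intro[where K = "norm w"])
    (auto simp: herm_add_left herm_scaleR_left norm_herm_le)
lemma continuous_on_herm [continuous_intros]:
  fixes f g :: "'a::topological_space \<Rightarrow> complex^'n"
  assumes "continuous_on A f" "continuous_on A g"
  shows "continuous_on A (\<lambda>x. herm (f x) (g x))"
  unfolding herm_def by (intro continuous_intros assms)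

lemma borel_measurable_herm [measurable]:
  fixes f g :: "'a \<Rightarrow> complex^'n"
  assumes [measurable]: "f \<in> borel_measurable M" "g \<in> borel_measurable M"
  shows "(\<lambda>x. herm (f x) (g x)) \<in> borel_measurable M"
proof -
  have 1: "continuous_on UNIV (\<lambda>z::(complex^'n) \<times> (complex^'n). herm (fst z) (snd z))"
    by (intro continuous_intros)
  have "(\<lambda>z::(complex^'n) \<times> (complex^'n). herm (fst z) (snd z)) \<in> borel_measurable borel"
    by (rule borel_measurable_continuous_onI[OF 1])
  then have "(\<lambda>x. herm (fst (f x, g x)) (snd (f x, g x))) \<in> borel_measurable M"
    by (rule measurable_compose[rotated]) measurable
  then show ?thesis by simp
qed

lemma norm_fock_kernel: "norm (fock_kernel \<alpha> w z) = exp (\<alpha> * (z \<bullet> w))"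
  by (simp add: fock_kernel_def Re_herm)

lemma borel_measurable_fock_kernel [measurable]:
  fixes f g :: "'a \<Rightarrow> complex^'n"
  assumes [measurable]: "f \<in> borel_measurable M" "g \<in> borel_measurable M"
  shows "(\<lambda>x. fock_kernel \<alpha> (f x) (g x)) \<in> borel_measurable M"
  unfolding fock_kernel_def by measurable

lemma entire_continuous_on: "entire f \<Longrightarrow> continuous_on A f"
  unfolding entire_def
  by (meson continuous_at_imp_continuous_on has_derivative_continuous)

lemma entire_measurable: "entire f \<Longrightarrow> f \<in> borel_measurable borel"
  by (simp add: entire_continuous_on borel_measurable_continuous_onI)

text \<open>
Restriction to a complex line makes the one-variable theory available.
\<close>
lemma entire_along_line:
  fixes f :: "complex^'n \<Rightarrow> complex"
  assumes "entire f"
  shows "(\<lambda>c. f (u + c *s z)) holomorphic_on UNIV"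
proof -
  have "\<exists>d. ((\<lambda>c. f (u + c *s z)) has_field_derivative d) (at c)" for c
  proof -
    obtain L where L: "(f has_derivative L) (at (u + c *s z))" "\<And>c v. L (c *s v) = c * L v"
      using assms unfolding entire_def by blast
    have "bounded_linear (\<lambda>c. c *s z)"
      by (rule bounded_linear_intro[where K = "norm z"])
        (auto simp: norm_vec_scale vec_eq_iff algebra_simps)
    then have "((\<lambda>c. u + c *s z) has_derivative (\<lambda>c. c *s z)) (at c)"
      by (auto intro!: derivative_eq_intros bounded_linear_imp_has_derivative)
    from has_derivative_compose[OF this L(1)]
    have "((\<lambda>c. f (u + c *s z)) has_derivative (\<lambda>h. h * L z)) (at c)"
      by (simp add: L(2))
    moreover have "(\<lambda>h. h * L z) = (*) (L z)"
      by (auto simp: fun_eq_iff)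
    ultimately have "((\<lambda>c. f (u + c *s z)) has_field_derivative (L z)) (at c)"
      unfolding has_field_derivative_def by simp
    then show ?thesis ..
  qed
  then show ?thesis
    unfolding holomorphic_on_def field_differentiable_def by blast
qed

text \<open>
The circle carries the parameter \<open>t \<in> [0, 1]\<close>, whose measure has total mass 1, so that Cauchy's formula
for the unit circle is a mean value without further constants.
\<close>
lemma circle_mean_value:
  assumes "\<phi> holomorphic_on UNIV"
  shows "(LINT t|restrict_space lborel {0..1}. \<phi> (exp (2 * of_real pi * \<i> * of_real t))) = \<phi> 0"
proof -
  let ?e = "\<lambda>t::real. exp (2 * of_real pi * \<i> * of_real t)"
  have cont: "continuous_on A \<phi>" for A
    by (rule continuous_on_subset[OF holomorphic_on_imp_continuous_on[OF assms]]) simp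
  have "((\<lambda>u. \<phi> u / (u - 0)) has_contour_integral (2 * of_real pi * \<i> * \<phi> 0)) (circlepath 0 1)"
    by (rule Cauchy_integral_circlepath)
      (auto intro: cont holomorphic_on_subset[OF assms])
  then have "((\<lambda>t. \<phi> (circlepath 0 1 t) / circlepath 0 1 t *
      vector_derivative (circlepath 0 1) (at t within {0..1})) has_integral (2 * of_real pi * \<i> * \<phi> 0)) {0..1}"
    by (simp add: has_contour_integral_def)
  then have "((\<lambda>t. 2 * of_real pi * \<i> * \<phi> (?e t)) has_integral (2 * of_real pi * \<i> * \<phi> 0)) {0..1}"
  proof (rule has_integral_eq[rotated])
    fix t :: real assume "t \<in> {0..1}"
    then have "vector_derivative (circlepath 0 1) (at t within {0..1}) = 2 * of_real pi * \<i> * ?e t"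
      by (simp add: vector_derivative_circlepath01)
    moreover have "circlepath 0 1 t = ?e t" by (simp add: circlepath)
    ultimately show "\<phi> (circlepath 0 1 t) / circlepath 0 1 t *
        vector_derivative (circlepath 0 1) (at t within {0..1}) = 2 * of_real pi * \<i> * \<phi> (?e t)"
      by simp
  qed
  then have "((\<lambda>t. (1 / (2 * of_real pi * \<i>)) * (2 * of_real pi * \<i> * \<phi> (?e t))) has_integral
      (1 / (2 * of_real pi * \<i>)) * (2 * of_real pi * \<i> * \<phi> 0)) {0..1}"
    by (rule has_integral_mult_right)
  then have 1: "((\<lambda>t. \<phi> (?e t)) has_integral \<phi> 0) {0..1}"
    by simp
  have 2: "continuous_on {0..1} (\<lambda>t. \<phi> (?e t))"
    by (intro continuous_on_compose2[OF cont[of UNIV]] continuous_intros) auto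
  have "set_integrable lborel {0..1} (\<lambda>t. \<phi> (?e t))"
    by (rule borel_integrable_compact[unfolded set_integrable_def[symmetric]]) (auto intro: 2)
  from set_borel_integral_eq_integral(2)[OF this] integral_unique[OF 1]
  have "(LINT t:{0..1}|lborel. \<phi> (?e t)) = \<phi> 0"
    by (rule trans)
  moreover have "(LINT t|restrict_space lborel {0..1}. \<phi> (?e t)) = (LINT t:{0..1}|lborel. \<phi> (?e t))"
    unfolding set_lebesgue_integral_def by (rule integral_restrict_space) simp
  ultimately show ?thesis by (rule trans[rotated])
qed

section \<open>The Gaussian mean value property\<close>

lemma norm_integral_le:
  fixes f :: "'a \<Rightarrow> 'b::{banach, second_countable_topology}"
  assumes "integrable M f" "integrable M g" "\<And>x. norm (f x) \<le> g x"
  shows "norm (LINT x|M. f x) \<le> (LINT x|M. g x)"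
  by (rule order_trans[OF integral_norm_bound]) (intro integral_mono integrable_norm assms)

lemma entireI:
  assumes "\<And>z. \<exists>L. (f has_derivative L) (at z) \<and> (\<forall>c v. L (c *s v) = c * L v)"
  shows "entire f"
  using assms unfolding entire_def by blast

text \<open>
The weighted modulus: its Lebesgue norms are, up to constants, the Fock norms of \<open>f\<close>.
\<close>
definition wt :: "real \<Rightarrow> (complex ^ 'n \<Rightarrow> complex) \<Rightarrow> complex ^ 'n \<Rightarrow> real" where
  "wt \<alpha> f z = norm (f z) * exp (- (\<alpha> / 2) * (norm z)\<^sup>2)"

lemma wt_nonneg [simp]: "0 \<le> wt \<alpha> f z"
  by (simp add: wt_def)

lemma borel_measurable_wt [measurable (raw)]:
  assumes [measurable]: "f \<in> borel_measurable borel" "g \<in> borel_measurable M"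
  shows "(\<lambda>x. wt \<alpha> f (g x)) \<in> borel_measurable M"
proof -
  have "(\<lambda>x. wt \<alpha> f x) \<in> borel_measurable borel"
    unfolding wt_def by measurable
  then show ?thesis by (rule measurable_compose[rotated]) fact
qed

lemma wt_powr: "wt \<alpha> f z powr q = norm (f z) powr q * exp (- (\<alpha> * q / 2) * (norm z)\<^sup>2)"
  by (simp add: wt_def powr_mult exp_powr_real mult_ac)

text \<open>
The Gaussian is invariant under the rotations \<open>z \<mapsto> e\<^sup>i\<^sup>t z\<close>, so the integrand may be replaced by its
average over \<open>t\<close>. On each complex line that average is a circle mean of a one-variable entire function, hence
its value at the centre. The factor \<open>exp (- \<alpha> \<langle>z, u\<rangle>)\<close> is what turns a translation of
\<open>f\<close> into a translation of its weighted modulus.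
\<close>
lemma gauss_mean_value:
  fixes f :: "complex^'n \<Rightarrow> complex" and u :: "complex^'n"
  assumes f: "entire f"
    and int: "integrable lborel
      (\<lambda>z. f (u + z) * exp (- of_real \<alpha> * herm z u) * of_real (exp (- \<beta> * (norm z)\<^sup>2)))"
  shows "(LINT z|lborel. f (u + z) * exp (- of_real \<alpha> * herm z u) * of_real (exp (- \<beta> * (norm z)\<^sup>2)))
     = of_real (gauss_mass TYPE(complex^'n) \<beta>) * f u"
proof -
  let ?I = "restrict_space lborel {0..1::real}"
  let ?e = "\<lambda>t::real. exp (2 * of_real pi * \<i> * of_real t) :: complex"
  define G where "G z = f (u + z) * exp (- of_real \<alpha> * herm z u) * of_real (exp (- \<beta> * (norm z)\<^sup>2))"
    for z :: "complex^'n"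
  note [measurable] = entire_measurable[OF f]
  have G[measurable]: "G \<in> borel_measurable borel"
    unfolding G_def by measurable
  have ne: "norm (?e t) = 1" for t
    by simp
  have lin: "linear (\<lambda>z::complex^'n. ?e t *s z)" for t
    by (rule linearI) (auto simp: vec_eq_iff algebra_simps)
  have iso: "norm (?e t *s z) = norm z" for t and z :: "complex^'n"
    by (simp add: norm_vec_scale)
  have conte: "continuous_on UNIV (\<lambda>p. ?e (fst p) *s snd p :: complex^'n)"
    unfolding vector_scalar_mult_def by (intro continuous_intros)
  then have me: "(\<lambda>p. ?e (fst p) *s snd p :: complex^'n) \<in> borel_measurable (borel :: (real \<times> (complex^'n)) measure)"
    by (rule borel_measurable_continuous_onI)
  have rot: "integrable lborel (\<lambda>z. h (?e t *s z)) \<and> (LINT z|lborel. h (?e t *s z)) = (LINT z|lborel. h z)"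
    if h: "integrable lborel h" for h :: "complex^'n \<Rightarrow> 'b::{banach, second_countable_topology}" and t
  proof -
    have [measurable]: "(\<lambda>z::complex^'n. ?e t *s z) \<in> borel_measurable borel"
      by (intro borel_measurable_continuous_onI linear_continuous_on) (use lin linear_linear in blast)
    have [measurable]: "h \<in> borel_measurable borel" using h by auto
    note d = lborel_distr_isometry[OF lin[of t] iso[of t]]
    have "integrable (distr lborel borel (\<lambda>z. ?e t *s z)) h"
      unfolding d by (rule h)
    then have "integrable lborel (\<lambda>z. h (?e t *s z))"
      by (subst (asm) integrable_distr_eq) auto
    moreover have "(LINT z|distr lborel borel (\<lambda>z. ?e t *s z). h z) = (LINT z|lborel. h (?e t *s z))"
      by (rule integral_distr) auto
    ultimately show ?thesis unfolding d by simp
  qed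
  interpret I: finite_measure ?I
    by (rule finite_measureI) (simp add: emeasure_restrict_space)
  interpret P: pair_sigma_finite ?I "lborel :: (complex^'n) measure" ..
  have m1: "(\<lambda>(t, z). G (?e t *s z)) \<in> borel_measurable (?I \<Otimes>\<^sub>M lborel)"
  proof -
    have "(\<lambda>p. G (?e (fst p) *s snd p)) \<in> borel_measurable (borel \<Otimes>\<^sub>M borel)"
      unfolding borel_prod by (rule measurable_compose[OF me]) measurable
    then have "(\<lambda>p. G (?e (fst p) *s snd p)) \<in> borel_measurable (lborel \<Otimes>\<^sub>M lborel)"
      by simp
    moreover have "(\<lambda>p. (fst p, snd p)) \<in> measurable (?I \<Otimes>\<^sub>M lborel) (lborel \<Otimes>\<^sub>M (lborel :: (complex^'n) measure))"
      by (intro measurable_Pair measurable_fst'' measurable_snd measurable_compose[OF measurable_fst]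
          measurable_restrict_space1) auto
    ultimately have "(\<lambda>p. G (?e (fst (fst p, snd p)) *s snd (fst p, snd p))) \<in> borel_measurable (?I \<Otimes>\<^sub>M lborel)"
      by (rule measurable_compose[rotated])
    then show ?thesis by (simp add: case_prod_beta')
  qed
  have int': "integrable lborel G" using int unfolding G_def .
  have intP: "integrable (?I \<Otimes>\<^sub>M lborel) (\<lambda>(t, z). G (?e t *s z))"
  proof (rule P.Fubini_integrable[OF m1])
    have "(LINT z|lborel. norm (case (t, z) of (t, z) \<Rightarrow> G (?e t *s z))) = (LINT z|lborel. norm (G z))" for t
      using rot[OF integrable_norm[OF int'], of t] by simp
    then show "integrable ?I (\<lambda>t. LINT z|lborel. norm (case (t, z) of (t, z) \<Rightarrow> G (?e t *s z)))"
      by simp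
    show "AE t in ?I. integrable lborel (\<lambda>z. case (t, z) of (t, z) \<Rightarrow> G (?e t *s z))"
      using rot[OF int'] by simp
  qed
  have inner: "(LINT t|?I. G (?e t *s z)) = f u * of_real (exp (- \<beta> * (norm z)\<^sup>2))" for z
  proof -
    define \<phi> where "\<phi> c = f (u + c *s z) * exp (- of_real \<alpha> * c * herm z u)" for c
    have "\<phi> holomorphic_on UNIV"
      unfolding \<phi>_def by (intro holomorphic_intros entire_along_line f)
    then have 1: "(LINT t|?I. \<phi> (?e t)) = \<phi> 0"
      by (rule circle_mean_value)
    have "(LINT t|?I. G (?e t *s z)) = (LINT t|?I. \<phi> (?e t) * of_real (exp (- \<beta> * (norm z)\<^sup>2)))"
      unfolding G_def \<phi>_def iso by (simp add: herm_scale_left mult_ac)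
    also have "\<dots> = \<phi> 0 * of_real (exp (- \<beta> * (norm z)\<^sup>2))"
      using 1 by simp
    also have "\<phi> 0 = f u"
      by (simp add: \<phi>_def)
    finally show ?thesis .
  qed
  have tot: "(LINT t|?I. (1::real)) = 1"
    by (subst integral_restrict_space) (auto simp: set_lebesgue_integral_def[symmetric])
  have "(LINT z|lborel. G z) = (LINT t|?I. (LINT z|lborel. G z))"
    using tot by simp
  also have "\<dots> = (LINT t|?I. (LINT z|lborel. G (?e t *s z)))"
    using rot[OF int'] by simp
  also have "\<dots> = (LINT z|lborel. (LINT t|?I. G (?e t *s z)))"
    by (rule P.Fubini_integral[OF intP, symmetric])
  also have "\<dots> = (LINT z|lborel. f u * of_real (exp (- \<beta> * (norm (z :: complex^'n))\<^sup>2)))"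
    by (simp add: inner)
  also have "\<dots> = of_real (gauss_mass TYPE(complex^'n) \<beta>) * f u"
    by (simp add: gauss_mass_def)
  finally show ?thesis unfolding G_def .
qed

lemma wt_shift:
  fixes f :: "complex^'n \<Rightarrow> complex" and u z :: "complex^'n"
  shows "norm (f (u + z) * exp (- of_real \<alpha> * herm z u) * of_real (exp (- (\<gamma> + \<alpha> / 2) * (norm z)\<^sup>2)))
    = exp (\<alpha> / 2 * (norm u)\<^sup>2) * (wt \<alpha> f (z + u) * exp (- \<gamma> * (norm z)\<^sup>2))"
proof -
  have "(norm (z + u))\<^sup>2 = (norm z)\<^sup>2 + 2 * (z \<bullet> u) + (norm u)\<^sup>2"
    by (simp add: power2_norm_eq_inner algebra_simps inner_commute)
  then have "exp (- \<alpha> * (z \<bullet> u)) * exp (- (\<gamma> + \<alpha> / 2) * (norm z)\<^sup>2)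
    = exp (\<alpha> / 2 * (norm u)\<^sup>2) * (exp (- (\<alpha> / 2) * (norm (z + u))\<^sup>2) * exp (- \<gamma> * (norm z)\<^sup>2))"
    by (simp only: mult_exp_exp) (simp add: algebra_simps)
  then show ?thesis
    by (simp add: wt_def norm_mult Re_herm mult_ac add.commute)
qed

text \<open>
The subharmonicity of the theory. It holds for every width \<open>\<gamma>\<close>, since the exponent
of the Gaussian in the mean value property is free; \<open>\<gamma> = \<alpha>\<close> and \<open>\<gamma> = 2\<alpha>\<close> will match
Berezin transforms.
\<close>
lemma wt_le_gauss_mean:
  fixes f :: "complex^'n \<Rightarrow> complex"
  assumes f: "entire f" and \<gamma>: "\<gamma> > 0" and \<alpha>: "\<alpha> > 0"
  shows "ennreal (wt \<alpha> f u) \<le> ennreal (inverse (gauss_mass TYPE(complex^'n) (\<gamma> + \<alpha> / 2))) *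
    (\<integral>\<^sup>+ z. ennreal (wt \<alpha> f z * gauss \<gamma> z u) \<partial>lborel)"
proof -
  let ?\<beta> = "\<gamma> + \<alpha> / 2"
  let ?\<kappa> = "gauss_mass TYPE(complex^'n) ?\<beta>"
  let ?N = "\<integral>\<^sup>+ z. ennreal (wt \<alpha> f z * gauss \<gamma> z u) \<partial>lborel"
  let ?G = "\<lambda>z. f (u + z) * exp (- of_real \<alpha> * herm z u) * of_real (exp (- ?\<beta> * (norm z)\<^sup>2))"
  note [measurable] = entire_measurable[OF f]
  have \<kappa>: "?\<kappa> > 0" using gauss_mass_pos \<gamma> \<alpha> by (metis add_pos_pos half_gt_zero)
  have "(\<integral>\<^sup>+ z. ennreal (wt \<alpha> f z * gauss \<gamma> z u) \<partial>lborel)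
      = (\<integral>\<^sup>+ z. ennreal (wt \<alpha> f (z + u) * gauss \<gamma> (z + u) u) \<partial>lborel)"
    by (rule nn_integral_lborel_shift[symmetric]) measurable
  then have N: "(\<integral>\<^sup>+ z. ennreal (wt \<alpha> f (z + u) * exp (- \<gamma> * (norm z)\<^sup>2)) \<partial>lborel) = ?N"
    by simp
  have nG: "(\<integral>\<^sup>+ z. norm (?G z) \<partial>lborel) = ennreal (exp (\<alpha> / 2 * (norm u)\<^sup>2)) * ?N"
    unfolding wt_shift N[symmetric] by (subst nn_integral_cmult[symmetric]) (auto simp: ennreal_mult)
  show ?thesis
  proof (cases "?N < \<infinity>")
    case False
    then have "?N = \<infinity>" using less_top by fastforce
    then show ?thesis using \<kappa> by (simp add: ennreal_mult_top)
  next
    case True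
    have int: "integrable lborel ?G"
      unfolding integrable_iff_bounded nG using True by (auto simp: ennreal_mult_less_top)
    have "ennreal (norm (of_real ?\<kappa> * f u)) \<le> (\<integral>\<^sup>+ z. norm (?G z) \<partial>lborel)"
      using integral_norm_bound_ennreal[OF int] unfolding gauss_mean_value[OF f int] .
    then have "ennreal (?\<kappa> * norm (f u)) \<le> ennreal (exp (\<alpha> / 2 * (norm u)\<^sup>2)) * ?N"
      unfolding nG using \<kappa> by (simp add: norm_mult)
    then have "ennreal (inverse ?\<kappa> * exp (- (\<alpha> / 2) * (norm u)\<^sup>2)) * ennreal (?\<kappa> * norm (f u)) \<le>
       ennreal (inverse ?\<kappa> * exp (- (\<alpha> / 2) * (norm u)\<^sup>2)) * (ennreal (exp (\<alpha> / 2 * (norm u)\<^sup>2)) * ?N)"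
      by (rule mult_left_mono) simp
    also have "\<dots> = ennreal (inverse ?\<kappa> * exp (- (\<alpha> / 2) * (norm u)\<^sup>2) * exp (\<alpha> / 2 * (norm u)\<^sup>2)) * ?N"
      using \<kappa> by (subst ennreal_mult[of "inverse ?\<kappa> * exp (- (\<alpha> / 2) * (norm u)\<^sup>2)"]) (simp_all add: mult.assoc)
    also have "inverse ?\<kappa> * exp (- (\<alpha> / 2) * (norm u)\<^sup>2) * exp (\<alpha> / 2 * (norm u)\<^sup>2) = inverse ?\<kappa>"
      by (simp only: mult.assoc mult_exp_exp) simp
    also have "ennreal (inverse ?\<kappa> * exp (- (\<alpha> / 2) * (norm u)\<^sup>2)) * ennreal (?\<kappa> * norm (f u)) = ennreal (wt \<alpha> f u)"
      using \<kappa> by (simp add: ennreal_mult[symmetric] wt_def mult_ac)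
    finally show ?thesis .
  qed
qed

text \<open>
After translation by \<open>u\<close> this is the mean value property with Gaussian \<open>exp (- \<alpha> \<bar>z\<bar>\<^sup>2)\<close>. Up to a
constant it says that the Toeplitz operator of Lebesgue measure is the identity, so that every property of
Toeplitz integrals also applies to bounded sets of entire functions.
\<close>
lemma reproducing_formula:
  fixes f :: "complex^'n \<Rightarrow> complex"
  assumes f: "entire f" and \<alpha>: "\<alpha> > 0" and M: "\<And>z. wt \<alpha> f z \<le> M"
  shows "integrable lborel (toeplitz_integrand \<alpha> f u)"
    and "toeplitz \<alpha> lborel f u = of_real (gauss_mass TYPE(complex^'n) \<alpha>) * f u"
proof -
  let ?G = "\<lambda>z. f (u + z) * exp (- of_real \<alpha> * herm z u) * of_real (exp (- \<alpha> * (norm z)\<^sup>2))"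
  note [measurable] = entire_measurable[OF f]
  have n: "norm (?G z) = exp (\<alpha> / 2 * (norm u)\<^sup>2) * (wt \<alpha> f (z + u) * exp (- (\<alpha> / 2) * (norm z)\<^sup>2))" for z
    using wt_shift[of f u z \<alpha> "\<alpha> / 2"] by simp
  have int: "integrable lborel ?G"
  proof (rule Bochner_Integration.integrable_bound)
    show "integrable lborel (\<lambda>z::complex^'n. exp (\<alpha> / 2 * (norm u)\<^sup>2) * (M * gauss (\<alpha> / 2) z 0))"
      using \<alpha> by (intro integrable_mult_right gauss_integrable) auto
    show "?G \<in> borel_measurable lborel" by measurable
    have "norm (?G z) \<le> norm (exp (\<alpha> / 2 * (norm u)\<^sup>2) * (M * gauss (\<alpha> / 2) z 0))" for z
    proof -
      have "M \<ge> 0" using M[of 0] wt_nonneg[of \<alpha> f 0] by linarith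
      then show ?thesis unfolding n using M[of "z + u"] by (simp add: mult_right_mono)
    qed
    then show "AE z in lborel. norm (?G z) \<le> norm (exp (\<alpha> / 2 * (norm u)\<^sup>2) * (M * gauss (\<alpha> / 2) z 0))"
      by simp
  qed
  have eq: "toeplitz_integrand \<alpha> f u w = ?G (w - u)" for w
  proof -
    have N: "(norm (w - u))\<^sup>2 = (norm w)\<^sup>2 - 2 * (w \<bullet> u) + (norm u)\<^sup>2"
      by (simp add: power2_norm_eq_inner algebra_simps inner_commute)
    have "herm w u + herm u w = of_real (2 * (w \<bullet> u))"
      using complex_add_cnj[of "herm w u"] by (simp add: cnj_herm Re_herm)
    then have h: "herm u w = of_real (2 * (w \<bullet> u)) - herm w u"
      by (simp add: eq_diff_eq add.commute)
    have "of_real \<alpha> * herm u w + of_real (- \<alpha> * (norm w)\<^sup>2) =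
      - of_real \<alpha> * herm (w - u) u + of_real (- \<alpha> * (norm (w - u))\<^sup>2)"
      unfolding N h herm_diff_left herm_self of_real_mult of_real_add of_real_diff of_real_minus
      by (simp only: ring_distribs minus_mult_left[symmetric] minus_mult_right[symmetric]) simp
    then have "exp (of_real \<alpha> * herm u w) * exp (of_real (- \<alpha> * (norm w)\<^sup>2)) =
      exp (- of_real \<alpha> * herm (w - u) u) * exp (of_real (- \<alpha> * (norm (w - u))\<^sup>2))"
      by (simp only: mult_exp_exp)
    then show ?thesis
      unfolding toeplitz_integrand_def fock_kernel_def exp_of_real by simp
  qed
  have d: "distr lborel borel ((+) (- u)) = (lborel :: (complex^'n) measure)"
    by (rule lborel_distr_plus)
  have "integrable (distr lborel borel ((+) (- u))) ?G"
    unfolding d by (rule int)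
  then have 1: "integrable lborel (\<lambda>w. ?G (- u + w))"
    by (subst (asm) integrable_distr_eq) auto
  have teq: "toeplitz_integrand \<alpha> f u = (\<lambda>w. ?G (- u + w))"
    by (rule ext, subst eq) simp
  show "integrable lborel (toeplitz_integrand \<alpha> f u)"
    unfolding teq by (rule 1)
  have "(LINT z|distr lborel borel ((+) (- u)). ?G z) = (LINT w|lborel. ?G (- u + w))"
    by (rule integral_distr) auto
  then have "toeplitz \<alpha> lborel f u = (LINT z|lborel. ?G z)"
    unfolding toeplitz_def teq d by simp
  also have "\<dots> = of_real (gauss_mass TYPE(complex^'n) \<alpha>) * f u"
    by (rule gauss_mean_value[OF f int])
  finally show "toeplitz \<alpha> lborel f u = of_real (gauss_mass TYPE(complex^'n) \<alpha>) * f u" .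
qed

section \<open>Analyticity of Toeplitz integrals\<close>

lemma exp_linear_growth_bound:
  fixes \<alpha> s x :: real
  assumes "\<alpha> > 0"
  shows "exp (- (\<alpha> / 2) * x\<^sup>2) * exp (s * x) \<le> exp (s\<^sup>2 / \<alpha>) * exp (- (\<alpha> / 4) * x\<^sup>2)"
proof -
  have "0 \<le> (\<alpha> / 2 * x - s)\<^sup>2 / \<alpha>" using assms by simp
  also have "\<dots> = \<alpha> / 4 * x\<^sup>2 - s * x + s\<^sup>2 / \<alpha>"
    using assms by (simp add: power2_eq_square field_simps)
  finally show ?thesis by (simp add: mult_exp_exp)
qed

text \<open>
Dominating functions for the Toeplitz integrand and its derivatives: each derivative of the kernel in \<open>z\<close> costs
one power of \<open>\<bar>w\<bar>\<close>, which is absorbed by increasing \<open>s\<close>.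
\<close>
definition growth :: "real \<Rightarrow> (complex ^ 'n \<Rightarrow> complex) \<Rightarrow> real \<Rightarrow> complex ^ 'n \<Rightarrow> real" where
  "growth \<alpha> f s w = norm (f w) * exp (- \<alpha> * (norm w)\<^sup>2) * exp (s * norm w)"

lemma growth_nonneg [simp]: "growth \<alpha> f s w \<ge> 0"
  by (simp add: growth_def)

lemma growth_le:
  assumes "\<alpha> > 0"
  shows "growth \<alpha> f s w \<le> wt \<alpha> f w * (exp (s\<^sup>2 / \<alpha>) * exp (- (\<alpha> / 4) * (norm w)\<^sup>2))"
proof -
  have "growth \<alpha> f s w = wt \<alpha> f w * (exp (- (\<alpha> / 2) * (norm w)\<^sup>2) * exp (s * norm w))"
    by (simp add: growth_def wt_def mult.assoc mult_exp_exp)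
  also have "\<dots> \<le> wt \<alpha> f w * (exp (s\<^sup>2 / \<alpha>) * exp (- (\<alpha> / 4) * (norm w)\<^sup>2))"
    by (intro mult_left_mono exp_linear_growth_bound assms) auto
  finally show ?thesis .
qed

lemma growth_measurable [measurable (raw)]:
  assumes [measurable]: "f \<in> borel_measurable borel" "g \<in> borel_measurable M"
  shows "(\<lambda>x. growth \<alpha> f s (g x)) \<in> borel_measurable M"
proof -
  have "(\<lambda>x. growth \<alpha> f s x) \<in> borel_measurable borel"
    unfolding growth_def by measurable
  then show ?thesis by (rule measurable_compose[rotated]) fact
qed

lemma growth_integrable:
  assumes \<alpha>: "\<alpha> > 0" and f[measurable]: "f \<in> borel_measurable borel"
    and \<mu>[measurable_cong]: "sets \<mu> = sets borel" and int: "integrable \<mu> (wt \<alpha> f)"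
  shows "integrable \<mu> (growth \<alpha> f s)"
proof (rule Bochner_Integration.integrable_bound)
  show "integrable \<mu> (\<lambda>w. exp (s\<^sup>2 / \<alpha>) * wt \<alpha> f w)"
    using int by simp
  show "growth \<alpha> f s \<in> borel_measurable \<mu>" by measurable
  have "growth \<alpha> f s w \<le> exp (s\<^sup>2 / \<alpha>) * wt \<alpha> f w" for w
  proof -
    have "wt \<alpha> f w * (exp (s\<^sup>2 / \<alpha>) * exp (- (\<alpha> / 4) * (norm w)\<^sup>2)) \<le> wt \<alpha> f w * (exp (s\<^sup>2 / \<alpha>) * 1)"
      using \<alpha> by (intro mult_left_mono) auto
    with growth_le[OF \<alpha>, of f s w] show ?thesis by (simp add: mult.commute)
  qed
  then show "AE w in \<mu>. norm (growth \<alpha> f s w) \<le> norm (exp (s\<^sup>2 / \<alpha>) * wt \<alpha> f w)" by simp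
qed

lemma growth_integrable_lborel:
  fixes f :: "complex^'n \<Rightarrow> complex"
  assumes \<alpha>: "\<alpha> > 0" and f[measurable]: "f \<in> borel_measurable borel"
    and M: "\<And>z. wt \<alpha> f z \<le> M"
  shows "integrable lborel (growth \<alpha> f s)"
    and "(LINT w|lborel. growth \<alpha> f s w) \<le> M * (exp (s\<^sup>2 / \<alpha>) * gauss_mass TYPE(complex^'n) (\<alpha> / 4))"
proof -
  have i: "integrable lborel (\<lambda>w::complex^'n. M * (exp (s\<^sup>2 / \<alpha>) * gauss (\<alpha> / 4) w 0))"
    using \<alpha> by (intro integrable_mult_right gauss_integrable) auto
  have b: "growth \<alpha> f s w \<le> M * (exp (s\<^sup>2 / \<alpha>) * gauss (\<alpha> / 4) w 0)" for w
    unfolding diff_zero by (rule order_trans[OF growth_le[OF \<alpha>] mult_right_mono[OF M]]) simp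
  show 1: "integrable lborel (growth \<alpha> f s)"
  proof (rule Bochner_Integration.integrable_bound[OF i])
    show "growth \<alpha> f s \<in> borel_measurable lborel" by measurable
    show "AE w in lborel. norm (growth \<alpha> f s w) \<le> norm (M * (exp (s\<^sup>2 / \<alpha>) * gauss (\<alpha> / 4) w 0))"
    proof (rule AE_I2)
      fix w :: "complex^'n"
      have "norm (growth \<alpha> f s w) = growth \<alpha> f s w" by simp
      also note b[of w]
      also have "M * (exp (s\<^sup>2 / \<alpha>) * gauss (\<alpha> / 4) w 0)
        \<le> norm (M * (exp (s\<^sup>2 / \<alpha>) * gauss (\<alpha> / 4) w 0))"
        by (simp only: real_norm_def abs_ge_self)
      finally show "norm (growth \<alpha> f s w) \<le> norm (M * (exp (s\<^sup>2 / \<alpha>) * gauss (\<alpha> / 4) w 0))" .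
    qed
  qed
  have "(LINT w|lborel. growth \<alpha> f s w) \<le> (LINT w|lborel. M * (exp (s\<^sup>2 / \<alpha>) * gauss (\<alpha> / 4) w (0::complex^'n)))"
    by (rule integral_mono[OF 1 i b])
  also have "\<dots> = M * (exp (s\<^sup>2 / \<alpha>) * gauss_mass TYPE(complex^'n) (\<alpha> / 4))"
    by (simp add: gauss_mass_def)
  finally show "(LINT w|lborel. growth \<alpha> f s w) \<le> M * (exp (s\<^sup>2 / \<alpha>) * gauss_mass TYPE(complex^'n) (\<alpha> / 4))" .
qed

lemma toeplitz_integrand_measurable [measurable]:
  fixes \<mu> :: "(complex^'n) measure"
  assumes f[measurable]: "f \<in> borel_measurable borel"
    and \<mu>[measurable_cong]: "sets \<mu> = sets borel"
  shows "toeplitz_integrand \<alpha> f z \<in> borel_measurable \<mu>"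
proof -
  have "(\<lambda>w. w) \<in> borel_measurable \<mu>" "(\<lambda>w. z) \<in> borel_measurable \<mu>"
    by (simp_all add: measurable_cong_sets[OF \<mu> refl])
  note [measurable] = borel_measurable_fock_kernel[OF this, of \<alpha>]
  show ?thesis
    unfolding toeplitz_integrand_def by measurable
qed

lemma norm_toeplitz_integrand_le:
  assumes "\<alpha> > 0"
  shows "norm (toeplitz_integrand \<alpha> f z w) \<le> growth \<alpha> f (\<alpha> * norm z) w"
proof -
  have "\<alpha> * (z \<bullet> w) \<le> \<alpha> * norm z * norm w"
    using assms norm_cauchy_schwarz[of z w] by simp
  then have "exp (\<alpha> * (z \<bullet> w)) * (norm (f w) * exp (- \<alpha> * (norm w)\<^sup>2)) \<le>
      exp (\<alpha> * norm z * norm w) * (norm (f w) * exp (- \<alpha> * (norm w)\<^sup>2))"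
    by (intro mult_right_mono) auto
  then show ?thesis
    by (simp add: toeplitz_integrand_def norm_mult norm_fock_kernel growth_def mult_ac)
qed

lemma toeplitz_integrand_shift:
  "toeplitz_integrand \<alpha> f (z + v) w = exp (of_real \<alpha> * herm v w) * toeplitz_integrand \<alpha> f z w"
  by (simp add: toeplitz_integrand_def fock_kernel_def herm_add_left distrib_left exp_add mult_ac)

lemma norm_scaled_herm_le:
  assumes "\<alpha> > 0"
  shows "norm (of_real \<alpha> * herm v w) \<le> norm v * (\<alpha> * norm w)"
  using assms norm_herm_le[of v w] by (simp add: norm_mult mult_ac)

lemma growth_mult_exp: "growth \<alpha> f s w * exp (r * norm w) = growth \<alpha> f (s + r) w"
  by (simp add: growth_def distrib_right exp_add)

text \<open>
Differentiation under the integral sign, by a first order Taylor estimate of \<open>exp (\<alpha> \<langle>v, w\<rangle>)\<close>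
in the increment \<open>v\<close>. Stated for measurable \<open>f\<close>, it serves to recognise a pointwise limit of entire functions
as entire. The zeroth order estimate gives a Lipschitz bound that depends on \<open>f\<close> only through
\<open>growth\<close>, which is the equicontinuity behind normal families.
\<close>
lemma toeplitz_regularity:
  fixes \<mu> :: "(complex^'n) measure"
  assumes \<alpha>: "\<alpha> > 0" and f[measurable]: "f \<in> borel_measurable borel"
    and \<mu>[measurable_cong]: "sets \<mu> = sets borel" and int: "\<And>s. integrable \<mu> (growth \<alpha> f s)"
  shows "integrable \<mu> (toeplitz_integrand \<alpha> f z)"
    and "entire (toeplitz \<alpha> \<mu> f)"
    and "norm v \<le> 1 \<Longrightarrow> norm (toeplitz \<alpha> \<mu> f (z + v) - toeplitz \<alpha> \<mu> f z)
       \<le> norm v * (LINT w|\<mu>. growth \<alpha> f (\<alpha> * norm z + 2 * \<alpha>) w)"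
proof -
  have mid: "(\<lambda>w. w) \<in> borel_measurable \<mu>" "(\<lambda>w. v) \<in> borel_measurable \<mu>" for v
    by (simp_all add: measurable_cong_sets[OF \<mu> refl])
  note mh[measurable] = borel_measurable_herm[OF mid(2) mid(1)]
  have I: "integrable \<mu> (toeplitz_integrand \<alpha> f z)" for z
    by (rule Bochner_Integration.integrable_bound[OF int[of "\<alpha> * norm z"]])
      (use norm_toeplitz_integrand_le[OF \<alpha>] in \<open>auto intro!: AE_I2 toeplitz_integrand_measurable f \<mu>\<close>)
  show "integrable \<mu> (toeplitz_integrand \<alpha> f z)" by (rule I)
  have T: "norm (toeplitz_integrand \<alpha> f z w) * exp (r * norm w) \<le> growth \<alpha> f (\<alpha> * norm z + r) w" for z w r
    unfolding growth_mult_exp[symmetric]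
    by (intro mult_right_mono norm_toeplitz_integrand_le \<alpha>) auto
  have ex: "x \<le> exp x" "x\<^sup>2 \<le> 2 * exp x" if "x \<ge> 0" for x :: real
  proof -
    show "x \<le> exp x" using exp_ge_add_one_self[of x] by linarith
    show "x\<^sup>2 \<le> 2 * exp x" using exp_lower_Taylor_quadratic[OF that] that by simp
  qed
  \<comment> \<open>Taylor estimates of order zero and one, applied to the increment of the exponent\<close>
  have T0: "norm (exp a - 1) \<le> exp (norm a) * norm a" for a :: complex
    using Taylor_exp_field[of a 0] by simp
  have T1: "norm (exp a - 1 - a) \<le> exp (norm a) * (norm a)\<^sup>2" for a :: complex
    using Taylor_exp_field[of a 1] by (simp add: power2_eq_square diff_diff_eq)
  \<comment> \<open>the derivative of the integrand in direction \<open>v\<close>\<close>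
  define D where "D z v w = of_real \<alpha> * herm v w * toeplitz_integrand \<alpha> f z w" for z v w
  have mD[measurable]: "D z v \<in> borel_measurable \<mu>" for z v
    unfolding D_def by measurable
  have D_le: "norm (D z v w) \<le> norm v * growth \<alpha> f (\<alpha> * norm z + \<alpha>) w" for z v w
  proof -
    have "norm (D z v w) \<le> (norm v * (\<alpha> * norm w)) * norm (toeplitz_integrand \<alpha> f z w)"
      unfolding D_def norm_mult[of _ "toeplitz_integrand \<alpha> f z w"]
      by (intro mult_right_mono norm_scaled_herm_le \<alpha>) auto
    also have "\<dots> \<le> (norm v * exp (\<alpha> * norm w)) * norm (toeplitz_integrand \<alpha> f z w)"
      using \<alpha> by (intro mult_right_mono mult_left_mono ex) auto
    also have "\<dots> \<le> norm v * growth \<alpha> f (\<alpha> * norm z + \<alpha>) w"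
      using mult_left_mono[OF T[of z w \<alpha>], of "norm v"] by (simp add: mult_ac)
    finally show ?thesis .
  qed
  have ID: "integrable \<mu> (D z v)" for z v
  proof (rule Bochner_Integration.integrable_bound)
    show "integrable \<mu> (\<lambda>w. norm v * growth \<alpha> f (\<alpha> * norm z + \<alpha>) w)"
      using int by simp
    show "AE w in \<mu>. norm (D z v w) \<le> norm (norm v * growth \<alpha> f (\<alpha> * norm z + \<alpha>) w)"
      using D_le[of z v] by (intro AE_I2) simp
  qed measurable
  have R: "norm (toeplitz_integrand \<alpha> f (z + v) w - toeplitz_integrand \<alpha> f z w - D z v w)
      \<le> 2 * (norm v)\<^sup>2 * growth \<alpha> f (\<alpha> * norm z + 2 * \<alpha>) w" if v: "norm v \<le> 1" for z v w
  proof -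
    let ?a = "of_real \<alpha> * herm v w"
    have "toeplitz_integrand \<alpha> f (z + v) w - toeplitz_integrand \<alpha> f z w - D z v w
      = (exp ?a - 1 - ?a) * toeplitz_integrand \<alpha> f z w"
      unfolding D_def toeplitz_integrand_shift by (simp add: algebra_simps)
    moreover have "norm (exp ?a - 1 - ?a) \<le> 2 * (norm v)\<^sup>2 * exp (2 * \<alpha> * norm w)"
    proof -
      have a: "norm ?a \<le> norm v * (\<alpha> * norm w)" by (rule norm_scaled_herm_le[OF \<alpha>])
      have "norm v * (\<alpha> * norm w) \<le> 1 * (\<alpha> * norm w)"
        using v \<alpha> by (intro mult_right_mono) auto
      with a have a': "norm ?a \<le> \<alpha> * norm w" by linarith
      have "norm (exp ?a - 1 - ?a) \<le> exp (norm ?a) * (norm ?a)\<^sup>2" by (rule T1)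
      also have "\<dots> \<le> exp (\<alpha> * norm w) * (norm v * (\<alpha> * norm w))\<^sup>2"
        using a a' by (intro mult_mono power_mono) auto
      also have "\<dots> = exp (\<alpha> * norm w) * ((norm v)\<^sup>2 * (\<alpha> * norm w)\<^sup>2)"
        by (simp add: power_mult_distrib)
      also have "\<dots> \<le> exp (\<alpha> * norm w) * ((norm v)\<^sup>2 * (2 * exp (\<alpha> * norm w)))"
        using \<alpha> by (intro mult_left_mono ex) auto
      also have "\<dots> = 2 * (norm v)\<^sup>2 * (exp (\<alpha> * norm w) * exp (\<alpha> * norm w))"
        by simp
      also have "exp (\<alpha> * norm w) * exp (\<alpha> * norm w) = exp (2 * \<alpha> * norm w)"
        unfolding mult_exp_exp by (rule arg_cong[of _ _ exp]) simp
      finally show ?thesis .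
    qed
    ultimately have "norm (toeplitz_integrand \<alpha> f (z + v) w - toeplitz_integrand \<alpha> f z w - D z v w)
      \<le> 2 * (norm v)\<^sup>2 * exp (2 * \<alpha> * norm w) * norm (toeplitz_integrand \<alpha> f z w)"
      by (simp only: norm_mult mult_right_mono norm_ge_zero)
    also have "\<dots> \<le> 2 * (norm v)\<^sup>2 * growth \<alpha> f (\<alpha> * norm z + 2 * \<alpha>) w"
      using mult_left_mono[OF T[of z w "2 * \<alpha>"], of "2 * (norm v)\<^sup>2"] by (simp add: mult_ac)
    finally show ?thesis .
  qed
  have R0: "norm (toeplitz_integrand \<alpha> f (z + v) w - toeplitz_integrand \<alpha> f z w)
      \<le> norm v * growth \<alpha> f (\<alpha> * norm z + 2 * \<alpha>) w" if v: "norm v \<le> 1" for z v w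
  proof -
    let ?a = "of_real \<alpha> * herm v w"
    have "toeplitz_integrand \<alpha> f (z + v) w - toeplitz_integrand \<alpha> f z w
      = (exp ?a - 1) * toeplitz_integrand \<alpha> f z w"
      unfolding toeplitz_integrand_shift by (simp add: algebra_simps)
    moreover have "norm (exp ?a - 1) \<le> norm v * exp (2 * \<alpha> * norm w)"
    proof -
      have a: "norm ?a \<le> norm v * (\<alpha> * norm w)" by (rule norm_scaled_herm_le[OF \<alpha>])
      have "norm v * (\<alpha> * norm w) \<le> 1 * (\<alpha> * norm w)"
        using v \<alpha> by (intro mult_right_mono) auto
      with a have a': "norm ?a \<le> \<alpha> * norm w" by linarith
      have "norm (exp ?a - 1) \<le> exp (norm ?a) * (norm ?a)" by (rule T0)
      also have "\<dots> \<le> exp (\<alpha> * norm w) * (norm v * (\<alpha> * norm w))"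
        using a a' by (intro mult_mono) auto
      also have "\<dots> \<le> exp (\<alpha> * norm w) * (norm v * exp (\<alpha> * norm w))"
        using \<alpha> by (intro mult_left_mono ex) auto
      also have "\<dots> = norm v * (exp (\<alpha> * norm w) * exp (\<alpha> * norm w))"
        by simp
      also have "exp (\<alpha> * norm w) * exp (\<alpha> * norm w) = exp (2 * \<alpha> * norm w)"
        unfolding mult_exp_exp by (rule arg_cong[of _ _ exp]) simp
      finally show ?thesis .
    qed
    ultimately have "norm (toeplitz_integrand \<alpha> f (z + v) w - toeplitz_integrand \<alpha> f z w)
      \<le> norm v * exp (2 * \<alpha> * norm w) * norm (toeplitz_integrand \<alpha> f z w)"
      by (simp only: norm_mult mult_right_mono norm_ge_zero)
    also have "\<dots> \<le> norm v * growth \<alpha> f (\<alpha> * norm z + 2 * \<alpha>) w"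
      using mult_left_mono[OF T[of z w "2 * \<alpha>"], of "norm v"] by (simp add: mult_ac)
    finally show ?thesis .
  qed
  show "norm (toeplitz \<alpha> \<mu> f (z + v) - toeplitz \<alpha> \<mu> f z)
       \<le> norm v * (LINT w|\<mu>. growth \<alpha> f (\<alpha> * norm z + 2 * \<alpha>) w)" if "norm v \<le> 1"
  proof -
    have "toeplitz \<alpha> \<mu> f (z + v) - toeplitz \<alpha> \<mu> f z =
        (LINT w|\<mu>. toeplitz_integrand \<alpha> f (z + v) w - toeplitz_integrand \<alpha> f z w)"
      unfolding toeplitz_def by (subst Bochner_Integration.integral_diff) (auto intro: I)
    also have "norm \<dots> \<le> (LINT w|\<mu>. norm v * growth \<alpha> f (\<alpha> * norm z + 2 * \<alpha>) w)"
      by (rule norm_integral_le) (auto intro!: I int R0 that)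
    finally show ?thesis by simp
  qed
  show "entire (toeplitz \<alpha> \<mu> f)"
  proof (rule entireI)
    fix z :: "complex^'n"
    define L where "L v = (LINT w|\<mu>. D z v w)" for v
    define C where "C = 2 * (LINT w|\<mu>. growth \<alpha> f (\<alpha> * norm z + 2 * \<alpha>) w)"
    have err: "norm (toeplitz \<alpha> \<mu> f (z + v) - toeplitz \<alpha> \<mu> f z - L v) \<le> C * (norm v)\<^sup>2"
      if "norm v \<le> 1" for v
    proof -
      have "toeplitz \<alpha> \<mu> f (z + v) - toeplitz \<alpha> \<mu> f z - L v =
          (LINT w|\<mu>. toeplitz_integrand \<alpha> f (z + v) w - toeplitz_integrand \<alpha> f z w - D z v w)"
        unfolding toeplitz_def L_def by (simp add: Bochner_Integration.integral_diff I ID)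
      also have "norm \<dots> \<le> (LINT w|\<mu>. 2 * (norm v)\<^sup>2 * growth \<alpha> f (\<alpha> * norm z + 2 * \<alpha>) w)"
        by (rule norm_integral_le)
          (auto intro!: Bochner_Integration.integrable_diff I ID int R that)
      finally show ?thesis by (simp add: C_def mult_ac)
    qed
    have bl: "bounded_linear L"
    proof (rule bounded_linear_intro)
      show "L (x + y) = L x + L y" for x y
      proof -
        have "D z (x + y) = (\<lambda>w. D z x w + D z y w)"
          by (simp add: fun_eq_iff D_def herm_add_left algebra_simps)
        then show ?thesis unfolding L_def by (simp add: Bochner_Integration.integral_add ID)
      qed
      show "L (r *\<^sub>R x) = r *\<^sub>R L x" for r x
      proof -
        have "D z (r *\<^sub>R x) = (\<lambda>w. r *\<^sub>R D z x w)"
          by (simp add: fun_eq_iff D_def herm_scaleR_left)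
        then show ?thesis unfolding L_def by simp
      qed
      show "norm (L x) \<le> norm x * (LINT w|\<mu>. growth \<alpha> f (\<alpha> * norm z + \<alpha>) w)" for x
      proof -
        have "norm (L x) \<le> (LINT w|\<mu>. norm x * growth \<alpha> f (\<alpha> * norm z + \<alpha>) w)"
          unfolding L_def by (rule norm_integral_le) (auto intro!: ID int D_le)
        then show ?thesis by simp
      qed
    qed
    have "((\<lambda>y. norm (toeplitz \<alpha> \<mu> f y - toeplitz \<alpha> \<mu> f z - L (y - z)) / norm (y - z)) \<longlongrightarrow> 0) (at z)"
    proof (rule Lim_null_comparison)
      show "((\<lambda>y. C * norm (y - z)) \<longlongrightarrow> 0) (at z)"
        by (rule tendsto_eq_intros refl | simp)+
      have "\<forall>\<^sub>F y in at z. dist y z < 1"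
        unfolding eventually_at by (intro exI[of _ 1]) auto
      then show "\<forall>\<^sub>F y in at z. norm (norm (toeplitz \<alpha> \<mu> f y - toeplitz \<alpha> \<mu> f z - L (y - z)) / norm (y - z)) \<le> C * norm (y - z)"
      proof eventually_elim
        case (elim y)
        then have "norm (toeplitz \<alpha> \<mu> f y - toeplitz \<alpha> \<mu> f z - L (y - z)) \<le> C * (norm (y - z))\<^sup>2"
          using err[of "y - z"] by (simp add: dist_norm)
        then show ?case
          by (cases "y = z") (simp_all add: divide_le_eq power2_eq_square mult_ac)
      qed
    qed
    then have "(toeplitz \<alpha> \<mu> f has_derivative L) (at z)"
      using bl by (simp add: has_derivative_iff_norm)
    moreover have "L (c *s v) = c * L v" for c v
    proof -
      have "D z (c *s v) = (\<lambda>w. c * D z v w)"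
        by (simp add: fun_eq_iff D_def herm_scale_left mult_ac)
      then show ?thesis unfolding L_def by simp
    qed
    ultimately show "\<exists>L. (toeplitz \<alpha> \<mu> f has_derivative L) (at z) \<and> (\<forall>c v. L (c *s v) = c * L v)"
      by blast
  qed
qed

section \<open>Hoelder's inequality\<close>

lemma holder_integral:
  fixes f g :: "'a \<Rightarrow> real"
  assumes p: "p > 1" and q: "1 / p + 1 / q = 1"
    and [measurable]: "f \<in> borel_measurable M" "g \<in> borel_measurable M"
    and nn: "\<And>x. f x \<ge> 0" "\<And>x. g x \<ge> 0"
    and fp: "integrable M (\<lambda>x. f x powr p)" and gq: "integrable M (\<lambda>x. g x powr q)"
  shows "integrable M (\<lambda>x. f x * g x)"
    and "(LINT x|M. f x * g x) \<le> (LINT x|M. f x powr p) powr (1 / p) * (LINT x|M. g x powr q) powr (1 / q)"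
proof -
  have q1: "q > 1"
  proof -
    have "1 / p < 1" "1 / p > 0" using p by auto
    with q have "1 / q > 0" "1 / q < 1" by linarith+
    then show ?thesis by (simp add: divide_less_eq_1 split: if_splits)
  qed
  have Y: "a * b \<le> a powr p / p + b powr q / q" if "a \<ge> 0" "b \<ge> 0" for a b
    using Youngs_inequality[of p q a b] p q1 q that by simp
  show I: "integrable M (\<lambda>x. f x * g x)"
  proof (rule Bochner_Integration.integrable_bound)
    show "integrable M (\<lambda>x. f x powr p / p + g x powr q / q)"
      using fp gq by auto
    show "AE x in M. norm (f x * g x) \<le> norm (f x powr p / p + g x powr q / q)"
      using Y[OF nn(1) nn(2)] nn p q1 by (intro AE_I2) (smt (verit) mult_nonneg_nonneg real_norm_def)
  qed measurable
  define A B where "A = (LINT x|M. f x powr p)" and "B = (LINT x|M. g x powr q)"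
  have AB: "A \<ge> 0" "B \<ge> 0" unfolding A_def B_def by auto
  have zero: "(LINT x|M. f x * g x) = 0"
    if "A = 0 \<or> B = 0"
  proof -
    have "AE x in M. f x * g x = 0"
      using that
    proof
      assume "A = 0"
      then have "AE x in M. f x powr p = 0"
        unfolding A_def using fp by (subst (asm) integral_nonneg_eq_0_iff_AE) auto
      then show ?thesis by eventually_elim auto
    next
      assume "B = 0"
      then have "AE x in M. g x powr q = 0"
        unfolding B_def using gq by (subst (asm) integral_nonneg_eq_0_iff_AE) auto
      then show ?thesis by eventually_elim auto
    qed
    then show ?thesis by (simp add: integral_eq_zero_AE)
  qed
  have "(LINT x|M. f x * g x) \<le> A powr (1 / p) * B powr (1 / q)"
  proof (cases "A = 0 \<or> B = 0")
    case True
    then show ?thesis using zero by simp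
  next
    case False
    with AB have AB': "A > 0" "B > 0" by auto
    have *: "f x * g x \<le> A powr (1 / p) * B powr (1 / q) * (f x powr p / (p * A) + g x powr q / (q * B))" for x
    proof -
      define a b where "a = f x / A powr (1 / p)" and "b = g x / B powr (1 / q)"
      have ab: "a \<ge> 0" "b \<ge> 0" using nn by (auto simp: a_def b_def)
      have "a powr p = f x powr p / A" "b powr q = g x powr q / B"
        using AB' nn p q1 by (auto simp: a_def b_def powr_divide powr_powr)
      with Y[OF ab] have "a * b \<le> f x powr p / (p * A) + g x powr q / (q * B)"
        by (simp add: mult.commute)
      then have "A powr (1 / p) * B powr (1 / q) * (a * b) \<le>
          A powr (1 / p) * B powr (1 / q) * (f x powr p / (p * A) + g x powr q / (q * B))"
        by (intro mult_left_mono) auto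
      moreover have "A powr (1 / p) * B powr (1 / q) * (a * b) = f x * g x"
        using AB' by (simp add: a_def b_def)
      ultimately show ?thesis by simp
    qed
    have "(LINT x|M. f x * g x) \<le> (LINT x|M. A powr (1 / p) * B powr (1 / q) * (f x powr p / (p * A) + g x powr q / (q * B)))"
      by (intro integral_mono I * integrable_mult_right Bochner_Integration.integrable_add integrable_divide fp gq)
    also have "\<dots> = A powr (1 / p) * B powr (1 / q) * (A / (p * A) + B / (q * B))"
      unfolding A_def B_def using fp gq by simp
    also have "A / (p * A) + B / (q * B) = 1"
      using AB' q by simp
    finally show ?thesis by simp
  qed
  then show "(LINT x|M. f x * g x) \<le> (LINT x|M. f x powr p) powr (1 / p) * (LINT x|M. g x powr q) powr (1 / q)"
    unfolding A_def B_def .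
qed

text \<open>
Reduces integrals of \<open>q\<close>-th powers of a bounded function to integrals of the function itself.
\<close>
lemma powr_le_mult_powr:
  fixes x M r :: real
  assumes "0 \<le> x" "x \<le> M" "r \<ge> 1"
  shows "x powr r \<le> x * M powr (r - 1)"
proof (cases "x = 0")
  case False
  then have "x powr r = x * x powr (r - 1)"
    using assms by (simp add: powr_diff)
  also have "\<dots> \<le> x * M powr (r - 1)"
    using assms by (intro mult_left_mono powr_mono2) auto
  finally show ?thesis .
qed simp

section \<open>Fock spaces and their inclusions\<close>

definition fock_const :: "'n itself \<Rightarrow> real \<Rightarrow> real \<Rightarrow> real" where
  "fock_const _ \<alpha> r = (\<alpha> * r / (2 * pi)) ^ CARD('n)"

lemma fock_const_pos: "\<alpha> > 0 \<Longrightarrow> r > 0 \<Longrightarrow> fock_const TYPE('n) \<alpha> r > 0"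
  by (simp add: fock_const_def)

lemma exponent_cases:
  fixes p :: ennreal
  assumes "1 \<le> p"
  obtains "p = \<infinity>" | r where "p = ennreal r" "r \<ge> 1"
  using assms by (cases p) (auto simp: top_unique)

lemma fock_space_infty: "f \<in> fock_space \<alpha> \<infinity> \<longleftrightarrow> entire f \<and> bdd_above (range (wt \<alpha> f))"
  by (simp add: fock_space_def wt_def[abs_def])

lemma fock_norm_infty: "fock_norm \<alpha> \<infinity> f = (SUP z. wt \<alpha> f z)"
  by (simp add: fock_norm_def wt_def)

lemma fock_space_real:
  "r \<ge> 1 \<Longrightarrow> f \<in> fock_space \<alpha> (ennreal r) \<longleftrightarrow> entire f \<and> integrable lborel (\<lambda>z. wt \<alpha> f z powr r)"
  by (simp add: fock_space_def wt_powr)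

lemma fock_norm_real:
  fixes f :: "complex^'n \<Rightarrow> complex"
  shows "r \<ge> 1 \<Longrightarrow> fock_norm \<alpha> (ennreal r) f =
    (fock_const TYPE('n) \<alpha> r * (LINT z|lborel. wt \<alpha> f z powr r)) powr (1 / r)"
  by (simp add: fock_norm_def wt_powr fock_const_def)

lemma fock_space_1: "f \<in> fock_space \<alpha> 1 \<longleftrightarrow> entire f \<and> integrable lborel (wt \<alpha> f)"
  using fock_space_real[of 1 f \<alpha>] by simp

lemma fock_norm_1:
  fixes f :: "complex^'n \<Rightarrow> complex"
  assumes "\<alpha> > 0"
  shows "fock_norm \<alpha> 1 f = fock_const TYPE('n) \<alpha> 1 * (LINT z|lborel. wt \<alpha> f z)"
proof -
  have "fock_const TYPE('n) \<alpha> 1 * (LINT z|lborel. wt \<alpha> f z) \<ge> 0"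
    using fock_const_pos[OF assms, of 1, where 'n='n] by simp
  then show ?thesis
    using fock_norm_real[of 1 \<alpha> f] by simp
qed

lemma fock_space_entire: "f \<in> fock_space \<alpha> p \<Longrightarrow> entire f"
  by (simp add: fock_space_def)

lemma fock_norm_powr:
  fixes f :: "complex^'n \<Rightarrow> complex"
  assumes "r \<ge> 1" "\<alpha> > 0"
  shows "fock_norm \<alpha> (ennreal r) f powr r = fock_const TYPE('n) \<alpha> r * (LINT z|lborel. wt \<alpha> f z powr r)"
proof -
  have "fock_const TYPE('n) \<alpha> r * (LINT z|lborel. wt \<alpha> f z powr r) \<ge> 0"
    using fock_const_pos[OF assms(2), of r, where 'n='n] assms by simp
  then show ?thesis
    using assms by (simp add: fock_norm_real powr_powr)
qed

lemma fock_norm_nonneg: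
  assumes "1 \<le> p" "f \<in> fock_space \<alpha> p"
  shows "0 \<le> fock_norm \<alpha> p f"
  using assms(1)
proof (cases rule: exponent_cases)
  case 1
  have "bdd_above (range (wt \<alpha> f))" using assms(2) unfolding 1 fock_space_infty by simp
  then have "wt \<alpha> f 0 \<le> (SUP z. wt \<alpha> f z)" by (rule cSUP_upper[rotated]) simp
  then show ?thesis using wt_nonneg[of \<alpha> f 0] unfolding 1 fock_norm_infty by linarith
next
  case (2 r)
  then show ?thesis by (simp add: fock_norm_real)
qed

lemma wt_scale: "wt \<alpha> (\<lambda>z. c * f z) z = norm c * wt \<alpha> f z"
  by (simp add: wt_def norm_mult)
lemma wt_diff_le: "wt \<alpha> (\<lambda>z. f z - g z) z \<le> wt \<alpha> f z + wt \<alpha> g z"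
  unfolding wt_def distrib_right[symmetric] by (intro mult_right_mono norm_triangle_ineq4) simp

lemma entire_diff:
  assumes "entire f" "entire g" shows "entire (\<lambda>z. f z - g z)"
proof (rule entireI)
  fix z
  obtain L L' where "(f has_derivative L) (at z)" "\<forall>c v. L (c *s v) = c * L v"
    "(g has_derivative L') (at z)" "\<forall>c v. L' (c *s v) = c * L' v"
    using assms unfolding entire_def by meson
  then show "\<exists>L. ((\<lambda>z. f z - g z) has_derivative L) (at z) \<and> (\<forall>c v. L (c *s v) = c * L v)"
    by (intro exI[of _ "\<lambda>v. L v - L' v"]) (auto intro: has_derivative_diff simp: algebra_simps)
qed

lemma entire_scale:
  assumes "entire f" shows "entire (\<lambda>z. c * f z)"
proof (rule entireI)
  fix z
  obtain L where "(f has_derivative L) (at z)" "\<forall>c v. L (c *s v) = c * L v"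
    using assms unfolding entire_def by meson
  then show "\<exists>L. ((\<lambda>z. c * f z) has_derivative L) (at z) \<and> (\<forall>c v. L (c *s v) = c * L v)"
    by (intro exI[of _ "\<lambda>v. c * L v"]) (auto intro: has_derivative_mult_right)
qed

lemma entire_sum:
  assumes "\<And>j. j \<in> J \<Longrightarrow> entire (f j)" shows "entire (\<lambda>z. \<Sum>j\<in>J. f j z)"
proof (rule entireI)
  fix z
  have "\<forall>j\<in>J. \<exists>L. (f j has_derivative L) (at z) \<and> (\<forall>c v. L (c *s v) = c * L v)"
    using assms unfolding entire_def by blast
  then obtain L where "\<forall>j\<in>J. (f j has_derivative L j) (at z) \<and> (\<forall>c v. L j (c *s v) = c * L j v)"
    by (rule bchoice[THEN exE])
  then show "\<exists>L. ((\<lambda>z. \<Sum>j\<in>J. f j z) has_derivative L) (at z) \<and> (\<forall>c v. L (c *s v) = c * L v)"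
    by (intro exI[of _ "\<lambda>v. \<Sum>j\<in>J. L j v"]) (auto intro: has_derivative_sum simp: sum_distrib_left)
qed

lemma fock_scale:
  fixes f :: "complex^'n \<Rightarrow> complex"
  assumes "1 \<le> p" and f: "f \<in> fock_space \<alpha> p" and \<alpha>: "\<alpha> > 0"
  shows "(\<lambda>z. c * f z) \<in> fock_space \<alpha> p"
    and "fock_norm \<alpha> p (\<lambda>z. c * f z) = norm c * fock_norm \<alpha> p f"
proof -
  have e: "entire (\<lambda>z. c * f z)"
    by (rule entire_scale[OF fock_space_entire[OF f]])
  have w: "wt \<alpha> (\<lambda>z. c * f z) = (\<lambda>z. norm c * wt \<alpha> f z)"
    by (rule ext) (rule wt_scale)
  from assms(1) have "(\<lambda>z. c * f z) \<in> fock_space \<alpha> p \<and> fock_norm \<alpha> p (\<lambda>z. c * f z) = norm c * fock_norm \<alpha> p f"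
  proof (cases rule: exponent_cases)
    case 1
    have b: "bdd_above (range (wt \<alpha> f))" using f unfolding 1 fock_space_infty by simp
    then obtain M where "\<And>z. wt \<alpha> f z \<le> M" by (auto simp: bdd_above_def)
    then have "\<And>z. norm c * wt \<alpha> f z \<le> norm c * M" by (intro mult_left_mono) auto
    then have "bdd_above (range (\<lambda>z. norm c * wt \<alpha> f z))" by (auto simp: bdd_above_def)
    moreover have "(SUP z. norm c * wt \<alpha> f z) = norm c * (SUP z. wt \<alpha> f z)"
    proof -
      have "continuous (at_left (Sup (range (wt \<alpha> f)))) (\<lambda>x. norm c * x)"
        by (intro continuous_intros)
      from continuous_at_Sup_mono[OF _ this _ b] show ?thesis
        by (simp add: mono_def mult_left_mono image_image)
    qed
    ultimately show ?thesis unfolding 1 fock_space_infty fock_norm_infty w using e by simp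
  next
    case (2 r)
    have "(\<lambda>z. (norm c * wt \<alpha> f z) powr r) = (\<lambda>z. norm c powr r * wt \<alpha> f z powr r)"
      by (simp add: powr_mult)
    moreover have "(fock_const TYPE('n) \<alpha> r * (norm c powr r * (LINT z|lborel. wt \<alpha> f z powr r))) powr (1 / r)
      = norm c * (fock_const TYPE('n) \<alpha> r * (LINT z|lborel. wt \<alpha> f z powr r)) powr (1 / r)"
      using 2 fock_const_pos[OF \<alpha>, of r, where 'n='n] by (simp add: powr_mult powr_powr)
    ultimately show ?thesis
      using e f 2 by (simp add: fock_space_real fock_norm_real w)
  qed
  then show "(\<lambda>z. c * f z) \<in> fock_space \<alpha> p" "fock_norm \<alpha> p (\<lambda>z. c * f z) = norm c * fock_norm \<alpha> p f"
    by auto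
qed

lemma powr_add_le:
  fixes x y r :: real
  assumes "0 \<le> x" "0 \<le> y" "r \<ge> 0"
  shows "(x + y) powr r \<le> 2 powr r * (x powr r + y powr r)"
proof -
  have "(x + y) powr r \<le> (2 * max x y) powr r"
    using assms by (intro powr_mono2) auto
  also have "\<dots> = 2 powr r * max x y powr r"
    using assms by (simp add: powr_mult)
  also have "\<dots> \<le> 2 powr r * (x powr r + y powr r)"
    by (intro mult_left_mono) (auto simp: max_def)
  finally show ?thesis .
qed

lemma fock_diff:
  assumes "1 \<le> p" and f: "f \<in> fock_space \<alpha> p" and g: "g \<in> fock_space \<alpha> p"
  shows "(\<lambda>z. f z - g z) \<in> fock_space \<alpha> p"
    and "p = ennreal r \<Longrightarrow> 1 \<le> r \<Longrightarrow> (LINT z|lborel. wt \<alpha> (\<lambda>z. f z - g z) z powr r)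
      \<le> 2 powr r * ((LINT z|lborel. wt \<alpha> f z powr r) + (LINT z|lborel. wt \<alpha> g z powr r))"
proof -
  have e: "entire (\<lambda>z. f z - g z)"
    by (intro entire_diff fock_space_entire[OF f] fock_space_entire[OF g])
  note [measurable] = entire_measurable[OF e]
  have real: "integrable lborel (\<lambda>z. wt \<alpha> (\<lambda>z. f z - g z) z powr r) \<and>
      (LINT z|lborel. wt \<alpha> (\<lambda>z. f z - g z) z powr r)
      \<le> 2 powr r * ((LINT z|lborel. wt \<alpha> f z powr r) + (LINT z|lborel. wt \<alpha> g z powr r))"
    if r: "p = ennreal r" "r \<ge> 1" for r
  proof -
    have fg: "integrable lborel (\<lambda>z. wt \<alpha> f z powr r)" "integrable lborel (\<lambda>z. wt \<alpha> g z powr r)"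
      using f g r by (auto simp: fock_space_real)
    have i: "integrable lborel (\<lambda>z. 2 powr r * (wt \<alpha> f z powr r + wt \<alpha> g z powr r))"
      using fg by auto
    have b: "wt \<alpha> (\<lambda>z. f z - g z) z powr r \<le> 2 powr r * (wt \<alpha> f z powr r + wt \<alpha> g z powr r)" for z
      by (rule order_trans[OF powr_mono2[OF _ _ wt_diff_le] powr_add_le]) (use r in auto)
    have I: "integrable lborel (\<lambda>z. wt \<alpha> (\<lambda>z. f z - g z) z powr r)"
      by (rule Bochner_Integration.integrable_bound[OF i]) (use b in \<open>auto intro!: AE_I2\<close>)
    moreover have "(LINT z|lborel. wt \<alpha> (\<lambda>z. f z - g z) z powr r)
      \<le> (LINT z|lborel. 2 powr r * (wt \<alpha> f z powr r + wt \<alpha> g z powr r))"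
      by (rule integral_mono[OF I i b])
    ultimately show ?thesis using fg by simp
  qed
  show "p = ennreal r \<Longrightarrow> 1 \<le> r \<Longrightarrow> (LINT z|lborel. wt \<alpha> (\<lambda>z. f z - g z) z powr r)
      \<le> 2 powr r * ((LINT z|lborel. wt \<alpha> f z powr r) + (LINT z|lborel. wt \<alpha> g z powr r))"
    using real by blast
  from assms(1) show "(\<lambda>z. f z - g z) \<in> fock_space \<alpha> p"
  proof (cases rule: exponent_cases)
    case 1
    obtain M N where "\<And>z. wt \<alpha> f z \<le> M" "\<And>z. wt \<alpha> g z \<le> N"
      using f g unfolding 1 fock_space_infty by (auto simp: bdd_above_def)
    then have "\<And>z. wt \<alpha> (\<lambda>z. f z - g z) z \<le> M + N"
      by (rule order_trans[OF wt_diff_le add_mono])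
    then have "bdd_above (range (wt \<alpha> (\<lambda>z. f z - g z)))"
      by (auto simp: bdd_above_def)
    then show ?thesis unfolding 1 fock_space_infty using e by simp
  next
    case (2 r)
    then show ?thesis using real e by (simp add: fock_space_real)
  qed
qed

text \<open>
The conjugate exponent; the value 1 at infinity makes the two cases \<open>p < \<infinity>\<close> and \<open>p = \<infinity>\<close>
formally alike.
\<close>
definition conj_exp :: "ennreal \<Rightarrow> real" where
  "conj_exp p = (if p = \<infinity> then 1 else enn2real p / (enn2real p - 1))"

lemma conj_exp_ge: "1 < p \<Longrightarrow> 1 \<le> conj_exp p"
  by (cases p) (auto simp: conj_exp_def divide_simps)

lemma conj_exp_real: "r > 1 \<Longrightarrow> 1 / r + 1 / conj_exp (ennreal r) = 1"
  by (simp add: conj_exp_def field_simps)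

lemma exponent_gt_1_cases:
  fixes p :: ennreal
  assumes "1 < p"
  obtains "p = \<infinity>" | r where "p = ennreal r" "r > 1"
  using assms by (cases p) (auto simp: top_unique)

text \<open>
The duality between a Fock space and the conjugate Lebesgue space, in one statement for finite and infinite
\<open>p\<close>.
\<close>
lemma fock_holder:
  assumes \<alpha>: "\<alpha> > 0" and p: "1 < p"
  shows "\<exists>C>0. \<forall>f\<in>(fock_space \<alpha> p :: (complex^'n \<Rightarrow> complex) set). \<forall>b\<in>borel_measurable borel.
     (\<forall>z. b z \<ge> 0) \<longrightarrow> integrable lborel (\<lambda>z. b z powr conj_exp p) \<longrightarrow>
     integrable lborel (\<lambda>z. wt \<alpha> f z * b z) \<and>
     (LINT z|lborel. wt \<alpha> f z * b z) \<le> C * fock_norm \<alpha> p f * (LINT z|lborel. b z powr conj_exp p) powr (1 / conj_exp p)"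
  using p
proof (cases rule: exponent_gt_1_cases)
  case 1
  have "integrable lborel (\<lambda>z. wt \<alpha> f z * b z) \<and>
     (LINT z|lborel. wt \<alpha> f z * b z) \<le> 1 * fock_norm \<alpha> p f * (LINT z|lborel. b z powr conj_exp p) powr (1 / conj_exp p)"
    if f: "f \<in> fock_space \<alpha> p" and [measurable]: "b \<in> borel_measurable borel"
     and b: "\<And>z. b z \<ge> 0" and i: "integrable lborel (\<lambda>z. b z powr conj_exp p)"
    for f :: "complex^'n \<Rightarrow> complex" and b
  proof -
    note [measurable] = entire_measurable[OF fock_space_entire[OF f]]
    have c1: "conj_exp p = 1" by (simp add: 1 conj_exp_def)
    have ib: "integrable lborel b" using i b unfolding c1 by simp
    have M: "wt \<alpha> f z \<le> fock_norm \<alpha> p f" for z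
      using f unfolding 1 fock_norm_infty fock_space_infty by (intro cSUP_upper) auto
    have le: "wt \<alpha> f z * b z \<le> fock_norm \<alpha> p f * b z" for z
      using M b by (intro mult_right_mono) auto
    have I: "integrable lborel (\<lambda>z. wt \<alpha> f z * b z)"
    proof (rule Bochner_Integration.integrable_bound)
      show "integrable lborel (\<lambda>z. fock_norm \<alpha> p f * b z)" using ib by simp
      show "AE z in lborel. norm (wt \<alpha> f z * b z) \<le> norm (fock_norm \<alpha> p f * b z)"
      proof (rule AE_I2)
        fix z
        have "norm (wt \<alpha> f z * b z) = wt \<alpha> f z * b z" using b by simp
        also have "\<dots> \<le> norm (fock_norm \<alpha> p f * b z)" using le[of z] by simp
        finally show "norm (wt \<alpha> f z * b z) \<le> norm (fock_norm \<alpha> p f * b z)" .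
      qed
    qed measurable
    have "(LINT z|lborel. wt \<alpha> f z * b z) \<le> (LINT z|lborel. fock_norm \<alpha> p f * b z)"
      using I ib le by (intro integral_mono) auto
    then show ?thesis using I b by (simp add: c1)
  qed
  then show ?thesis by (intro exI[of _ 1]) simp
next
  case (2 r)
  let ?c = "fock_const TYPE('n) \<alpha> r"
  have c: "?c > 0" using \<alpha> 2 by (simp add: fock_const_pos)
  have "integrable lborel (\<lambda>z. wt \<alpha> f z * b z) \<and>
     (LINT z|lborel. wt \<alpha> f z * b z) \<le> ?c powr (- 1 / r) * fock_norm \<alpha> p f * (LINT z|lborel. b z powr conj_exp p) powr (1 / conj_exp p)"
    if f: "f \<in> fock_space \<alpha> p" and [measurable]: "b \<in> borel_measurable borel"
     and b: "\<And>z. b z \<ge> 0" and i: "integrable lborel (\<lambda>z. b z powr conj_exp p)"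
    for f :: "complex^'n \<Rightarrow> complex" and b
  proof -
    note [measurable] = entire_measurable[OF fock_space_entire[OF f]]
    have fi: "integrable lborel (\<lambda>z. wt \<alpha> f z powr r)"
      using f 2 by (simp add: fock_space_real)
    note H = holder_integral[OF 2(2) conj_exp_real[OF 2(2)], of "wt \<alpha> f" lborel b, folded 2(1),
        OF _ _ _ _ fi i]
    have "(LINT z|lborel. wt \<alpha> f z powr r) powr (1 / r) = ?c powr (- 1 / r) * fock_norm \<alpha> p f"
      unfolding 2(1) using 2 c by (simp add: fock_norm_real powr_mult powr_minus_divide)
    with H b show ?thesis by simp
  qed
  moreover have "?c powr (- 1 / r) > 0" using c by simp
  ultimately show ?thesis by blast
qed

text \<open>
Point evaluation is bounded, \<open>F\<^sup>p \<subseteq> F\<^sup>\<infinity>\<close>: pair the mean value inequality with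
Hoelder's inequality, and use that the norm of a translated Gaussian does not depend on the centre. For
\<open>p = 1\<close> the Gaussian is simply bounded by 1.
\<close>
lemma fock_sup_bound:
  assumes \<alpha>: "\<alpha> > 0" and p: "1 \<le> p"
  shows "\<exists>C>0. \<forall>f\<in>(fock_space \<alpha> p :: (complex^'n \<Rightarrow> complex) set). \<forall>z. wt \<alpha> f z \<le> C * fock_norm \<alpha> p f"
proof -
  let ?k = "gauss_mass TYPE(complex^'n) (1 + \<alpha> / 2)"
  have k: "?k > 0" using \<alpha> by (intro gauss_mass_pos) auto
  have gm: "wt \<alpha> f u \<le> inverse ?k * (LINT z|lborel. wt \<alpha> f z * gauss 1 z u)"
    if "entire f" "integrable lborel (\<lambda>z. wt \<alpha> f z * gauss 1 z u)"
    for f :: "complex^'n \<Rightarrow> complex" and u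
  proof -
    have "ennreal (wt \<alpha> f u) \<le> ennreal (inverse ?k) * ennreal (LINT z|lborel. wt \<alpha> f z * gauss 1 z u)"
      using wt_le_gauss_mean[OF that(1) zero_less_one \<alpha>, of u] nn_integral_eq_integral[OF that(2)] by simp
    then show ?thesis
      using k by (simp add: ennreal_mult[symmetric] integral_nonneg_AE del: ennreal_mult')
  qed
  show ?thesis
  proof (cases "p = 1")
    case True
    let ?c = "fock_const TYPE('n) \<alpha> 1"
    have c: "?c > 0" using \<alpha> by (simp add: fock_const_pos)
    have "wt \<alpha> f u \<le> (inverse ?k * inverse ?c) * fock_norm \<alpha> p f"
      if f: "f \<in> fock_space \<alpha> p" for f :: "complex^'n \<Rightarrow> complex" and u
    proof -
      have e: "entire f" and i: "integrable lborel (wt \<alpha> f)"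
        using f unfolding True fock_space_1 by auto
      note [measurable] = entire_measurable[OF e]
      have le: "wt \<alpha> f z * gauss 1 z u \<le> wt \<alpha> f z" for z
        by (intro mult_left_le) auto
      have i': "integrable lborel (\<lambda>z. wt \<alpha> f z * gauss 1 z u)"
        by (rule Bochner_Integration.integrable_bound[OF i]) (use le in \<open>auto intro!: AE_I2\<close>)
      have "(LINT z|lborel. wt \<alpha> f z * gauss 1 z u) \<le> (LINT z|lborel. wt \<alpha> f z)"
        by (rule integral_mono[OF i' i le])
      with gm[OF e i'] k have h: "wt \<alpha> f u \<le> inverse ?k * (LINT z|lborel. wt \<alpha> f z)"
        by (smt (verit) inverse_positive_iff_positive mult_left_mono)
      have eq: "inverse ?c * (?c * (LINT z|lborel. wt \<alpha> f z)) = (LINT z|lborel. wt \<alpha> f z)"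
        using c by (simp add: field_simps)
      show ?thesis
        unfolding True fock_norm_1[OF \<alpha>] mult.assoc[of "inverse ?k"] eq by (rule h)
    qed
    moreover have "inverse ?k * inverse ?c > 0" using k c by simp
    ultimately show ?thesis by blast
  next
    case False
    with p have p1: "1 < p" by simp
    from fock_holder[OF \<alpha> p1, where 'n='n] obtain C where C: "C > 0"
      "\<forall>f\<in>(fock_space \<alpha> p :: (complex^'n \<Rightarrow> complex) set). \<forall>b\<in>borel_measurable borel.
       (\<forall>z. b z \<ge> 0) \<longrightarrow> integrable lborel (\<lambda>z. b z powr conj_exp p) \<longrightarrow>
       integrable lborel (\<lambda>z. wt \<alpha> f z * b z) \<and>
       (LINT z|lborel. wt \<alpha> f z * b z) \<le> C * fock_norm \<alpha> p f * (LINT z|lborel. b z powr conj_exp p) powr (1 / conj_exp p)"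
      by blast
    let ?q = "conj_exp p"
    have q: "?q \<ge> 1" by (rule conj_exp_ge[OF p1])
    let ?G = "gauss_mass TYPE(complex^'n) ?q powr (1 / ?q)"
    have G: "?G > 0" using gauss_mass_pos[of ?q, where 'a="complex^'n"] q by simp
    have "wt \<alpha> f u \<le> (inverse ?k * C * ?G) * fock_norm \<alpha> p f"
      if f: "f \<in> fock_space \<alpha> p" for f :: "complex^'n \<Rightarrow> complex" and u
    proof -
      have e: "(\<lambda>z::complex^'n. gauss 1 z u powr ?q) = (\<lambda>z. gauss ?q z u)"
        by (simp add: exp_powr_real mult.commute)
      have i: "integrable lborel (\<lambda>z::complex^'n. gauss 1 z u powr ?q)"
        unfolding e using q by (intro gauss_integrable) auto
      have v: "(LINT z|lborel. gauss 1 z u powr ?q) = gauss_mass TYPE(complex^'n) ?q"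
        unfolding e using q by (intro gauss_integral) auto
      have "(\<lambda>z. gauss 1 z u) \<in> borel_measurable borel" by measurable
      from C(2)[rule_format, OF f this _ i] have "integrable lborel (\<lambda>z. wt \<alpha> f z * gauss 1 z u)"
        "(LINT z|lborel. wt \<alpha> f z * gauss 1 z u) \<le> C * fock_norm \<alpha> p f * ?G"
        unfolding v by auto
      with gm[OF fock_space_entire[OF f] this(1)] k
      have "wt \<alpha> f u \<le> inverse ?k * (C * fock_norm \<alpha> p f * ?G)"
        by (smt (verit) inverse_positive_iff_positive mult_left_mono)
      then show ?thesis by (simp add: mult_ac)
    qed
    moreover have "inverse ?k * C * ?G > 0" using k C(1) G by simp
    ultimately show ?thesis by blast
  qed
qed

text \<open>
Interpolation between \<open>F\<^sup>1\<close> and the sup bound: \<open>\<integral> \<phi>\<^sup>r \<le> (sup \<phi>)\<^sup>r\<^sup>-\<^sup>1 \<integral> \<phi>\<close>.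
\<close>
lemma fock_1_subset:
  assumes \<alpha>: "\<alpha> > 0" and p: "1 \<le> p"
  shows "\<exists>C>0. \<forall>f\<in>(fock_space \<alpha> 1 :: (complex^'n \<Rightarrow> complex) set).
    f \<in> fock_space \<alpha> p \<and> fock_norm \<alpha> p f \<le> C * fock_norm \<alpha> 1 f"
proof -
  obtain C where C: "C > 0" "\<forall>f\<in>(fock_space \<alpha> 1 :: (complex^'n \<Rightarrow> complex) set). \<forall>z. wt \<alpha> f z \<le> C * fock_norm \<alpha> 1 f"
    using fock_sup_bound[OF \<alpha> order_refl, where 'n='n] by blast
  from p show ?thesis
  proof (cases rule: exponent_cases)
    case 1
    have "f \<in> fock_space \<alpha> p \<and> fock_norm \<alpha> p f \<le> C * fock_norm \<alpha> 1 f"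
      if f: "f \<in> fock_space \<alpha> 1" for f :: "complex^'n \<Rightarrow> complex"
      unfolding 1 fock_space_infty fock_norm_infty
      using C(2)[rule_format, OF f] fock_space_entire[OF f] by (auto intro!: cSUP_least bdd_aboveI2)
    then show ?thesis using C(1) by blast
  next
    case (2 r)
    let ?c = "fock_const TYPE('n) \<alpha> r" and ?c1 = "fock_const TYPE('n) \<alpha> 1"
    have c: "?c > 0" "?c1 > 0" using \<alpha> 2 by (simp_all add: fock_const_pos)
    define K where "K = (?c * C powr (r - 1) * inverse ?c1) powr (1 / r)"
    have K: "K > 0" unfolding K_def using c C(1) by simp
    have "f \<in> fock_space \<alpha> p \<and> fock_norm \<alpha> p f \<le> K * fock_norm \<alpha> 1 f"
      if f: "f \<in> fock_space \<alpha> 1" for f :: "complex^'n \<Rightarrow> complex"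
    proof -
      let ?N = "fock_norm \<alpha> 1 f"
      have N: "?N \<ge> 0" using fock_norm_nonneg[OF _ f] by simp
      have e: "entire f" and i: "integrable lborel (wt \<alpha> f)"
        using f unfolding fock_space_1 by auto
      note [measurable] = entire_measurable[OF e]
      have le: "wt \<alpha> f z powr r \<le> wt \<alpha> f z * (C * ?N) powr (r - 1)" for z
        using C(2)[rule_format, OF f] 2 by (intro powr_le_mult_powr) auto
      have i': "integrable lborel (\<lambda>z. wt \<alpha> f z * (C * ?N) powr (r - 1))" using i by simp
      have I: "integrable lborel (\<lambda>z. wt \<alpha> f z powr r)"
        by (rule Bochner_Integration.integrable_bound[OF i']) (use le in \<open>auto intro!: AE_I2\<close>)
      have "(LINT z|lborel. wt \<alpha> f z powr r) \<le> (LINT z|lborel. wt \<alpha> f z * (C * ?N) powr (r - 1))"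
        by (rule integral_mono[OF I i' le])
      also have "\<dots> = (inverse ?c1 * ?N) * (C * ?N) powr (r - 1)"
        using c by (simp add: fock_norm_1[OF \<alpha>])
      also have "\<dots> = C powr (r - 1) * inverse ?c1 * ?N powr r"
        using N C(1) by (cases "?N = 0") (auto simp: powr_mult powr_diff)
      finally have "?c * (LINT z|lborel. wt \<alpha> f z powr r) \<le> ?c * (C powr (r - 1) * inverse ?c1 * ?N powr r)"
        using c by simp
      also have "\<dots> = (?c * C powr (r - 1) * inverse ?c1) * ?N powr r" by simp
      finally have le2: "?c * (LINT z|lborel. wt \<alpha> f z powr r) \<le> (?c * C powr (r - 1) * inverse ?c1) * ?N powr r" .
      have "fock_norm \<alpha> p f \<le> ((?c * C powr (r - 1) * inverse ?c1) * ?N powr r) powr (1 / r)"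
        unfolding 2 fock_norm_real[OF 2(2)] using c 2 by (intro powr_mono2 le2) auto
      also have "\<dots> = K * ?N"
        unfolding K_def using 2 c C(1) N by (subst powr_mult) (auto simp: powr_powr)
      finally show ?thesis using I e 2 by (simp add: fock_space_real)
    qed
    then show ?thesis using K by blast
  qed
qed

section \<open>The Berezin transform\<close>

text \<open>
For \<open>\<gamma> = \<alpha>\<close> this is, up to a constant, the Berezin transform. Other widths enter because the embedding
into \<open>L\<^sup>q\<close> is tested with \<open>q\<close>-th powers of kernels.
\<close>
definition berezin :: "real \<Rightarrow> (complex ^ 'n) measure \<Rightarrow> complex ^ 'n \<Rightarrow> ennreal" where
  "berezin \<gamma> \<mu> z = (\<integral>\<^sup>+ w. ennreal (gauss \<gamma> w z) \<partial>\<mu>)"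

lemma norm_diff_sq:
  fixes w z :: "'a::real_inner"
  shows "(norm (w - z))\<^sup>2 = (norm w)\<^sup>2 - 2 * (w \<bullet> z) + (norm z)\<^sup>2"
  by (simp add: power2_norm_eq_inner algebra_simps inner_commute)

lemma norm_kernel_gauss:
  fixes w z :: "complex^'n"
  shows "(norm (fock_kernel \<alpha> w z))\<^sup>2 * exp (- \<alpha> * (norm w)\<^sup>2) = exp (\<alpha> * (norm z)\<^sup>2) * gauss \<alpha> w z"
proof -
  show ?thesis
    unfolding norm_fock_kernel power2_eq_square[of "exp _"] mult_exp_exp norm_diff_sq
    by (simp add: algebra_simps inner_commute)
qed

lemma admissible_sets: "toeplitz_admissible \<alpha> \<mu> \<Longrightarrow> sets \<mu> = sets borel"
  by (simp add: toeplitz_admissible_def)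

lemma admissible_berezin_finite:
  fixes \<mu> :: "(complex^'n) measure"
  assumes "toeplitz_admissible \<alpha> \<mu>"
  shows "berezin \<alpha> \<mu> z < \<infinity>"
proof -
  note [measurable_cong] = admissible_sets[OF assms]
  have "ennreal (exp (\<alpha> * (norm z)\<^sup>2)) * berezin \<alpha> \<mu> z =
      (\<integral>\<^sup>+ w. ennreal ((norm (fock_kernel \<alpha> w z))\<^sup>2 * exp (- \<alpha> * (norm w)\<^sup>2)) \<partial>\<mu>)"
    unfolding norm_kernel_gauss berezin_def by (subst nn_integral_cmult[symmetric]) (auto simp: ennreal_mult)
  also have "\<dots> < \<infinity>"
    using assms unfolding toeplitz_admissible_def by blast
  finally have "ennreal (exp (\<alpha> * (norm z)\<^sup>2)) * berezin \<alpha> \<mu> z < top" by simp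
  then show ?thesis
    unfolding ennreal_mult_less_top by auto
qed

text \<open>
Finiteness of the Berezin transform at the origin bounds the measure of every ball.
\<close>
lemma admissible_sigma_finite:
  fixes \<mu> :: "(complex^'n) measure"
  assumes "toeplitz_admissible \<alpha> \<mu>" and \<alpha>: "\<alpha> > 0"
  shows "sigma_finite_measure \<mu>"
proof -
  note s[measurable_cong] = admissible_sets[OF assms(1)]
  have fin: "emeasure \<mu> (cball 0 (real n)) < \<infinity>" for n
  proof -
    have "emeasure \<mu> (cball 0 (real n)) = (\<integral>\<^sup>+ w. indicator (cball 0 (real n)) w \<partial>\<mu>)"
      using s by simp
    also have "\<dots> \<le> (\<integral>\<^sup>+ w. ennreal (exp (\<alpha> * (real n)\<^sup>2)) * ennreal (gauss \<alpha> w 0) \<partial>\<mu>)"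
    proof (rule nn_integral_mono)
      fix w :: "complex^'n"
      show "indicator (cball 0 (real n)) w \<le> ennreal (exp (\<alpha> * (real n)\<^sup>2)) * ennreal (gauss \<alpha> w 0)"
      proof (cases "norm w \<le> real n")
        case True
        then have "(norm w)\<^sup>2 \<le> (real n)\<^sup>2" by (intro power_mono) auto
        then have "1 \<le> exp (\<alpha> * (real n)\<^sup>2) * exp (- \<alpha> * (norm w)\<^sup>2)"
          using \<alpha> by (simp add: mult_exp_exp)
        then show ?thesis by (simp add: ennreal_mult[symmetric] indicator_def ennreal_1[symmetric] del: ennreal_1)
      qed simp
    qed
    also have "\<dots> = ennreal (exp (\<alpha> * (real n)\<^sup>2)) * berezin \<alpha> \<mu> 0"
      unfolding berezin_def by (rule nn_integral_cmult) measurable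
    also have "\<dots> < \<infinity>" using admissible_berezin_finite[OF assms(1), of 0]
      by (simp add: ennreal_mult_less_top)
    finally show ?thesis .
  qed
  show ?thesis
  proof
    show "\<exists>A. countable A \<and> A \<subseteq> sets \<mu> \<and> \<Union> A = space \<mu> \<and> (\<forall>a\<in>A. emeasure \<mu> a \<noteq> \<infinity>)"
    proof (intro exI conjI ballI)
      let ?A = "range (\<lambda>n. cball (0::complex^'n) (real n))"
      show "countable ?A" by simp
      show "?A \<subseteq> sets \<mu>" unfolding s by auto
      have "x \<in> \<Union> ?A" for x
        using real_arch_simple[of "norm x"] by auto
      then have "\<Union> ?A = UNIV" by blast
      then show "\<Union> ?A = space \<mu>"
        using sets_eq_imp_space_eq[OF s] by simp
      fix a assume "a \<in> ?A"
      then obtain n where "a = cball 0 (real n)" by blast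
      then show "emeasure \<mu> a \<noteq> \<infinity>" using fin[of n] by simp
    qed
  qed
qed

lemma berezin_measurable [measurable]:
  fixes \<mu> :: "(complex^'n) measure"
  assumes s[measurable_cong]: "sets \<mu> = sets borel" and "sigma_finite_measure \<mu>"
  shows "berezin \<gamma> \<mu> \<in> borel_measurable borel"
proof -
  interpret sigma_finite_measure \<mu> by fact
  have "(\<lambda>p. snd p) \<in> borel_measurable (borel \<Otimes>\<^sub>M \<mu>)"
    using measurable_snd[of borel \<mu>] by (simp add: measurable_cong_sets[OF refl s])
  then have "(\<lambda>p. ennreal (gauss \<gamma> (snd p) (fst p))) \<in> borel_measurable (borel \<Otimes>\<^sub>M \<mu>)"
    by measurable
  then have "(\<lambda>z. \<integral>\<^sup>+ w. ennreal (gauss \<gamma> w z) \<partial>\<mu>) \<in> borel_measurable borel"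
    by (intro borel_measurable_nn_integral) (simp add: case_prod_beta')
  then show ?thesis unfolding berezin_def[abs_def] .
qed

lemma fubini_lborel:
  fixes \<mu> :: "(complex^'n) measure" and g :: "complex^'n \<Rightarrow> complex^'n \<Rightarrow> ennreal"
  assumes s: "sets \<mu> = sets borel" and "sigma_finite_measure \<mu>"
    and g: "(\<lambda>p. g (fst p) (snd p)) \<in> borel_measurable (borel \<Otimes>\<^sub>M borel)"
  shows "(\<integral>\<^sup>+ u. (\<integral>\<^sup>+ z. g z u \<partial>lborel) \<partial>\<mu>) = (\<integral>\<^sup>+ z. (\<integral>\<^sup>+ u. g z u \<partial>\<mu>) \<partial>lborel)"
proof -
  interpret \<mu>: sigma_finite_measure \<mu> by fact
  interpret pair_sigma_finite "lborel :: (complex^'n) measure" \<mu> ..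
  have "sets (lborel \<Otimes>\<^sub>M \<mu>) = sets (borel \<Otimes>\<^sub>M borel)"
    by (rule sets_pair_measure_cong) (auto simp: s)
  then have "(\<lambda>p. g (fst p) (snd p)) \<in> borel_measurable (lborel \<Otimes>\<^sub>M \<mu>)"
    using g measurable_cong_sets by blast
  then show ?thesis
    by (intro Fubini') (simp add: case_prod_beta')
qed

text \<open>
Mean value inequality integrated against \<open>\<mu>\<close>: the Berezin transform acts as a density that dominates \<open>\<mu>\<close>
on entire functions.
\<close>
lemma integral_wt_le_berezin:
  fixes f :: "complex^'n \<Rightarrow> complex"
  assumes \<alpha>: "\<alpha> > 0" and \<gamma>: "\<gamma> > 0" and f: "entire f"
    and s[measurable_cong]: "sets \<mu> = sets borel" and sf: "sigma_finite_measure \<mu>"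
  shows "(\<integral>\<^sup>+ u. ennreal (wt \<alpha> f u) \<partial>\<mu>) \<le> ennreal (inverse (gauss_mass TYPE(complex^'n) (\<gamma> + \<alpha> / 2))) *
    (\<integral>\<^sup>+ z. ennreal (wt \<alpha> f z) * berezin \<gamma> \<mu> z \<partial>lborel)"
proof -
  let ?c = "ennreal (inverse (gauss_mass TYPE(complex^'n) (\<gamma> + \<alpha> / 2)))"
  note [measurable] = entire_measurable[OF f]
  have m: "(\<lambda>p::(complex^'n) \<times> (complex^'n). ennreal (wt \<alpha> f (fst p) * gauss \<gamma> (fst p) (snd p)))
      \<in> borel_measurable (borel \<Otimes>\<^sub>M borel)"
    by measurable
  have m': "(\<lambda>u. \<integral>\<^sup>+ z. ennreal (wt \<alpha> f z * gauss \<gamma> z u) \<partial>lborel) \<in> borel_measurable borel"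
  proof (rule lborel.borel_measurable_nn_integral)
    show "(\<lambda>(u, z). ennreal (wt \<alpha> f z * gauss \<gamma> z u)) \<in> borel_measurable (borel \<Otimes>\<^sub>M lborel)"
      unfolding case_prod_beta' by measurable
  qed
  have "(\<integral>\<^sup>+ u. ennreal (wt \<alpha> f u) \<partial>\<mu>) \<le>
      (\<integral>\<^sup>+ u. ?c * (\<integral>\<^sup>+ z. ennreal (wt \<alpha> f z * gauss \<gamma> z u) \<partial>lborel) \<partial>\<mu>)"
    by (intro nn_integral_mono wt_le_gauss_mean f \<gamma> \<alpha>)
  also have "\<dots> = ?c * (\<integral>\<^sup>+ u. (\<integral>\<^sup>+ z. ennreal (wt \<alpha> f z * gauss \<gamma> z u) \<partial>lborel) \<partial>\<mu>)"
    by (rule nn_integral_cmult) (use m' in measurable)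
  also have "(\<integral>\<^sup>+ u. (\<integral>\<^sup>+ z. ennreal (wt \<alpha> f z * gauss \<gamma> z u) \<partial>lborel) \<partial>\<mu>)
     = (\<integral>\<^sup>+ z. (\<integral>\<^sup>+ u. ennreal (wt \<alpha> f z * gauss \<gamma> z u) \<partial>\<mu>) \<partial>lborel)"
    by (rule fubini_lborel[OF s sf m])
  also have "\<dots> = (\<integral>\<^sup>+ z. ennreal (wt \<alpha> f z) * berezin \<gamma> \<mu> z \<partial>lborel)"
  proof (rule nn_integral_cong)
    fix z :: "complex^'n"
    have "(\<integral>\<^sup>+ u. ennreal (wt \<alpha> f z * gauss \<gamma> z u) \<partial>\<mu>)
      = (\<integral>\<^sup>+ u. ennreal (wt \<alpha> f z) * ennreal (gauss \<gamma> u z) \<partial>\<mu>)"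
      by (simp add: ennreal_mult norm_minus_commute)
    also have "\<dots> = ennreal (wt \<alpha> f z) * berezin \<gamma> \<mu> z"
      unfolding berezin_def by (rule nn_integral_cmult) measurable
    finally show "(\<integral>\<^sup>+ u. ennreal (wt \<alpha> f z * gauss \<gamma> z u) \<partial>\<mu>) = ennreal (wt \<alpha> f z) * berezin \<gamma> \<mu> z" .
  qed
  finally show ?thesis .
qed

text \<open>
In weighted form the kernel depends only on the distance of its arguments.
\<close>
lemma norm_toeplitz_integrand_wt:
  fixes z w :: "complex^'n"
  shows "norm (toeplitz_integrand \<alpha> f z w) * exp (- (\<alpha> / 2) * (norm z)\<^sup>2) = wt \<alpha> f w * gauss (\<alpha> / 2) z w"
proof -
  have "exp (\<alpha> * (z \<bullet> w)) * exp (- \<alpha> * (norm w)\<^sup>2) * exp (- (\<alpha> / 2) * (norm z)\<^sup>2) =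
      exp (- (\<alpha> / 2) * (norm w)\<^sup>2) * gauss (\<alpha> / 2) z w"
    unfolding mult_exp_exp norm_diff_sq by (simp add: algebra_simps)
  then show ?thesis
    by (simp add: toeplitz_integrand_def norm_mult norm_fock_kernel wt_def mult_ac)
qed

lemma integrable_wt_of_nn:
  assumes [measurable]: "f \<in> borel_measurable borel" and [measurable_cong]: "sets \<mu> = sets borel"
    and "(\<integral>\<^sup>+ w. ennreal (wt \<alpha> f w) \<partial>\<mu>) < \<infinity>"
  shows "integrable \<mu> (wt \<alpha> f)"
  using assms(3) by (auto simp: integrable_iff_bounded)

lemma wt_toeplitz_le:
  fixes \<mu> :: "(complex^'n) measure"
  assumes f[measurable]: "f \<in> borel_measurable borel"
    and s[measurable_cong]: "sets \<mu> = sets borel"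
    and i: "integrable \<mu> (toeplitz_integrand \<alpha> f z)"
  shows "ennreal (wt \<alpha> (toeplitz \<alpha> \<mu> f) z) \<le> (\<integral>\<^sup>+ w. ennreal (wt \<alpha> f w * gauss (\<alpha> / 2) z w) \<partial>\<mu>)"
proof -
  have "ennreal (wt \<alpha> (toeplitz \<alpha> \<mu> f) z) = ennreal (exp (- (\<alpha> / 2) * (norm z)\<^sup>2)) * ennreal (norm (LINT w|\<mu>. toeplitz_integrand \<alpha> f z w))"
    by (simp add: wt_def toeplitz_def ennreal_mult mult.commute)
  also have "\<dots> \<le> ennreal (exp (- (\<alpha> / 2) * (norm z)\<^sup>2)) * (\<integral>\<^sup>+ w. ennreal (norm (toeplitz_integrand \<alpha> f z w)) \<partial>\<mu>)"
    by (intro mult_left_mono integral_norm_bound_ennreal i) simp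
  also have "\<dots> = (\<integral>\<^sup>+ w. ennreal (wt \<alpha> f w * gauss (\<alpha> / 2) z w) \<partial>\<mu>)"
    unfolding norm_toeplitz_integrand_wt[symmetric]
    by (subst nn_integral_cmult[symmetric])
      (auto simp: ennreal_mult mult.commute intro!: borel_measurable_norm toeplitz_integrand_measurable f s)
  finally show ?thesis .
qed

lemma toeplitz_of_integrable:
  fixes \<mu> :: "(complex^'n) measure"
  assumes \<alpha>: "\<alpha> > 0" and f: "f \<in> borel_measurable borel"
    and s: "sets \<mu> = sets borel" and fin: "(\<integral>\<^sup>+ w. ennreal (wt \<alpha> f w) \<partial>\<mu>) < \<infinity>"
  shows "integrable \<mu> (toeplitz_integrand \<alpha> f z)" "entire (toeplitz \<alpha> \<mu> f)"
  using toeplitz_regularity[OF \<alpha> f s growth_integrable[OF \<alpha> f s integrable_wt_of_nn[OF f s fin]]]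
  by auto

lemma integral_wt_toeplitz_le:
  fixes \<mu> :: "(complex^'n) measure"
  assumes \<alpha>: "\<alpha> > 0" and f[measurable]: "f \<in> borel_measurable borel"
    and s[measurable_cong]: "sets \<mu> = sets borel" and sf: "sigma_finite_measure \<mu>"
    and fin: "(\<integral>\<^sup>+ w. ennreal (wt \<alpha> f w) \<partial>\<mu>) < \<infinity>"
  shows "(\<integral>\<^sup>+ z. ennreal (wt \<alpha> (toeplitz \<alpha> \<mu> f) z) \<partial>lborel) \<le>
    ennreal (gauss_mass TYPE(complex^'n) (\<alpha> / 2)) * (\<integral>\<^sup>+ w. ennreal (wt \<alpha> f w) \<partial>\<mu>)"
proof -
  have m: "(\<lambda>p::(complex^'n) \<times> (complex^'n). ennreal (wt \<alpha> f (snd p) * gauss (\<alpha> / 2) (fst p) (snd p)))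
      \<in> borel_measurable (borel \<Otimes>\<^sub>M borel)"
    by measurable
  have "(\<integral>\<^sup>+ z. ennreal (wt \<alpha> (toeplitz \<alpha> \<mu> f) z) \<partial>lborel) \<le>
     (\<integral>\<^sup>+ z. (\<integral>\<^sup>+ w. ennreal (wt \<alpha> f w * gauss (\<alpha> / 2) z w) \<partial>\<mu>) \<partial>lborel)"
    by (intro nn_integral_mono wt_toeplitz_le f s toeplitz_of_integrable \<alpha> fin)
  also have "\<dots> = (\<integral>\<^sup>+ w. (\<integral>\<^sup>+ z. ennreal (wt \<alpha> f w * gauss (\<alpha> / 2) z w) \<partial>lborel) \<partial>\<mu>)"
    by (rule fubini_lborel[OF s sf m, symmetric])
  also have "\<dots> = (\<integral>\<^sup>+ w. ennreal (gauss_mass TYPE(complex^'n) (\<alpha> / 2)) * ennreal (wt \<alpha> f w) \<partial>\<mu>)"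
  proof (rule nn_integral_cong)
    fix w
    have "(\<integral>\<^sup>+ z. ennreal (wt \<alpha> f w * gauss (\<alpha> / 2) z w) \<partial>lborel) =
      ennreal (wt \<alpha> f w) * (\<integral>\<^sup>+ z. ennreal (gauss (\<alpha> / 2) z w) \<partial>lborel)"
      by (subst nn_integral_cmult[symmetric]) (auto simp: ennreal_mult)
    also have "(\<integral>\<^sup>+ z. ennreal (gauss (\<alpha> / 2) z w) \<partial>lborel) = ennreal (gauss_mass TYPE(complex^'n) (\<alpha> / 2))"
      using \<alpha> by (intro gauss_nn_integral) simp
    finally show "(\<integral>\<^sup>+ z. ennreal (wt \<alpha> f w * gauss (\<alpha> / 2) z w) \<partial>lborel) =
      ennreal (gauss_mass TYPE(complex^'n) (\<alpha> / 2)) * ennreal (wt \<alpha> f w)" by (simp add: mult.commute)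
  qed
  also have "\<dots> = ennreal (gauss_mass TYPE(complex^'n) (\<alpha> / 2)) * (\<integral>\<^sup>+ w. ennreal (wt \<alpha> f w) \<partial>\<mu>)"
    by (rule nn_integral_cmult) measurable
  finally show ?thesis .
qed

text \<open>
The convolution of \<open>gauss \<gamma> u\<close> with \<open>gauss (\<delta>/2) w\<close> dominates a multiple of
\<open>gauss \<delta> u w\<close>, by the parallelogram inequality \<open>\<bar>z - w\<bar>\<^sup>2 \<le> 2\<bar>z - u\<bar>\<^sup>2 + 2\<bar>u - w\<bar>\<^sup>2\<close>; integrate this in
\<open>u\<close>. Hence any Berezin transform is a Gaussian average of any other, whichever is wider.
\<close>
lemma berezin_compare:
  fixes \<mu> :: "(complex^'n) measure"
  assumes \<gamma>: "\<gamma> > 0" and \<delta>: "\<delta> > 0"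
    and s[measurable_cong]: "sets \<mu> = sets borel" and sf: "sigma_finite_measure \<mu>"
  shows "berezin \<delta> \<mu> w \<le> ennreal (inverse (gauss_mass TYPE(complex^'n) (\<gamma> + \<delta>))) *
    (\<integral>\<^sup>+ z. berezin \<gamma> \<mu> z * ennreal (gauss (\<delta> / 2) z w) \<partial>lborel)"
proof -
  let ?g = "gauss_mass TYPE(complex^'n) (\<gamma> + \<delta>)"
  have g: "?g > 0" using \<gamma> \<delta> by (intro gauss_mass_pos) simp
  let ?F = "\<lambda>z u. ennreal (gauss \<gamma> u z) * ennreal (gauss (\<delta> / 2) z w)"
  have m: "(\<lambda>p. ?F (fst p) (snd p)) \<in> borel_measurable (borel \<Otimes>\<^sub>M borel)"
    by measurable
  have key: "ennreal ?g * ennreal (gauss \<delta> u w) \<le> (\<integral>\<^sup>+ z. ?F z u \<partial>lborel)" for u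
  proof -
    have "ennreal ?g * ennreal (gauss \<delta> u w) =
        (\<integral>\<^sup>+ z. ennreal (gauss (\<gamma> + \<delta>) z u) \<partial>lborel) * ennreal (gauss \<delta> u w)"
      using \<gamma> \<delta> by (subst gauss_nn_integral) auto
    also have "\<dots> = (\<integral>\<^sup>+ z. ennreal (gauss (\<gamma> + \<delta>) z u) * ennreal (gauss \<delta> u w) \<partial>lborel)"
      by (rule nn_integral_multc[symmetric]) measurable
    also have "\<dots> \<le> (\<integral>\<^sup>+ z. ?F z u \<partial>lborel)"
    proof (rule nn_integral_mono)
      fix z
      have "norm (z - w) \<le> norm (z - u) + norm (u - w)"
        using norm_triangle_ineq[of "z - u" "u - w"] by simp
      then have "(norm (z - w))\<^sup>2 \<le> (norm (z - u) + norm (u - w))\<^sup>2" by (intro power_mono) auto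
      also have "\<dots> \<le> 2 * (norm (z - u))\<^sup>2 + 2 * (norm (u - w))\<^sup>2"
        using sum_squares_bound[of "norm (z - u)" "norm (u - w)"] by (simp add: power2_sum)
      finally have "\<delta> / 2 * (norm (z - w))\<^sup>2 \<le> \<delta> / 2 * (2 * (norm (z - u))\<^sup>2 + 2 * (norm (u - w))\<^sup>2)"
        using \<delta> by (intro mult_left_mono) auto
      then have "gauss (\<gamma> + \<delta>) z u * gauss \<delta> u w \<le>
        (gauss \<gamma> u z) * gauss (\<delta> / 2) z w"
        unfolding mult_exp_exp by (simp add: norm_minus_commute[of u z] algebra_simps)
      then show "ennreal (gauss (\<gamma> + \<delta>) z u) * ennreal (gauss \<delta> u w) \<le> ?F z u"
        unfolding ennreal_mult[OF exp_ge_zero exp_ge_zero, symmetric] by (rule ennreal_leI)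
    qed
    finally show ?thesis .
  qed
  have "ennreal ?g * berezin \<delta> \<mu> w = (\<integral>\<^sup>+ u. ennreal ?g * ennreal (gauss \<delta> u w) \<partial>\<mu>)"
    unfolding berezin_def by (rule nn_integral_cmult[symmetric]) measurable
  also have "\<dots> \<le> (\<integral>\<^sup>+ u. (\<integral>\<^sup>+ z. ?F z u \<partial>lborel) \<partial>\<mu>)"
    by (intro nn_integral_mono key)
  also have "\<dots> = (\<integral>\<^sup>+ z. (\<integral>\<^sup>+ u. ?F z u \<partial>\<mu>) \<partial>lborel)"
    by (rule fubini_lborel[OF s sf m])
  also have "\<dots> = (\<integral>\<^sup>+ z. berezin \<gamma> \<mu> z * ennreal (gauss (\<delta> / 2) z w) \<partial>lborel)"
    unfolding berezin_def by (intro nn_integral_cong nn_integral_multc) measurable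
  finally have "ennreal ?g * berezin \<delta> \<mu> w \<le> (\<integral>\<^sup>+ z. berezin \<gamma> \<mu> z * ennreal (gauss (\<delta> / 2) z w) \<partial>lborel)" .
  then have "ennreal (inverse ?g) * (ennreal ?g * berezin \<delta> \<mu> w) \<le> ennreal (inverse ?g) *
     (\<integral>\<^sup>+ z. berezin \<gamma> \<mu> z * ennreal (gauss (\<delta> / 2) z w) \<partial>lborel)"
    by (rule mult_left_mono) simp
  also have "ennreal (inverse ?g) * (ennreal ?g * berezin \<delta> \<mu> w) = berezin \<delta> \<mu> w"
    using g by (simp add: mult.assoc[symmetric] ennreal_mult[symmetric] del: ennreal_mult')
  finally show ?thesis .
qed

lemma berezin_bounded_compare:
  fixes \<mu> :: "(complex^'n) measure"
  assumes \<gamma>: "\<gamma> > 0" and \<delta>: "\<delta> > 0"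
    and s[measurable_cong]: "sets \<mu> = sets borel" and sf: "sigma_finite_measure \<mu>"
    and S: "\<And>z. berezin \<gamma> \<mu> z \<le> ennreal S" and S0: "S \<ge> 0"
  shows "berezin \<delta> \<mu> w \<le> ennreal (inverse (gauss_mass TYPE(complex^'n) (\<gamma> + \<delta>)) * gauss_mass TYPE(complex^'n) (\<delta> / 2) * S)"
proof -
  let ?g = "gauss_mass TYPE(complex^'n) (\<gamma> + \<delta>)" and ?h = "gauss_mass TYPE(complex^'n) (\<delta> / 2)"
  have g: "?g > 0" "?h > 0" using \<gamma> \<delta> by (auto intro!: gauss_mass_pos)
  have "(\<integral>\<^sup>+ z. berezin \<gamma> \<mu> z * ennreal (gauss (\<delta> / 2) z w) \<partial>lborel)
     \<le> (\<integral>\<^sup>+ z. ennreal S * ennreal (gauss (\<delta> / 2) z w) \<partial>lborel)"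
    by (intro nn_integral_mono mult_right_mono S) simp
  also have "\<dots> = ennreal S * (\<integral>\<^sup>+ z. ennreal (gauss (\<delta> / 2) z w) \<partial>lborel)"
    by (rule nn_integral_cmult) measurable
  also have "(\<integral>\<^sup>+ z. ennreal (gauss (\<delta> / 2) z w) \<partial>lborel) = ennreal ?h"
    using \<delta> by (intro gauss_nn_integral) simp
  finally have "berezin \<delta> \<mu> w \<le> ennreal (inverse ?g) * (ennreal S * ennreal ?h)"
    using berezin_compare[OF \<gamma> \<delta> s sf, of w] by (meson mult_left_mono order_trans zero_le)
  also have "\<dots> = ennreal (inverse ?g * ?h * S)"
    using g S0 by (simp add: ennreal_mult[symmetric] mult_ac del: ennreal_mult')
  finally show ?thesis .
qed

lemma berezin_antimono: "\<gamma> \<le> \<delta> \<Longrightarrow> berezin \<delta> \<mu> z \<le> berezin \<gamma> \<mu> z"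
  unfolding berezin_def by (intro nn_integral_mono ennreal_leI) (simp add: mult_right_mono)

text \<open>
At twice the width parameter, a shift of the centre costs only a factor that is bounded on bounded sets.
\<close>
lemma berezin_local_bound:
  fixes \<mu> :: "(complex^'n) measure"
  assumes "\<alpha> > 0" "\<delta> \<ge> 2 * \<alpha>" and s[measurable_cong]: "sets \<mu> = sets borel"
  shows "berezin \<delta> \<mu> z \<le> ennreal (exp (2 * \<alpha> * (norm (z - a))\<^sup>2)) * berezin \<alpha> \<mu> a"
proof -
  have "berezin \<delta> \<mu> z \<le> berezin (2 * \<alpha>) \<mu> z" by (rule berezin_antimono[OF assms(2)])
  also have "\<dots> \<le> (\<integral>\<^sup>+ u. ennreal (exp (2 * \<alpha> * (norm (z - a))\<^sup>2)) * ennreal (gauss \<alpha> u a) \<partial>\<mu>)"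
    unfolding berezin_def
  proof (rule nn_integral_mono)
    fix u
    have "norm (u - a) \<le> norm (u - z) + norm (z - a)"
      using norm_triangle_ineq[of "u - z" "z - a"] by simp
    then have "(norm (u - a))\<^sup>2 \<le> (norm (u - z) + norm (z - a))\<^sup>2" by (intro power_mono) auto
    also have "\<dots> \<le> 2 * (norm (u - z))\<^sup>2 + 2 * (norm (z - a))\<^sup>2"
      using sum_squares_bound[of "norm (u - z)" "norm (z - a)"] by (simp add: power2_sum)
    finally have "\<alpha> * (norm (u - a))\<^sup>2 \<le> \<alpha> * (2 * (norm (u - z))\<^sup>2 + 2 * (norm (z - a))\<^sup>2)"
      using assms(1) by (intro mult_left_mono) auto
    then have "gauss (2 * \<alpha>) u z \<le> exp (2 * \<alpha> * (norm (z - a))\<^sup>2) * gauss \<alpha> u a"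
      unfolding mult_exp_exp by (simp add: algebra_simps)
    then show "ennreal (gauss (2 * \<alpha>) u z) \<le>
        ennreal (exp (2 * \<alpha> * (norm (z - a))\<^sup>2)) * ennreal (gauss \<alpha> u a)"
      unfolding ennreal_mult[OF exp_ge_zero exp_ge_zero, symmetric] by (rule ennreal_leI)
  qed
  also have "\<dots> = ennreal (exp (2 * \<alpha> * (norm (z - a))\<^sup>2)) * berezin \<alpha> \<mu> a"
    unfolding berezin_def by (rule nn_integral_cmult) measurable
  finally show ?thesis .
qed

section \<open>Normalised kernels\<close>

text \<open>
The kernel at \<open>a\<close> divided by its norm in \<open>F\<^sup>2\<close>.
\<close>
definition nkern :: "real \<Rightarrow> complex ^ 'n \<Rightarrow> complex ^ 'n \<Rightarrow> complex" where
  "nkern \<alpha> a z = fock_kernel \<alpha> a z * of_real (exp (- (\<alpha> / 2) * (norm a)\<^sup>2))"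

lemma wt_nkern: "wt \<alpha> (nkern \<alpha> a) z = gauss (\<alpha> / 2) z a"
proof -
  have "exp (\<alpha> * (z \<bullet> a)) * exp (- (\<alpha> / 2) * (norm a)\<^sup>2) * exp (- (\<alpha> / 2) * (norm z)\<^sup>2) = gauss (\<alpha> / 2) z a"
    unfolding mult_exp_exp norm_diff_sq by (simp add: algebra_simps)
  then show ?thesis by (simp add: wt_def nkern_def norm_mult norm_fock_kernel)
qed

lemma entire_nkern:
  fixes a :: "complex^'n"
  shows "entire (nkern \<alpha> a)"
proof (rule entireI)
  fix z :: "complex^'n"
  have "((\<lambda>z. of_real \<alpha> * herm z a) has_derivative (\<lambda>v. of_real \<alpha> * herm v a)) (at z)"
    by (intro has_derivative_mult_right bounded_linear_imp_has_derivative bounded_linear_herm)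
  note has_derivative_mult_left[OF has_derivative_compose[OF this DERIV_exp[unfolded has_field_derivative_def]], of "of_real (exp (- (\<alpha> / 2) * (norm a)\<^sup>2))"]
  then show "\<exists>L. (nkern \<alpha> a has_derivative L) (at z) \<and> (\<forall>c v. L (c *s v) = c * L v)"
    unfolding nkern_def[abs_def] fock_kernel_def by (intro exI conjI) (assumption, simp add: herm_scale_left mult_ac)
qed

lemma nkern_fock_1:
  fixes a :: "complex^'n"
  assumes \<alpha>: "\<alpha> > 0"
  shows "nkern \<alpha> a \<in> fock_space \<alpha> 1"
    and "fock_norm \<alpha> 1 (nkern \<alpha> a) = fock_const TYPE('n) \<alpha> 1 * gauss_mass TYPE(complex^'n) (\<alpha> / 2)"
proof -
  have w: "wt \<alpha> (nkern \<alpha> a) = (\<lambda>z. gauss (\<alpha> / 2) z a)"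
    by (rule ext) (rule wt_nkern)
  have "\<alpha> / 2 > 0" using \<alpha> by simp
  then show "nkern \<alpha> a \<in> fock_space \<alpha> 1" "fock_norm \<alpha> 1 (nkern \<alpha> a) = fock_const TYPE('n) \<alpha> 1 * gauss_mass TYPE(complex^'n) (\<alpha> / 2)"
    unfolding fock_space_1 fock_norm_1[OF \<alpha>] w
    by (auto simp only: entire_nkern gauss_integral intro!: gauss_integrable entire_nkern)
qed

text \<open>
Here no absolute values are lost: \<open>K\<^sub>w(a) K\<^sub>a(w) = exp (2\<alpha> Re \<langle>w, a\<rangle>)\<close> is positive. This is what makes
kernels good test functions.
\<close>
lemma toeplitz_nkern_diag:
  fixes \<mu> :: "(complex^'n) measure"
  assumes s[measurable_cong]: "sets \<mu> = sets borel"
  shows "toeplitz \<alpha> \<mu> (nkern \<alpha> a) a * of_real (exp (- (\<alpha> / 2) * (norm a)\<^sup>2)) = of_real (enn2real (berezin \<alpha> \<mu> a))"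
proof -
  have e: "toeplitz_integrand \<alpha> (nkern \<alpha> a) a w * of_real (exp (- (\<alpha> / 2) * (norm a)\<^sup>2)) = of_real (gauss \<alpha> w a)" for w
  proof -
    have h: "herm a w + herm w a = of_real (2 * (w \<bullet> a))"
      using complex_add_cnj[of "herm w a"] by (simp add: cnj_herm Re_herm add.commute)
    have "fock_kernel \<alpha> w a * fock_kernel \<alpha> a w = exp (of_real (\<alpha> * (2 * (w \<bullet> a))))"
      unfolding fock_kernel_def mult_exp_exp distrib_left[symmetric] h by simp
    also have "\<dots> = of_real (exp (\<alpha> * (2 * (w \<bullet> a))))"
      by (rule exp_of_real)
    finally have "toeplitz_integrand \<alpha> (nkern \<alpha> a) a w * of_real (exp (- (\<alpha> / 2) * (norm a)\<^sup>2)) =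
      of_real (exp (\<alpha> * (2 * (w \<bullet> a))) * exp (- \<alpha> * (norm w)\<^sup>2) * (exp (- (\<alpha> / 2) * (norm a)\<^sup>2) * exp (- (\<alpha> / 2) * (norm a)\<^sup>2)))"
      unfolding toeplitz_integrand_def nkern_def of_real_mult by (simp add: mult_ac)
    also have "exp (\<alpha> * (2 * (w \<bullet> a))) * exp (- \<alpha> * (norm w)\<^sup>2) * (exp (- (\<alpha> / 2) * (norm a)\<^sup>2) * exp (- (\<alpha> / 2) * (norm a)\<^sup>2)) = gauss \<alpha> w a"
      unfolding mult_exp_exp norm_diff_sq by (simp add: algebra_simps)
    finally show ?thesis .
  qed
  have "toeplitz \<alpha> \<mu> (nkern \<alpha> a) a * of_real (exp (- (\<alpha> / 2) * (norm a)\<^sup>2)) =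
      (LINT w|\<mu>. toeplitz_integrand \<alpha> (nkern \<alpha> a) a w * of_real (exp (- (\<alpha> / 2) * (norm a)\<^sup>2)))"
    unfolding toeplitz_def by simp
  also have "\<dots> = (LINT w|\<mu>. of_real (gauss \<alpha> w a))"
    unfolding e ..
  also have "\<dots> = of_real (LINT w|\<mu>. gauss \<alpha> w a)"
    by (rule integral_complex_of_real)
  also have "(LINT w|\<mu>. gauss \<alpha> w a) = enn2real (berezin \<alpha> \<mu> a)"
    unfolding berezin_def by (rule integral_eq_nn_integral) auto
  finally show ?thesis .
qed

lemma wt_toeplitz_nkern_diag:
  fixes \<mu> :: "(complex^'n) measure"
  assumes "sets \<mu> = sets borel"
  shows "wt \<alpha> (toeplitz \<alpha> \<mu> (nkern \<alpha> a)) a = enn2real (berezin \<alpha> \<mu> a)"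
proof -
  have "wt \<alpha> (toeplitz \<alpha> \<mu> (nkern \<alpha> a)) a = norm (toeplitz \<alpha> \<mu> (nkern \<alpha> a) a * of_real (exp (- (\<alpha> / 2) * (norm a)\<^sup>2)))"
    by (simp add: wt_def norm_mult)
  then show ?thesis unfolding toeplitz_nkern_diag[OF assms] by simp
qed

text \<open>
The product of two Gaussians centred at \<open>a\<close> and \<open>z\<close> is a Gaussian centred at their midpoint, times a factor that
decays with their distance.
\<close>
lemma wt_toeplitz_nkern_le:
  fixes \<mu> :: "(complex^'n) measure"
  assumes \<alpha>: "\<alpha> > 0" and s[measurable_cong]: "sets \<mu> = sets borel"
    and i: "integrable \<mu> (toeplitz_integrand \<alpha> (nkern \<alpha> a) z)"
  shows "ennreal (wt \<alpha> (toeplitz \<alpha> \<mu> (nkern \<alpha> a)) z) \<le>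
    ennreal (gauss (\<alpha> / 4) z a) * berezin \<alpha> \<mu> ((1 / 2) *\<^sub>R (z + a))"
proof -
  have "ennreal (wt \<alpha> (toeplitz \<alpha> \<mu> (nkern \<alpha> a)) z) \<le>
    (\<integral>\<^sup>+ w. ennreal (wt \<alpha> (nkern \<alpha> a) w * gauss (\<alpha> / 2) z w) \<partial>\<mu>)"
    by (rule wt_toeplitz_le[OF entire_measurable[OF entire_nkern] s i])
  also have "\<dots> = (\<integral>\<^sup>+ w. ennreal (gauss (\<alpha> / 4) z a) * ennreal (gauss \<alpha> w ((1 / 2) *\<^sub>R (z + a))) \<partial>\<mu>)"
  proof (rule nn_integral_cong)
    fix w
    \<comment> \<open>the parallelogram identity, with the midpoint of \<open>z\<close> and \<open>a\<close>\<close>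
    have "(norm (w - a))\<^sup>2 + (norm (z - w))\<^sup>2 = 2 * (norm (w - (1 / 2) *\<^sub>R (z + a)))\<^sup>2 + (norm (z - a))\<^sup>2 / 2"
      by (simp add: power2_norm_eq_inner inner_commute inner_diff_left inner_diff_right
          inner_add_left inner_add_right field_simps)
    then have "- (\<alpha> / 2) * ((norm (w - a))\<^sup>2 + (norm (z - w))\<^sup>2) = - (\<alpha> / 2) * (2 * (norm (w - (1 / 2) *\<^sub>R (z + a)))\<^sup>2 + (norm (z - a))\<^sup>2 / 2)"
      by simp
    then have "gauss (\<alpha> / 2) w a * gauss (\<alpha> / 2) z w =
      (gauss (\<alpha> / 4) z a) * gauss \<alpha> w ((1 / 2) *\<^sub>R (z + a))"
      unfolding mult_exp_exp by (intro arg_cong[of _ _ exp]) (simp add: field_simps)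
    then show "ennreal (wt \<alpha> (nkern \<alpha> a) w * gauss (\<alpha> / 2) z w) =
      ennreal (gauss (\<alpha> / 4) z a) * ennreal (gauss \<alpha> w ((1 / 2) *\<^sub>R (z + a)))"
      unfolding wt_nkern ennreal_mult[OF exp_ge_zero exp_ge_zero, symmetric] by simp
  qed
  also have "\<dots> = ennreal (gauss (\<alpha> / 4) z a) * berezin \<alpha> \<mu> ((1 / 2) *\<^sub>R (z + a))"
    unfolding berezin_def by (rule nn_integral_cmult) measurable
  finally show ?thesis .
qed

section \<open>Normal families\<close>

lemma fock_locally_lipschitz:
  fixes f :: "complex^'n \<Rightarrow> complex"
  assumes \<alpha>: "\<alpha> > 0" and f: "entire f" and M: "\<And>z. wt \<alpha> f z \<le> M" and v: "norm v \<le> 1"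
  shows "norm (f (z + v) - f z) \<le> norm v * (M * (exp ((\<alpha> * norm z + 2 * \<alpha>)\<^sup>2 / \<alpha>) *
     gauss_mass TYPE(complex^'n) (\<alpha> / 4)) / gauss_mass TYPE(complex^'n) \<alpha>)"
proof -
  let ?k = "gauss_mass TYPE(complex^'n) \<alpha>"
  let ?I = "M * (exp ((\<alpha> * norm z + 2 * \<alpha>)\<^sup>2 / \<alpha>) * gauss_mass TYPE(complex^'n) (\<alpha> / 4))"
  have k: "?k > 0" using \<alpha> by (rule gauss_mass_pos)
  note fm = entire_measurable[OF f]
  have "norm (toeplitz \<alpha> lborel f (z + v) - toeplitz \<alpha> lborel f z)
       \<le> norm v * (LINT w|lborel. growth \<alpha> f (\<alpha> * norm z + 2 * \<alpha>) w)"
    using growth_integrable_lborel(1)[OF \<alpha> fm M] by (intro toeplitz_regularity(3)[OF \<alpha> fm _ _ v]) auto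
  also have "\<dots> \<le> norm v * ?I"
    using growth_integrable_lborel(2)[OF \<alpha> fm M] by (intro mult_left_mono) auto
  also have "toeplitz \<alpha> lborel f (z + v) - toeplitz \<alpha> lborel f z = of_real ?k * (f (z + v) - f z)"
    by (simp add: reproducing_formula(2)[OF f \<alpha> M] algebra_simps)
  finally have "?k * norm (f (z + v) - f z) \<le> norm v * ?I"
    using k by (simp add: norm_mult)
  then show ?thesis using k by (simp add: field_simps)
qed

text \<open>
The reproducing formula passes to the limit by dominated convergence and exhibits the limit as a Toeplitz
integral, which is entire.
\<close>
lemma entire_of_bounded_limit:
  fixes s :: "nat \<Rightarrow> complex^'n \<Rightarrow> complex"
  assumes \<alpha>: "\<alpha> > 0" and s: "\<And>k. entire (s k)" and M: "\<And>k z. wt \<alpha> (s k) z \<le> M"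
    and lim: "\<And>z. (\<lambda>k. s k z) \<longlonglongrightarrow> f z"
  shows "entire f" and "wt \<alpha> f z \<le> M"
proof -
  let ?k = "gauss_mass TYPE(complex^'n) \<alpha>"
  have k: "?k > 0" using \<alpha> by (rule gauss_mass_pos)
  note sm[measurable] = entire_measurable[OF s]
  have fm[measurable]: "f \<in> borel_measurable borel"
    by (rule borel_measurable_LIMSEQ_metric[OF sm lim])
  have wl: "(\<lambda>k. wt \<alpha> (s k) z) \<longlonglongrightarrow> wt \<alpha> f z" for z
    unfolding wt_def by (intro tendsto_intros lim)
  have fM: "wt \<alpha> f z \<le> M" for z
    by (rule LIMSEQ_le_const2[OF wl]) (use M in auto)
  show "wt \<alpha> f z \<le> M" by (rule fM)
  have "(\<lambda>k. toeplitz \<alpha> lborel (s k) u) \<longlonglongrightarrow> toeplitz \<alpha> lborel f u" for u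
    unfolding toeplitz_def
  proof (rule integral_dominated_convergence)
    show "toeplitz_integrand \<alpha> f u \<in> borel_measurable lborel" "\<And>k. toeplitz_integrand \<alpha> (s k) u \<in> borel_measurable lborel"
      by (auto intro: toeplitz_integrand_measurable fm sm)
    show "AE w in lborel. (\<lambda>k. toeplitz_integrand \<alpha> (s k) u w) \<longlonglongrightarrow> toeplitz_integrand \<alpha> f u w"
      unfolding toeplitz_integrand_def by (intro AE_I2 tendsto_intros lim)
    let ?c = "exp (\<alpha> / 2 * (norm u)\<^sup>2)"
    show "integrable lborel (\<lambda>w. ?c * (M * gauss (\<alpha> / 2) w u))"
      using \<alpha> by (intro integrable_mult_right gauss_integrable) auto
    show "AE w in lborel. norm (toeplitz_integrand \<alpha> (s k) u w) \<le> ?c * (M * gauss (\<alpha> / 2) w u)" for k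
    proof (rule AE_I2)
      fix w
      have "norm (toeplitz_integrand \<alpha> (s k) u w) = ?c * (norm (toeplitz_integrand \<alpha> (s k) u w) * exp (- (\<alpha> / 2) * (norm u)\<^sup>2))"
        by (simp add: exp_minus field_simps)
      also have "\<dots> = ?c * (wt \<alpha> (s k) w * gauss (\<alpha> / 2) u w)"
        unfolding norm_toeplitz_integrand_wt ..
      also have "\<dots> \<le> ?c * (M * gauss (\<alpha> / 2) w u)"
        unfolding norm_minus_commute[of u w] by (intro mult_left_mono mult_right_mono M) auto
      finally show "norm (toeplitz_integrand \<alpha> (s k) u w) \<le> ?c * (M * gauss (\<alpha> / 2) w u)" .
    qed
  qed
  moreover have "(\<lambda>k. toeplitz \<alpha> lborel (s k) u) \<longlonglongrightarrow> of_real ?k * f u" for u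
    unfolding reproducing_formula(2)[OF s \<alpha> M] by (intro tendsto_intros lim)
  ultimately have T: "toeplitz \<alpha> lborel f u = of_real ?k * f u" for u
    using LIMSEQ_unique by blast
  have "entire (toeplitz \<alpha> lborel f)"
    by (rule toeplitz_regularity(2)[OF \<alpha> fm]) (auto intro: growth_integrable_lborel(1)[OF \<alpha> fm fM])
  then have "entire (\<lambda>u. inverse (of_real ?k) * toeplitz \<alpha> lborel f u)"
    by (rule entire_scale)
  also have "(\<lambda>u. inverse (of_real ?k) * toeplitz \<alpha> lborel f u) = f"
    unfolding T using k by auto
  finally show "entire f" .
qed

text \<open>
Montel's theorem for Fock spaces. Pointwise convergence is obtained on a countable dense set by a diagonal argument
and spreads by equicontinuity. The limit stays in \<open>F\<^sup>p\<close> by Fatou's lemma.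
\<close>
lemma fock_normal_family:
  fixes s :: "nat \<Rightarrow> complex^'n \<Rightarrow> complex"
  assumes \<alpha>: "\<alpha> > 0" and p: "1 \<le> p" and s: "\<And>k. s k \<in> fock_space \<alpha> p"
    and B: "\<And>k. fock_norm \<alpha> p (s k) \<le> B"
  shows "\<exists>r f M. strict_mono (r :: nat \<Rightarrow> nat) \<and> f \<in> fock_space \<alpha> p \<and> (\<forall>z. (\<lambda>k. s (r k) z) \<longlonglongrightarrow> f z) \<and>
    (\<forall>k z. wt \<alpha> (s k) z \<le> M) \<and> (\<forall>z. wt \<alpha> f z \<le> M)"
proof -
  obtain C where C: "C > 0" "\<forall>f\<in>(fock_space \<alpha> p :: (complex^'n \<Rightarrow> complex) set). \<forall>z. wt \<alpha> f z \<le> C * fock_norm \<alpha> p f"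
    using fock_sup_bound[OF \<alpha> p, where 'n='n] by blast
  define M where "M = C * B"
  have M: "wt \<alpha> (s k) z \<le> M" for k z
    using C(2)[rule_format, OF s[of k], of z] mult_left_mono[OF B[of k], of C] C(1) unfolding M_def by linarith
  note se = fock_space_entire[OF s]
  obtain D :: "(complex^'n) set" where D: "countable D" "\<And>X. open X \<Longrightarrow> X \<noteq> {} \<Longrightarrow> \<exists>d\<in>D. d \<in> X"
    using countable_dense_exists[where 'a="complex^'n"] by metis
  \<comment> \<open>the weight makes the family uniformly bounded, as the diagonal argument requires\<close>
  define e where "e z = complex_of_real (exp (- (\<alpha> / 2) * (norm z)\<^sup>2))" for z :: "complex^'n"
  have e0: "e z \<noteq> 0" for z by (simp add: e_def)
  have nb: "norm (s k z * e z) \<le> M" for k z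
    using M[of k z] by (simp add: wt_def e_def norm_mult)
  obtain r where r: "strict_mono (r :: nat \<Rightarrow> nat)" "\<And>x. x \<in> D \<Longrightarrow> \<exists>l. (\<lambda>k. s (r k) x * e x) \<longlonglongrightarrow> l"
    by (rule function_convergent_subsequence[of D "\<lambda>k x. s k x * e x" M]) (use D(1) nb in auto)
  have conv: "convergent (\<lambda>k. s (r k) z)" for z
  proof (rule Cauchy_convergent, rule metric_CauchyI)
    fix \<epsilon> :: real assume \<epsilon>: "\<epsilon> > 0"
    define K where "K = M * (exp ((\<alpha> * norm z + 2 * \<alpha>)\<^sup>2 / \<alpha>) * gauss_mass TYPE(complex^'n) (\<alpha> / 4)) / gauss_mass TYPE(complex^'n) \<alpha>"
    define \<delta> where "\<delta> = min 1 (\<epsilon> / (3 * (\<bar>K\<bar> + 1)))"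
    have \<delta>: "\<delta> > 0" using \<epsilon> by (simp add: \<delta>_def)
    obtain d where d: "d \<in> D" "d \<in> ball z \<delta>"
      using D(2)[of "ball z \<delta>"] \<delta> by force
    have nd: "norm (d - z) < \<delta>" using d(2) by (simp add: dist_norm norm_minus_commute)
    have near: "norm (s k d - s k z) \<le> \<epsilon> / 3" for k
    proof -
      have "norm (s k (z + (d - z)) - s k z) \<le> norm (d - z) * K"
        unfolding K_def by (rule fock_locally_lipschitz[OF \<alpha> se M]) (use nd in \<open>simp add: \<delta>_def\<close>)
      also have "\<dots> \<le> norm (d - z) * (\<bar>K\<bar> + 1)"
        by (intro mult_left_mono) auto
      also have "\<dots> \<le> (\<epsilon> / (3 * (\<bar>K\<bar> + 1))) * (\<bar>K\<bar> + 1)"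
        using nd by (intro mult_right_mono) (auto simp: \<delta>_def)
      also have "\<dots> = \<epsilon> / 3"
        by (simp add: field_simps)
      finally show ?thesis by simp
    qed
    obtain l where "(\<lambda>k. s (r k) d * e d) \<longlonglongrightarrow> l" using r(2)[OF d(1)] by blast
    then have "(\<lambda>k. s (r k) d * e d * inverse (e d)) \<longlonglongrightarrow> l * inverse (e d)"
      by (intro tendsto_intros)
    then have "(\<lambda>k. s (r k) d) \<longlonglongrightarrow> l * inverse (e d)"
      using e0 by (simp add: mult.assoc)
    then have "Cauchy (\<lambda>k. s (r k) d)" by (rule LIMSEQ_imp_Cauchy)
    then obtain N where N: "\<And>m n. m \<ge> N \<Longrightarrow> n \<ge> N \<Longrightarrow> dist (s (r m) d) (s (r n) d) < \<epsilon> / 3"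
      using \<epsilon> unfolding Cauchy_def by (meson divide_pos_pos zero_less_numeral)
    show "\<exists>N. \<forall>m\<ge>N. \<forall>n\<ge>N. dist (s (r m) z) (s (r n) z) < \<epsilon>"
    proof (intro exI allI impI)
      fix m n assume "N \<le> m" "N \<le> n"
      from N[OF this] near[of "r m"] near[of "r n"] show "dist (s (r m) z) (s (r n) z) < \<epsilon>"
        unfolding dist_norm by norm
    qed
  qed
  define f where "f z = lim (\<lambda>k. s (r k) z)" for z
  have lim: "(\<lambda>k. s (r k) z) \<longlonglongrightarrow> f z" for z
    unfolding f_def using conv by (simp add: convergent_LIMSEQ_iff)
  have fe: "entire f" and fM: "\<And>z. wt \<alpha> f z \<le> M"
    using entire_of_bounded_limit[OF \<alpha> se M lim] by auto
  have "f \<in> fock_space \<alpha> p"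
    using p
  proof (cases rule: exponent_cases)
    case 1
    show ?thesis unfolding 1 fock_space_infty using fe fM by (auto intro!: bdd_aboveI2)
  next
    case (2 t)
    let ?c = "fock_const TYPE('n) \<alpha> t"
    have c: "?c > 0" using \<alpha> 2 by (simp add: fock_const_pos)
    note [measurable] = entire_measurable[OF fe] entire_measurable[OF se]
    have wl: "(\<lambda>k. ennreal (wt \<alpha> (s (r k)) z powr t)) \<longlonglongrightarrow> ennreal (wt \<alpha> f z powr t)" for z
      unfolding wt_def by (intro tendsto_intros tendsto_ennrealI tendsto_powr' lim) (use 2 in auto)
    have bd: "(\<integral>\<^sup>+ z. ennreal (wt \<alpha> (s k) z powr t) \<partial>lborel) \<le> ennreal (B powr t / ?c)" for k
    proof -
      have "integrable lborel (\<lambda>z. wt \<alpha> (s k) z powr t)" using s[of k] 2 by (simp add: fock_space_real)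
      then have "(\<integral>\<^sup>+ z. ennreal (wt \<alpha> (s k) z powr t) \<partial>lborel) = ennreal (LINT z|lborel. wt \<alpha> (s k) z powr t)"
        by (rule nn_integral_eq_integral) simp
      moreover have "fock_norm \<alpha> p (s k) powr t \<le> B powr t"
        using fock_norm_nonneg[OF p s] B 2 by (intro powr_mono2) auto
      then have "(LINT z|lborel. wt \<alpha> (s k) z powr t) \<le> B powr t / ?c"
        unfolding 2(1) fock_norm_powr[OF 2(2) \<alpha>] using c by (simp add: field_simps)
      ultimately show ?thesis by (simp add: ennreal_leI)
    qed
    have "(\<integral>\<^sup>+ z. ennreal (wt \<alpha> f z powr t) \<partial>lborel) = (\<integral>\<^sup>+ z. liminf (\<lambda>k. ennreal (wt \<alpha> (s (r k)) z powr t)) \<partial>lborel)"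
      using lim_imp_Liminf[OF sequentially_bot wl] by simp
    also have "\<dots> \<le> liminf (\<lambda>k. \<integral>\<^sup>+ z. ennreal (wt \<alpha> (s (r k)) z powr t) \<partial>lborel)"
      by (rule nn_integral_liminf) measurable
    also have "\<dots> \<le> ennreal (B powr t / ?c)"
      by (rule Liminf_le) (use bd in auto)
    finally have "(\<integral>\<^sup>+ z. ennreal (wt \<alpha> f z powr t) \<partial>lborel) < \<infinity>"
      by (rule le_less_trans) simp
    then have "integrable lborel (\<lambda>z. wt \<alpha> f z powr t)"
      by (auto simp: integrable_iff_bounded)
    then show ?thesis using fe 2 by (simp add: fock_space_real)
  qed
  then show ?thesis using r(1) lim M fM by blast
qed

section \<open>Operator norms and embeddings\<close>

lemma operator_norm_le:
  assumes "0 \<le> C" "\<And>f. f \<in> X \<Longrightarrow> nY (T f) \<le> C * nX f"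
  shows "operator_norm X nX nY T \<le> C"
  unfolding operator_norm_def by (rule cInf_lower) (use assms in \<open>auto intro!: bdd_belowI[of _ 0]\<close>)

text \<open>
The infimum defining the operator norm is attained.
\<close>
lemma operator_norm_bound:
  assumes ex: "\<And>f. f \<in> X \<Longrightarrow> nY (T f) \<le> C * nX f" and nn: "\<And>f. f \<in> X \<Longrightarrow> 0 \<le> nX f"
  shows "0 \<le> operator_norm X nX nY T"
    and "f \<in> X \<Longrightarrow> nY (T f) \<le> operator_norm X nX nY T * nX f"
proof -
  let ?S = "{C. 0 \<le> C \<and> (\<forall>f\<in>X. nY (T f) \<le> C * nX f)}"
  have "nY (T f) \<le> max C 0 * nX f" if "f \<in> X" for f
    using ex[OF that] mult_right_mono[OF max.cobounded1[of C 0] nn[OF that]] by linarith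
  then have ne: "max C 0 \<in> ?S" by auto
  show "0 \<le> operator_norm X nX nY T"
    unfolding operator_norm_def by (rule cInf_greatest) (use ne in blast)+
  assume f: "f \<in> X"
  show "nY (T f) \<le> operator_norm X nX nY T * nX f"
  proof (cases "nX f = 0")
    case True
    then show ?thesis using ex[OF f] by simp
  next
    case False
    with nn[OF f] have pos: "nX f > 0" by simp
    have "nY (T f) / nX f \<le> Inf ?S"
    proof (rule cInf_greatest)
      show "?S \<noteq> {}" using ne by blast
      fix D assume "D \<in> ?S"
      then show "nY (T f) / nX f \<le> D" using f pos by (simp add: pos_divide_le_eq)
    qed
    then show ?thesis unfolding operator_norm_def using pos by (simp add: pos_divide_le_eq)
  qed
qed

text \<open>
Links the weighted measures of the embedding maps to powers of the weighted modulus.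
\<close>
lemma weighted_integrable_iff:
  fixes f :: "complex^'n \<Rightarrow> complex"
  assumes [measurable]: "f \<in> borel_measurable borel" and [measurable_cong]: "sets \<mu> = sets borel"
  shows "integrable (weighted_measure \<alpha> q \<mu>) (\<lambda>x. norm (f x) powr q) \<longleftrightarrow> integrable \<mu> (\<lambda>x. wt \<alpha> f x powr q)"
    and "(LINT x|weighted_measure \<alpha> q \<mu>. norm (f x) powr q) = (LINT x|\<mu>. wt \<alpha> f x powr q)"
proof -
  have e: "exp (- (q * \<alpha> * (norm x)\<^sup>2 / 2)) *\<^sub>R (norm (f x) powr q) = wt \<alpha> f x powr q" for x
    unfolding wt_powr by (simp add: mult_ac)
  show "integrable (weighted_measure \<alpha> q \<mu>) (\<lambda>x. norm (f x) powr q) \<longleftrightarrow> integrable \<mu> (\<lambda>x. wt \<alpha> f x powr q)"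
    unfolding weighted_measure_def by (subst integrable_density) (auto simp del: real_scaleR_def simp: e)
  show "(LINT x|weighted_measure \<alpha> q \<mu>. norm (f x) powr q) = (LINT x|\<mu>. wt \<alpha> f x powr q)"
    unfolding weighted_measure_def by (subst integral_density) (auto simp del: real_scaleR_def simp: e)
qed

lemma fock_carleson_wt:
  "fock_carleson \<alpha> p q \<mu> \<longleftrightarrow> (\<exists>C. \<forall>f\<in>fock_space \<alpha> p.
     (\<integral>\<^sup>+ z. ennreal (wt \<alpha> f z powr q) \<partial>\<mu>) \<le> ennreal (C * fock_norm \<alpha> p f powr q))"
  unfolding fock_carleson_def wt_powr ..

lemma Lq_norm_weighted:
  fixes f :: "complex^'n \<Rightarrow> complex"
  assumes f: "f \<in> borel_measurable borel" and s[measurable_cong]: "sets \<mu> = sets borel"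
  shows "Lq_norm q (weighted_measure \<alpha> q \<mu>) f = enn2real (\<integral>\<^sup>+ z. ennreal (wt \<alpha> f z powr q) \<partial>\<mu>) powr (1 / q)"
proof -
  note [measurable] = f
  have "(LINT z|\<mu>. wt \<alpha> f z powr q) = enn2real (\<integral>\<^sup>+ z. ennreal (wt \<alpha> f z powr q) \<partial>\<mu>)"
    by (rule integral_eq_nn_integral) auto
  then show ?thesis unfolding Lq_norm_def weighted_integrable_iff(2)[OF f s] by simp
qed

text \<open>
The \<open>q\<close>-th power of the embedding norm is the least constant in the Carleson inequality, so that norm estimates
become estimates of that constant, which is homogeneous of degree one in \<open>\<mu>\<close>.
\<close>
lemma embedding_norm_bounds:
  fixes \<mu> :: "(complex^'n) measure"
  assumes p: "1 \<le> p" and q: "q > 0" and s: "sets \<mu> = sets borel"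
    and fin: "fock_carleson \<alpha> p q \<mu>"
  shows "f \<in> fock_space \<alpha> p \<Longrightarrow> (\<integral>\<^sup>+ z. ennreal (wt \<alpha> f z powr q) \<partial>\<mu>)
      \<le> ennreal (embedding_norm \<alpha> p q \<mu> powr q * fock_norm \<alpha> p f powr q)"
    and "0 \<le> N \<Longrightarrow> (\<And>f. f \<in> fock_space \<alpha> p \<Longrightarrow>
      (\<integral>\<^sup>+ z. ennreal (wt \<alpha> f z powr q) \<partial>\<mu>) \<le> ennreal (N * fock_norm \<alpha> p f powr q)) \<Longrightarrow>
      embedding_norm \<alpha> p q \<mu> powr q \<le> N"
    and "0 \<le> embedding_norm \<alpha> p q \<mu>"
proof -
  let ?I = "\<lambda>f. \<integral>\<^sup>+ z. ennreal (wt \<alpha> f z powr q) \<partial>\<mu>"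
  let ?L = "Lq_norm q (weighted_measure \<alpha> q \<mu>)"
  note fm = entire_measurable[OF fock_space_entire]
  have L: "?L f = enn2real (?I f) powr (1 / q)" if "f \<in> fock_space \<alpha> p" for f
    by (rule Lq_norm_weighted[OF fm[OF that] s])
  have up: "?L f \<le> N powr (1 / q) * fock_norm \<alpha> p f"
    if f: "f \<in> fock_space \<alpha> p" and N: "0 \<le> N" and le: "?I f \<le> ennreal (N * fock_norm \<alpha> p f powr q)" for f N
  proof -
    have "enn2real (?I f) \<le> N * fock_norm \<alpha> p f powr q"
      using le N by (intro enn2real_leI) auto
    then have "?L f \<le> (N * fock_norm \<alpha> p f powr q) powr (1 / q)"
      unfolding L[OF f] using q by (intro powr_mono2) auto
    also have "\<dots> = N powr (1 / q) * fock_norm \<alpha> p f"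
      using N q fock_norm_nonneg[OF p f] by (simp add: powr_mult powr_powr)
    finally show ?thesis .
  qed
  obtain C where C: "\<And>f. f \<in> fock_space \<alpha> p \<Longrightarrow> ?I f \<le> ennreal (C * fock_norm \<alpha> p f powr q)"
    using fin unfolding fock_carleson_wt by blast
  have C': "?I f \<le> ennreal (max C 0 * fock_norm \<alpha> p f powr q)" if "f \<in> fock_space \<alpha> p" for f
    by (rule order_trans[OF C[OF that]]) (intro ennreal_leI mult_right_mono, auto)
  note ob = operator_norm_bound[of "fock_space \<alpha> p" ?L "\<lambda>f. f" "(max C 0) powr (1 / q)" "fock_norm \<alpha> p",
      OF up[OF _ _ C'] fock_norm_nonneg[OF p], folded embedding_norm_def, simplified]
  show E0: "0 \<le> embedding_norm \<alpha> p q \<mu>"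
    by (rule ob(1))
  show "?I f \<le> ennreal (embedding_norm \<alpha> p q \<mu> powr q * fock_norm \<alpha> p f powr q)" if f: "f \<in> fock_space \<alpha> p"
  proof -
    have "?I f < \<infinity>" using C[OF f] by (rule le_less_trans) simp
    then have e: "?I f = ennreal (enn2real (?I f))" by (simp add: less_top)
    have "(enn2real (?I f) powr (1 / q)) powr q \<le> (embedding_norm \<alpha> p q \<mu> * fock_norm \<alpha> p f) powr q"
      using ob(2)[OF f] q unfolding L[OF f] by (intro powr_mono2) auto
    then have "enn2real (?I f) \<le> embedding_norm \<alpha> p q \<mu> powr q * fock_norm \<alpha> p f powr q"
      using q E0 fock_norm_nonneg[OF p f] by (simp add: powr_powr powr_mult)
    then show ?thesis by (subst e) (rule ennreal_leI)
  qed
  show "embedding_norm \<alpha> p q \<mu> powr q \<le> N" if N: "0 \<le> N"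
    and le: "\<And>f. f \<in> fock_space \<alpha> p \<Longrightarrow> ?I f \<le> ennreal (N * fock_norm \<alpha> p f powr q)"
  proof -
    have "embedding_norm \<alpha> p q \<mu> \<le> N powr (1 / q)"
      unfolding embedding_norm_def by (rule operator_norm_le) (auto intro: up N le)
    then have "embedding_norm \<alpha> p q \<mu> powr q \<le> (N powr (1 / q)) powr q"
      using q E0 by (intro powr_mono2) auto
    then show ?thesis using N q by (simp add: powr_powr)
  qed
qed

section \<open>Integrals tending to zero\<close>

lemma tendsto_0_if_eventually_le:
  fixes u :: "'a \<Rightarrow> ennreal"
  assumes "\<And>\<epsilon>::real. \<epsilon> > 0 \<Longrightarrow> \<forall>\<^sub>F k in F. u k \<le> ennreal \<epsilon>"
  shows "(u \<longlongrightarrow> 0) F"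
proof (rule order_tendstoI)
  fix a :: ennreal assume "0 < a"
  then obtain b where b: "0 < b" "b < a" using dense by blast
  then have "b < \<infinity>" by (metis infinity_ennreal_def le_less_trans less_top order_less_imp_not_less top_greatest leD not_le)
  then obtain e where e: "b = ennreal e" "e > 0" using b by (cases b) auto
  show "\<forall>\<^sub>F k in F. u k < a"
    using assms[OF e(2)] by eventually_elim (use b e in auto)
qed simp

text \<open>
A form of dominated convergence that tolerates a part of the integrand that is small in mean only. It covers both
uses: tails at infinity, where the Berezin transform is small, and Young's inequality, where a small multiple of
\<open>\<psi> = \<phi>\<^sup>r\<close> is split off.
\<close>
lemma integrals_tendsto_0:
  fixes \<phi> \<psi> :: "nat \<Rightarrow> 'a \<Rightarrow> real" and b :: "'a \<Rightarrow> real"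
  assumes m[measurable]: "\<And>k. \<phi> k \<in> borel_measurable M" "\<And>k. \<psi> k \<in> borel_measurable M" "b \<in> borel_measurable M"
    and nn: "\<And>k x. \<phi> k x \<ge> 0" "\<And>k x. \<psi> k x \<ge> 0" "\<And>x. b x \<ge> 0"
    and lim: "\<And>x. (\<lambda>k. \<phi> k x) \<longlonglongrightarrow> 0"
    and L: "L \<ge> 0" "\<And>k. (\<integral>\<^sup>+ x. ennreal (\<psi> k x) \<partial>M) \<le> ennreal L"
    and dom: "\<And>\<epsilon>. \<epsilon> > 0 \<Longrightarrow> \<exists>g\<in>borel_measurable M. (\<forall>x. g x \<ge> 0) \<and> (\<integral>\<^sup>+ x. ennreal (g x) \<partial>M) < \<infinity> \<and>
       (\<forall>k x. \<phi> k x * b x \<le> \<epsilon> * \<psi> k x + g x)"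
  shows "(\<lambda>k. \<integral>\<^sup>+ x. ennreal (\<phi> k x * b x) \<partial>M) \<longlonglongrightarrow> 0"
proof (rule tendsto_0_if_eventually_le)
  fix \<epsilon> :: real assume \<epsilon>: "\<epsilon> > 0"
  define \<eta> where "\<eta> = \<epsilon> / 2 / (L + 1)"
  have \<eta>: "\<eta> > 0" using \<epsilon> L by (simp add: \<eta>_def)
  obtain g where [measurable]: "g \<in> borel_measurable M" and g: "\<And>x. g x \<ge> 0" "(\<integral>\<^sup>+ x. ennreal (g x) \<partial>M) < \<infinity>"
    "\<And>k x. \<phi> k x * b x \<le> \<eta> * \<psi> k x + g x"
    using dom[OF \<eta>] by blast
  define u where "u k x = max 0 (\<phi> k x * b x - \<eta> * \<psi> k x)" for k x
  have [measurable]: "u k \<in> borel_measurable M" for k unfolding u_def by measurable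
  have u0: "u k x \<ge> 0" for k x by (simp add: u_def)
  have ug: "u k x \<le> g x" for k x using g(1)[of x] g(3)[of k x] by (simp add: u_def)
  have ul: "(\<lambda>k. u k x) \<longlonglongrightarrow> 0" for x
  proof (rule tendsto_sandwich[where f = "\<lambda>_. 0"])
    show "(\<lambda>k. \<phi> k x * b x) \<longlonglongrightarrow> 0" using tendsto_mult_right[OF lim[of x], of "b x"] by simp
    show "\<forall>\<^sub>F k in sequentially. u k x \<le> \<phi> k x * b x"
      using nn \<eta> by (intro always_eventually) (simp add: u_def)
  qed (use u0 in auto)
  have "(\<lambda>k. \<integral>\<^sup>+ x. ennreal (u k x) \<partial>M) \<longlonglongrightarrow> (\<integral>\<^sup>+ x. 0 \<partial>M)"
  proof (rule nn_integral_dominated_convergence)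
    show "AE x in M. ennreal (u k x) \<le> ennreal (g x)" for k using ug by (intro AE_I2 ennreal_leI)
    show "AE x in M. (\<lambda>k. ennreal (u k x)) \<longlonglongrightarrow> 0"
      using tendsto_ennrealI[OF ul] by simp
  qed (use g in auto)
  then have "(\<lambda>k. \<integral>\<^sup>+ x. ennreal (u k x) \<partial>M) \<longlonglongrightarrow> 0" by simp
  then have "\<forall>\<^sub>F k in sequentially. (\<integral>\<^sup>+ x. ennreal (u k x) \<partial>M) < ennreal (\<epsilon> / 2)"
    by (rule order_tendstoD) (use \<epsilon> in simp)
  then show "\<forall>\<^sub>F k in sequentially. (\<integral>\<^sup>+ x. ennreal (\<phi> k x * b x) \<partial>M) \<le> ennreal \<epsilon>"
  proof eventually_elim
    case (elim k)
    have "(\<integral>\<^sup>+ x. ennreal (\<phi> k x * b x) \<partial>M) \<le> (\<integral>\<^sup>+ x. ennreal \<eta> * ennreal (\<psi> k x) + ennreal (u k x) \<partial>M)"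
    proof (rule nn_integral_mono)
      fix x
      have "\<phi> k x * b x \<le> \<eta> * \<psi> k x + u k x" by (simp add: u_def)
      then have "ennreal (\<phi> k x * b x) \<le> ennreal (\<eta> * \<psi> k x + u k x)" by (rule ennreal_leI)
      also have "\<dots> = ennreal \<eta> * ennreal (\<psi> k x) + ennreal (u k x)"
        using \<eta> nn u0 by (simp add: ennreal_plus ennreal_mult)
      finally show "ennreal (\<phi> k x * b x) \<le> ennreal \<eta> * ennreal (\<psi> k x) + ennreal (u k x)" .
    qed
    also have "\<dots> = ennreal \<eta> * (\<integral>\<^sup>+ x. ennreal (\<psi> k x) \<partial>M) + (\<integral>\<^sup>+ x. ennreal (u k x) \<partial>M)"
      by (subst nn_integral_add) (auto simp: nn_integral_cmult)
    also have "\<dots> \<le> ennreal \<eta> * ennreal L + ennreal (\<epsilon> / 2)"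
      using elim by (intro add_mono mult_left_mono L) auto
    also have "\<dots> = ennreal (\<eta> * L + \<epsilon> / 2)"
      using \<eta> L \<epsilon> by (simp add: ennreal_mult ennreal_plus)
    also have "\<dots> \<le> ennreal \<epsilon>"
    proof (rule ennreal_leI)
      have "\<eta> * L \<le> \<eta> * (L + 1)" using \<eta> by simp
      also have "\<dots> = \<epsilon> / 2"
        using L(1) nonzero_divide_eq_eq[of "L + 1" "\<epsilon> / 2" \<eta>] \<eta>_def by linarith
      finally show "\<eta> * L + \<epsilon> / 2 \<le> \<epsilon>" by simp
    qed
    finally show ?case .
  qed
qed

section \<open>Bounded operators on the smallest Fock space\<close>

text \<open>
The norm of every normalised kernel in \<open>F\<^sup>1\<close>.
\<close>
definition kern_norm :: "'n::finite itself \<Rightarrow> real \<Rightarrow> real" where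
  "kern_norm _ \<alpha> = fock_const TYPE('n) \<alpha> 1 * gauss_mass TYPE(complex^'n) (\<alpha> / 2)"

lemma kern_norm_pos: "\<alpha> > 0 \<Longrightarrow> kern_norm TYPE('n::finite) \<alpha> > 0"
  unfolding kern_norm_def by (intro mult_pos_pos fock_const_pos gauss_mass_pos) auto

lemma fock_norm_nkern:
  fixes a :: "complex^'n"
  shows "\<alpha> > 0 \<Longrightarrow> fock_norm \<alpha> 1 (nkern \<alpha> a) = kern_norm TYPE('n) \<alpha>"
  by (simp add: nkern_fock_1 kern_norm_def)

lemma nn_integral_wt_nkern_powr:
  fixes a :: "complex^'n"
  shows "(\<integral>\<^sup>+ z. ennreal (wt \<alpha> (nkern \<alpha> a) z powr q) \<partial>\<mu>) = berezin (\<alpha> * q / 2) \<mu> a"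
  unfolding berezin_def wt_nkern by (simp add: exp_powr_real mult_ac)

text \<open>
An operator into \<open>F\<^sup>1\<close> is bounded by the embedding into \<open>L\<^sup>1\<close>: integrate the weighted kernel in \<open>z\<close> first.
\<close>
lemma toeplitz_into_fock_1:
  fixes \<mu> :: "(complex^'n) measure"
  assumes \<alpha>: "\<alpha> > 0" and s: "sets \<mu> = sets borel" and sf: "sigma_finite_measure \<mu>"
    and f: "entire f" and I: "I \<ge> 0" "(\<integral>\<^sup>+ w. ennreal (wt \<alpha> f w) \<partial>\<mu>) \<le> ennreal I"
  shows "integrable \<mu> (toeplitz_integrand \<alpha> f z)"
    and "toeplitz \<alpha> \<mu> f \<in> fock_space \<alpha> 1"
    and "fock_norm \<alpha> 1 (toeplitz \<alpha> \<mu> f) \<le> kern_norm TYPE('n) \<alpha> * I"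
proof -
  note fm = entire_measurable[OF f]
  have fin: "(\<integral>\<^sup>+ w. ennreal (wt \<alpha> f w) \<partial>\<mu>) < \<infinity>"
    using I(2) by (rule le_less_trans) simp
  show "integrable \<mu> (toeplitz_integrand \<alpha> f z)"
    by (rule toeplitz_of_integrable(1)[OF \<alpha> fm s fin])
  have e: "entire (toeplitz \<alpha> \<mu> f)"
    by (rule toeplitz_of_integrable(2)[OF \<alpha> fm s fin])
  note [measurable] = entire_measurable[OF e]
  let ?g = "gauss_mass TYPE(complex^'n) (\<alpha> / 2)"
  have g: "?g > 0" using \<alpha> by (intro gauss_mass_pos) simp
  have "(\<integral>\<^sup>+ z. ennreal (wt \<alpha> (toeplitz \<alpha> \<mu> f) z) \<partial>lborel) \<le> ennreal ?g * ennreal I"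
    by (rule order_trans[OF integral_wt_toeplitz_le[OF \<alpha> fm s sf fin] mult_left_mono[OF I(2)]]) simp
  also have "\<dots> = ennreal (?g * I)"
    using g I by (simp add: ennreal_mult)
  finally have le: "(\<integral>\<^sup>+ z. ennreal (wt \<alpha> (toeplitz \<alpha> \<mu> f) z) \<partial>lborel) \<le> ennreal (?g * I)" .
  then have i: "integrable lborel (wt \<alpha> (toeplitz \<alpha> \<mu> f))"
    by (intro integrable_wt_of_nn) (auto intro: le_less_trans)
  then show "toeplitz \<alpha> \<mu> f \<in> fock_space \<alpha> 1"
    using e by (simp add: fock_space_1)
  have "(LINT z|lborel. wt \<alpha> (toeplitz \<alpha> \<mu> f) z) \<le> ?g * I"
    using le g I by (subst (asm) nn_integral_eq_integral[OF i]) auto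
  then show "fock_norm \<alpha> 1 (toeplitz \<alpha> \<mu> f) \<le> kern_norm TYPE('n) \<alpha> * I"
    unfolding fock_norm_1[OF \<alpha>] kern_norm_def mult.assoc
    using \<alpha> by (intro mult_left_mono) (auto intro!: less_imp_le[OF fock_const_pos])
qed

text \<open>
Test on the kernel at \<open>z\<close> and evaluate at \<open>z\<close>.
\<close>
lemma berezin_le_of_toeplitz_bound:
  assumes \<alpha>: "\<alpha> > 0" and p: "1 \<le> p"
  shows "\<exists>C>0. \<forall>(\<mu> :: (complex^'n) measure) N. toeplitz_admissible \<alpha> \<mu> \<longrightarrow>
    (\<forall>f\<in>fock_space \<alpha> 1. toeplitz \<alpha> \<mu> f \<in> fock_space \<alpha> p \<and> fock_norm \<alpha> p (toeplitz \<alpha> \<mu> f) \<le> N * fock_norm \<alpha> 1 f) \<longrightarrow>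
    (\<forall>z. berezin \<alpha> \<mu> z \<le> ennreal (C * N))"
proof -
  obtain C where C: "C > 0" "\<forall>f\<in>(fock_space \<alpha> p :: (complex^'n \<Rightarrow> complex) set). \<forall>z. wt \<alpha> f z \<le> C * fock_norm \<alpha> p f"
    using fock_sup_bound[OF \<alpha> p, where 'n='n] by blast
  let ?k = "kern_norm TYPE('n) \<alpha>"
  have k: "?k > 0" by (rule kern_norm_pos[OF \<alpha>])
  have "berezin \<alpha> \<mu> z \<le> ennreal (C * ?k * N)"
    if adm: "toeplitz_admissible \<alpha> \<mu>" and N: "\<forall>f\<in>fock_space \<alpha> 1. toeplitz \<alpha> \<mu> f \<in> fock_space \<alpha> p \<and>
       fock_norm \<alpha> p (toeplitz \<alpha> \<mu> f) \<le> N * fock_norm \<alpha> 1 f"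
    for \<mu> :: "(complex^'n) measure" and N z
  proof -
    let ?T = "toeplitz \<alpha> \<mu> (nkern \<alpha> z)"
    have T: "?T \<in> fock_space \<alpha> p" "fock_norm \<alpha> p ?T \<le> N * ?k"
      using N[rule_format, OF nkern_fock_1(1)[OF \<alpha>, of z]] by (auto simp: fock_norm_nkern[OF \<alpha>])
    have "enn2real (berezin \<alpha> \<mu> z) = wt \<alpha> ?T z"
      by (rule wt_toeplitz_nkern_diag[OF admissible_sets[OF adm], symmetric])
    also have "\<dots> \<le> C * fock_norm \<alpha> p ?T" using C(2) T(1) by blast
    also have "\<dots> \<le> C * (N * ?k)" using C(1) T(2) by (intro mult_left_mono) auto
    finally have "ennreal (enn2real (berezin \<alpha> \<mu> z)) \<le> ennreal (C * ?k * N)"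
      by (intro ennreal_leI) (simp add: mult_ac)
    then show ?thesis using admissible_berezin_finite[OF adm, of z] by (simp add: less_top)
  qed
  moreover have "C * ?k > 0" using C k by simp
  ultimately show ?thesis by blast
qed

text \<open>
For \<open>q = 1\<close> the Berezin transform is pulled out of the integral as a constant; for larger \<open>q\<close> the sup bound on
\<open>F\<^sup>1\<close> reduces to this case.
\<close>
lemma carleson_of_berezin:
  assumes \<alpha>: "\<alpha> > 0" and q: "1 \<le> q"
  shows "\<exists>C>0. \<forall>(\<mu> :: (complex^'n) measure) S. sets \<mu> = sets borel \<longrightarrow> sigma_finite_measure \<mu> \<longrightarrow> 0 \<le> S \<longrightarrow>
    (\<forall>z. berezin \<alpha> \<mu> z \<le> ennreal S) \<longrightarrow>
    (\<forall>f\<in>fock_space \<alpha> 1. (\<integral>\<^sup>+ z. ennreal (wt \<alpha> f z powr q) \<partial>\<mu>) \<le> ennreal (C * S * fock_norm \<alpha> 1 f powr q))"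
proof -
  obtain C where C: "C > 0" "\<forall>f\<in>(fock_space \<alpha> 1 :: (complex^'n \<Rightarrow> complex) set). \<forall>z. wt \<alpha> f z \<le> C * fock_norm \<alpha> 1 f"
    using fock_sup_bound[OF \<alpha> order_refl, where 'n='n] by blast
  let ?g = "inverse (gauss_mass TYPE(complex^'n) (\<alpha> + \<alpha> / 2))" and ?c = "fock_const TYPE('n) \<alpha> 1"
  have g: "?g > 0" using \<alpha> by (simp add: gauss_mass_pos)
  have c: "?c > 0" using \<alpha> by (simp add: fock_const_pos)
  let ?K = "C powr (q - 1) * ?g / ?c"
  have K: "?K > 0" using C g c by simp
  have "(\<integral>\<^sup>+ z. ennreal (wt \<alpha> f z powr q) \<partial>\<mu>) \<le> ennreal (?K * S * fock_norm \<alpha> 1 f powr q)"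
    if s: "sets \<mu> = sets borel" and sf: "sigma_finite_measure \<mu>" and S: "0 \<le> S" "\<forall>z. berezin \<alpha> \<mu> z \<le> ennreal S"
      and f: "f \<in> fock_space \<alpha> 1" for \<mu> :: "(complex^'n) measure" and S f
  proof -
    note [measurable_cong] = s
    let ?N = "fock_norm \<alpha> 1 f"
    have N: "?N \<ge> 0" by (rule fock_norm_nonneg[OF order_refl f])
    have e: "entire f" and i: "integrable lborel (wt \<alpha> f)" using f by (auto simp: fock_space_1)
    note [measurable] = entire_measurable[OF e]
    have "(\<integral>\<^sup>+ z. ennreal (wt \<alpha> f z powr q) \<partial>\<mu>) \<le> (\<integral>\<^sup>+ z. ennreal ((C * ?N) powr (q - 1)) * ennreal (wt \<alpha> f z) \<partial>\<mu>)"
      using C(2) f q by (intro nn_integral_mono)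
        (auto simp: ennreal_mult[symmetric] mult.commute intro!: ennreal_leI powr_le_mult_powr)
    also have "\<dots> = ennreal ((C * ?N) powr (q - 1)) * (\<integral>\<^sup>+ z. ennreal (wt \<alpha> f z) \<partial>\<mu>)"
      by (rule nn_integral_cmult) measurable
    also have "\<dots> \<le> ennreal ((C * ?N) powr (q - 1)) * (ennreal ?g * (\<integral>\<^sup>+ z. ennreal (wt \<alpha> f z) * berezin \<alpha> \<mu> z \<partial>lborel))"
      by (intro mult_left_mono integral_wt_le_berezin \<alpha> e s sf) simp
    also have "\<dots> \<le> ennreal ((C * ?N) powr (q - 1)) * (ennreal ?g * (\<integral>\<^sup>+ z. ennreal (wt \<alpha> f z) * ennreal S \<partial>lborel))"
      using S(2) by (intro mult_left_mono nn_integral_mono) auto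
    also have "(\<integral>\<^sup>+ z. ennreal (wt \<alpha> f z) * ennreal S \<partial>lborel) = ennreal (?N / ?c) * ennreal S"
      by (subst nn_integral_multc) (use c in \<open>simp_all add: nn_integral_eq_integral[OF i] fock_norm_1[OF \<alpha>]\<close>)
    also have "ennreal ((C * ?N) powr (q - 1)) * (ennreal ?g * (ennreal (?N / ?c) * ennreal S)) =
       ennreal ((C * ?N) powr (q - 1) * (?g * (?N / ?c * S)))"
      using C(1) N g c S(1) by (simp add: ennreal_mult[symmetric] del: ennreal_mult')
    also have "(C * ?N) powr (q - 1) * (?g * (?N / ?c * S)) = ?K * S * ?N powr q"
    proof -
      have "?N powr (q - 1) * ?N = ?N powr q"
        using N by (cases "?N = 0") (auto simp: powr_diff)
      then show ?thesis using C(1) N by (simp add: powr_mult field_simps)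
    qed
    finally show ?thesis .
  qed
  with K show ?thesis by blast
qed

text \<open>
Testing on kernels bounds the Berezin transform of width \<open>\<alpha>q/2\<close>, and the comparison of Gaussians returns to
width \<open>\<alpha>\<close>.
\<close>
lemma berezin_of_carleson:
  assumes \<alpha>: "\<alpha> > 0" and q: "q > 0"
  shows "\<exists>C>0. \<forall>(\<mu> :: (complex^'n) measure) N. sets \<mu> = sets borel \<longrightarrow> sigma_finite_measure \<mu> \<longrightarrow> 0 \<le> N \<longrightarrow>
    (\<forall>f\<in>fock_space \<alpha> 1. (\<integral>\<^sup>+ z. ennreal (wt \<alpha> f z powr q) \<partial>\<mu>) \<le> ennreal (N * fock_norm \<alpha> 1 f powr q)) \<longrightarrow>
    (\<forall>z. berezin \<alpha> \<mu> z \<le> ennreal (C * N))"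
proof -
  let ?k = "kern_norm TYPE('n) \<alpha>"
  let ?D = "inverse (gauss_mass TYPE(complex^'n) (\<alpha> * q / 2 + \<alpha>)) * gauss_mass TYPE(complex^'n) (\<alpha> / 2)"
  have k: "?k > 0" by (rule kern_norm_pos[OF \<alpha>])
  have D: "?D > 0" using \<alpha> q by (intro mult_pos_pos positive_imp_inverse_positive gauss_mass_pos) (auto intro: add_pos_pos)
  have "berezin \<alpha> \<mu> z \<le> ennreal (?D * ?k powr q * N)"
    if s: "sets \<mu> = sets borel" and sf: "sigma_finite_measure \<mu>" and N: "0 \<le> N"
      and le: "\<forall>f\<in>fock_space \<alpha> 1. (\<integral>\<^sup>+ z. ennreal (wt \<alpha> f z powr q) \<partial>\<mu>) \<le> ennreal (N * fock_norm \<alpha> 1 f powr q)"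
    for \<mu> :: "(complex^'n) measure" and N z
  proof -
    have 1: "berezin (\<alpha> * q / 2) \<mu> a \<le> ennreal (N * ?k powr q)" for a
      using le[rule_format, OF nkern_fock_1(1)[OF \<alpha>, of a]]
      unfolding nn_integral_wt_nkern_powr fock_norm_nkern[OF \<alpha>] .
    have "berezin \<alpha> \<mu> z \<le> ennreal (?D * (N * ?k powr q))"
      using \<alpha> q N by (intro berezin_bounded_compare[OF _ \<alpha> s sf 1]) auto
    then show ?thesis by (simp add: mult_ac)
  qed
  moreover have "?D * ?k powr q > 0" using D k by simp
  ultimately show ?thesis by blast
qed

lemma toeplitz_of_berezin:
  assumes \<alpha>: "\<alpha> > 0" and p: "1 \<le> p"
  shows "\<exists>C>0. \<forall>(\<mu> :: (complex^'n) measure) S. sets \<mu> = sets borel \<longrightarrow> sigma_finite_measure \<mu> \<longrightarrow> 0 \<le> S \<longrightarrow>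
    (\<forall>z. berezin \<alpha> \<mu> z \<le> ennreal S) \<longrightarrow>
    (\<forall>f\<in>fock_space \<alpha> 1. (\<forall>z. integrable \<mu> (toeplitz_integrand \<alpha> f z)) \<and> toeplitz \<alpha> \<mu> f \<in> fock_space \<alpha> p \<and>
      fock_norm \<alpha> p (toeplitz \<alpha> \<mu> f) \<le> C * S * fock_norm \<alpha> 1 f)"
proof -
  obtain C where C: "C > 0" "\<forall>f\<in>(fock_space \<alpha> 1 :: (complex^'n \<Rightarrow> complex) set).
      f \<in> fock_space \<alpha> p \<and> fock_norm \<alpha> p f \<le> C * fock_norm \<alpha> 1 f"
    using fock_1_subset[OF \<alpha> p, where 'n='n] by blast
  obtain D where D: "D > 0" "\<forall>(\<mu> :: (complex^'n) measure) S. sets \<mu> = sets borel \<longrightarrow> sigma_finite_measure \<mu> \<longrightarrow> 0 \<le> S \<longrightarrow>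
    (\<forall>z. berezin \<alpha> \<mu> z \<le> ennreal S) \<longrightarrow>
    (\<forall>f\<in>fock_space \<alpha> 1. (\<integral>\<^sup>+ z. ennreal (wt \<alpha> f z powr 1) \<partial>\<mu>) \<le> ennreal (D * S * fock_norm \<alpha> 1 f powr 1))"
    using carleson_of_berezin[OF \<alpha> order_refl, where 'n='n] by blast
  let ?k = "kern_norm TYPE('n) \<alpha>"
  have k: "?k > 0" by (rule kern_norm_pos[OF \<alpha>])
  have "(\<forall>z. integrable \<mu> (toeplitz_integrand \<alpha> f z)) \<and> toeplitz \<alpha> \<mu> f \<in> fock_space \<alpha> p \<and>
      fock_norm \<alpha> p (toeplitz \<alpha> \<mu> f) \<le> (C * ?k * D) * S * fock_norm \<alpha> 1 f"
    if s: "sets \<mu> = sets borel" and sf: "sigma_finite_measure \<mu>" and S: "0 \<le> S" "\<forall>z. berezin \<alpha> \<mu> z \<le> ennreal S"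
      and f: "f \<in> fock_space \<alpha> 1" for \<mu> :: "(complex^'n) measure" and S f
  proof -
    have N: "fock_norm \<alpha> 1 f \<ge> 0" by (rule fock_norm_nonneg[OF order_refl f])
    have "(\<integral>\<^sup>+ z. ennreal (wt \<alpha> f z) \<partial>\<mu>) \<le> ennreal (D * S * fock_norm \<alpha> 1 f)"
      using D(2)[rule_format, OF s sf S(1) _ f] S(2) N by simp
    note T = toeplitz_into_fock_1[OF \<alpha> s sf fock_space_entire[OF f] _ this]
    have I: "0 \<le> D * S * fock_norm \<alpha> 1 f" using D(1) S(1) N by simp
    have "fock_norm \<alpha> p (toeplitz \<alpha> \<mu> f) \<le> C * fock_norm \<alpha> 1 (toeplitz \<alpha> \<mu> f)"
      using C(2) T(2)[OF I] by blast
    also have "\<dots> \<le> C * (?k * (D * S * fock_norm \<alpha> 1 f))"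
      using C(1) T(3)[OF I] by (intro mult_left_mono) auto
    finally have "fock_norm \<alpha> p (toeplitz \<alpha> \<mu> f) \<le> (C * ?k * D) * S * fock_norm \<alpha> 1 f"
      by (simp add: mult_ac)
    then show ?thesis using T(1)[OF I] C(2) T(2)[OF I] by blast
  qed
  moreover have "C * ?k * D > 0" using C D k by simp
  ultimately show ?thesis by blast
qed

lemma toeplitz_boundedD:
  assumes p: "1 \<le> p" and b: "toeplitz_bounded \<alpha> \<mu> p r"
  shows "0 \<le> toeplitz_norm \<alpha> \<mu> p r"
    and "f \<in> fock_space \<alpha> p \<Longrightarrow> toeplitz \<alpha> \<mu> f \<in> fock_space \<alpha> r"
    and "f \<in> fock_space \<alpha> p \<Longrightarrow> fock_norm \<alpha> r (toeplitz \<alpha> \<mu> f) \<le> toeplitz_norm \<alpha> \<mu> p r * fock_norm \<alpha> p f"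
    and "f \<in> fock_space \<alpha> p \<Longrightarrow> integrable \<mu> (toeplitz_integrand \<alpha> f z)"
proof -
  obtain C where C: "\<And>f. f \<in> fock_space \<alpha> p \<Longrightarrow> fock_norm \<alpha> r (toeplitz \<alpha> \<mu> f) \<le> C * fock_norm \<alpha> p f"
    using b unfolding toeplitz_bounded_def bounded_operator_def by blast
  note ob = operator_norm_bound[of "fock_space \<alpha> p" "fock_norm \<alpha> r" "toeplitz \<alpha> \<mu>", OF C fock_norm_nonneg[OF p],
      folded toeplitz_norm_def]
  show "0 \<le> toeplitz_norm \<alpha> \<mu> p r"
    by (rule ob(1))
  show "f \<in> fock_space \<alpha> p \<Longrightarrow> fock_norm \<alpha> r (toeplitz \<alpha> \<mu> f) \<le> toeplitz_norm \<alpha> \<mu> p r * fock_norm \<alpha> p f"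
    by (rule ob(2))
  show "f \<in> fock_space \<alpha> p \<Longrightarrow> toeplitz \<alpha> \<mu> f \<in> fock_space \<alpha> r" "f \<in> fock_space \<alpha> p \<Longrightarrow> integrable \<mu> (toeplitz_integrand \<alpha> f z)"
    using b unfolding toeplitz_bounded_def bounded_operator_def toeplitz_converges_def by auto
qed

definition berezin_bounded :: "real \<Rightarrow> (complex ^ 'n) measure \<Rightarrow> bool" where
  "berezin_bounded \<gamma> \<mu> \<longleftrightarrow> (\<exists>S\<ge>0. \<forall>z. berezin \<gamma> \<mu> z \<le> ennreal S)"

lemma toeplitz_bounded_1_iff:
  fixes \<mu> :: "(complex^'n) measure"
  assumes \<alpha>: "\<alpha> > 0" and p: "1 \<le> p" and adm: "toeplitz_admissible \<alpha> \<mu>"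
  shows "toeplitz_bounded \<alpha> \<mu> 1 p \<longleftrightarrow> berezin_bounded \<alpha> \<mu>"
proof
  assume b: "toeplitz_bounded \<alpha> \<mu> 1 p"
  obtain C where C: "C > 0" "\<forall>(\<mu> :: (complex^'n) measure) N. toeplitz_admissible \<alpha> \<mu> \<longrightarrow>
    (\<forall>f\<in>fock_space \<alpha> 1. toeplitz \<alpha> \<mu> f \<in> fock_space \<alpha> p \<and> fock_norm \<alpha> p (toeplitz \<alpha> \<mu> f) \<le> N * fock_norm \<alpha> 1 f) \<longrightarrow>
    (\<forall>z. berezin \<alpha> \<mu> z \<le> ennreal (C * N))"
    using berezin_le_of_toeplitz_bound[OF \<alpha> p, where 'n='n] by blast
  note B = toeplitz_boundedD[OF order_refl b]
  have "\<forall>z. berezin \<alpha> \<mu> z \<le> ennreal (C * toeplitz_norm \<alpha> \<mu> 1 p)"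
    using C(2) adm B(2,3) by blast
  moreover have "0 \<le> C * toeplitz_norm \<alpha> \<mu> 1 p" using C(1) B(1) by simp
  ultimately show "berezin_bounded \<alpha> \<mu>" unfolding berezin_bounded_def by blast
next
  assume "berezin_bounded \<alpha> \<mu>"
  then obtain S where S: "S \<ge> 0" "\<forall>z. berezin \<alpha> \<mu> z \<le> ennreal S" unfolding berezin_bounded_def by blast
  obtain C where C: "\<forall>(\<mu> :: (complex^'n) measure) S. sets \<mu> = sets borel \<longrightarrow> sigma_finite_measure \<mu> \<longrightarrow> 0 \<le> S \<longrightarrow>
    (\<forall>z. berezin \<alpha> \<mu> z \<le> ennreal S) \<longrightarrow>
    (\<forall>f\<in>fock_space \<alpha> 1. (\<forall>z. integrable \<mu> (toeplitz_integrand \<alpha> f z)) \<and> toeplitz \<alpha> \<mu> f \<in> fock_space \<alpha> p \<and>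
      fock_norm \<alpha> p (toeplitz \<alpha> \<mu> f) \<le> C * S * fock_norm \<alpha> 1 f)"
    using toeplitz_of_berezin[OF \<alpha> p, where 'n='n] by blast
  have "\<forall>f\<in>fock_space \<alpha> 1. (\<forall>z. integrable \<mu> (toeplitz_integrand \<alpha> f z)) \<and> toeplitz \<alpha> \<mu> f \<in> fock_space \<alpha> p \<and>
      fock_norm \<alpha> p (toeplitz \<alpha> \<mu> f) \<le> C * S * fock_norm \<alpha> 1 f"
    using C admissible_sets[OF adm] admissible_sigma_finite[OF adm \<alpha>] S by simp
  then show "toeplitz_bounded \<alpha> \<mu> 1 p"
    unfolding toeplitz_bounded_def toeplitz_converges_def bounded_operator_def by blast
qed

lemma fock_carleson_1_iff:
  fixes \<mu> :: "(complex^'n) measure"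
  assumes \<alpha>: "\<alpha> > 0" and q: "1 \<le> q" and adm: "toeplitz_admissible \<alpha> \<mu>"
  shows "fock_carleson \<alpha> 1 q \<mu> \<longleftrightarrow> berezin_bounded \<alpha> \<mu>"
proof
  assume b: "fock_carleson \<alpha> 1 q \<mu>"
  have q0: "q > 0" using q by simp
  note s = admissible_sets[OF adm] and sf = admissible_sigma_finite[OF adm \<alpha>]
  note E = embedding_norm_bounds[OF order_refl q0 s b]
  obtain C where C: "C > 0" "\<forall>(\<mu> :: (complex^'n) measure) N. sets \<mu> = sets borel \<longrightarrow> sigma_finite_measure \<mu> \<longrightarrow> 0 \<le> N \<longrightarrow>
    (\<forall>f\<in>fock_space \<alpha> 1. (\<integral>\<^sup>+ z. ennreal (wt \<alpha> f z powr q) \<partial>\<mu>) \<le> ennreal (N * fock_norm \<alpha> 1 f powr q)) \<longrightarrow>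
    (\<forall>z. berezin \<alpha> \<mu> z \<le> ennreal (C * N))"
    using berezin_of_carleson[OF \<alpha> q0, where 'n='n] by blast
  have "\<forall>z. berezin \<alpha> \<mu> z \<le> ennreal (C * embedding_norm \<alpha> 1 q \<mu> powr q)"
    using C(2)[rule_format, OF s sf _ E(1)] by simp
  moreover have "0 \<le> C * embedding_norm \<alpha> 1 q \<mu> powr q" using C(1) by simp
  ultimately show "berezin_bounded \<alpha> \<mu>" unfolding berezin_bounded_def by blast
next
  assume "berezin_bounded \<alpha> \<mu>"
  then obtain S where S: "S \<ge> 0" "\<forall>z. berezin \<alpha> \<mu> z \<le> ennreal S" unfolding berezin_bounded_def by blast
  obtain C where C: "\<forall>(\<mu> :: (complex^'n) measure) S. sets \<mu> = sets borel \<longrightarrow> sigma_finite_measure \<mu> \<longrightarrow> 0 \<le> S \<longrightarrow>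
    (\<forall>z. berezin \<alpha> \<mu> z \<le> ennreal S) \<longrightarrow>
    (\<forall>f\<in>fock_space \<alpha> 1. (\<integral>\<^sup>+ z. ennreal (wt \<alpha> f z powr q) \<partial>\<mu>) \<le> ennreal (C * S * fock_norm \<alpha> 1 f powr q))"
    using carleson_of_berezin[OF \<alpha> q, where 'n='n] by blast
  note C[rule_format, OF admissible_sets[OF adm] admissible_sigma_finite[OF adm \<alpha>] S(1) S(2)[rule_format]]
  then show "fock_carleson \<alpha> 1 q \<mu>"
    unfolding fock_carleson_wt by blast
qed

lemma comparableI:
  assumes "A \<le> C * B" "B \<le> C * A" "C > 0"
  shows "comparable C A B"
  using assms unfolding comparable_def by (simp add: field_simps)

text \<open>
Both norms are comparable to the supremum of the Berezin transform.
\<close>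
lemma toeplitz_norm_comparable_1:
  assumes \<alpha>: "\<alpha> > 0" and p: "1 \<le> p" and q: "1 \<le> q"
  shows "\<exists>C>0. \<forall>\<mu> :: (complex ^ 'n) measure. toeplitz_admissible \<alpha> \<mu> \<and> toeplitz_bounded \<alpha> \<mu> 1 p \<longrightarrow>
             comparable C (toeplitz_norm \<alpha> \<mu> 1 p) (embedding_norm \<alpha> 1 q \<mu> powr q)"
proof -
  have q0: "q > 0" using q by simp
  obtain C1 where C1: "C1 > 0" "\<forall>(\<mu> :: (complex^'n) measure) N. toeplitz_admissible \<alpha> \<mu> \<longrightarrow>
    (\<forall>f\<in>fock_space \<alpha> 1. toeplitz \<alpha> \<mu> f \<in> fock_space \<alpha> p \<and> fock_norm \<alpha> p (toeplitz \<alpha> \<mu> f) \<le> N * fock_norm \<alpha> 1 f) \<longrightarrow>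
    (\<forall>z. berezin \<alpha> \<mu> z \<le> ennreal (C1 * N))"
    using berezin_le_of_toeplitz_bound[OF \<alpha> p, where 'n='n] by blast
  obtain C2 where C2: "C2 > 0" "\<forall>(\<mu> :: (complex^'n) measure) N. sets \<mu> = sets borel \<longrightarrow> sigma_finite_measure \<mu> \<longrightarrow> 0 \<le> N \<longrightarrow>
    (\<forall>f\<in>fock_space \<alpha> 1. (\<integral>\<^sup>+ z. ennreal (wt \<alpha> f z powr q) \<partial>\<mu>) \<le> ennreal (N * fock_norm \<alpha> 1 f powr q)) \<longrightarrow>
    (\<forall>z. berezin \<alpha> \<mu> z \<le> ennreal (C2 * N))"
    using berezin_of_carleson[OF \<alpha> q0, where 'n='n] by blast
  obtain C3 where C3: "C3 > 0" "\<forall>(\<mu> :: (complex^'n) measure) S. sets \<mu> = sets borel \<longrightarrow> sigma_finite_measure \<mu> \<longrightarrow> 0 \<le> S \<longrightarrow>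
    (\<forall>z. berezin \<alpha> \<mu> z \<le> ennreal S) \<longrightarrow>
    (\<forall>f\<in>fock_space \<alpha> 1. (\<integral>\<^sup>+ z. ennreal (wt \<alpha> f z powr q) \<partial>\<mu>) \<le> ennreal (C3 * S * fock_norm \<alpha> 1 f powr q))"
    using carleson_of_berezin[OF \<alpha> q, where 'n='n] by blast
  obtain C4 where C4: "C4 > 0" "\<forall>(\<mu> :: (complex^'n) measure) S. sets \<mu> = sets borel \<longrightarrow> sigma_finite_measure \<mu> \<longrightarrow> 0 \<le> S \<longrightarrow>
    (\<forall>z. berezin \<alpha> \<mu> z \<le> ennreal S) \<longrightarrow>
    (\<forall>f\<in>fock_space \<alpha> 1. (\<forall>z. integrable \<mu> (toeplitz_integrand \<alpha> f z)) \<and> toeplitz \<alpha> \<mu> f \<in> fock_space \<alpha> p \<and>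
      fock_norm \<alpha> p (toeplitz \<alpha> \<mu> f) \<le> C4 * S * fock_norm \<alpha> 1 f)"
    using toeplitz_of_berezin[OF \<alpha> p, where 'n='n] by blast
  define C where "C = max (C4 * C2) (C3 * C1)"
  have C: "C > 0" unfolding C_def using C2(1) C4(1) by (simp add: less_max_iff_disj)
  have "comparable C (toeplitz_norm \<alpha> \<mu> 1 p) (embedding_norm \<alpha> 1 q \<mu> powr q)"
    if adm: "toeplitz_admissible \<alpha> \<mu>" and b: "toeplitz_bounded \<alpha> \<mu> 1 p" for \<mu> :: "(complex^'n) measure"
  proof -
    note s = admissible_sets[OF adm] and sf = admissible_sigma_finite[OF adm \<alpha>]
    note T = toeplitz_boundedD[OF order_refl b]
    let ?T = "toeplitz_norm \<alpha> \<mu> 1 p" and ?E = "embedding_norm \<alpha> 1 q \<mu> powr q"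
    have car: "fock_carleson \<alpha> 1 q \<mu>"
      using b by (simp add: toeplitz_bounded_1_iff[OF \<alpha> p adm] fock_carleson_1_iff[OF \<alpha> q adm])
    note E = embedding_norm_bounds[OF order_refl q0 s car]
    have bzE: "\<forall>z. berezin \<alpha> \<mu> z \<le> ennreal (C2 * ?E)"
      using C2(2)[rule_format, OF s sf _ E(1)] by simp
    have bzT: "\<forall>z. berezin \<alpha> \<mu> z \<le> ennreal (C1 * ?T)"
      using C1(2) adm T(2,3) by blast
    have "0 \<le> C2 * ?E" "0 \<le> C1 * ?T" using C2(1) C1(1) T(1) by auto
    have "?T \<le> C4 * (C2 * ?E)"
      unfolding toeplitz_norm_def
      by (rule operator_norm_le) (use C4 C2(1) s sf \<open>0 \<le> C2 * ?E\<close> bzE in auto)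
    also have "\<dots> \<le> C * ?E"
      unfolding mult.assoc[symmetric] C_def by (intro mult_right_mono) auto
    finally have 1: "?T \<le> C * ?E" .
    have "?E \<le> C3 * (C1 * ?T)"
    proof (rule E(2))
      show "0 \<le> C3 * (C1 * ?T)" using C3(1) \<open>0 \<le> C1 * ?T\<close> by simp
      show "\<And>f. f \<in> fock_space \<alpha> 1 \<Longrightarrow> (\<integral>\<^sup>+ z. ennreal (wt \<alpha> f z powr q) \<partial>\<mu>) \<le> ennreal (C3 * (C1 * ?T) * fock_norm \<alpha> 1 f powr q)"
        using C3(2) s sf \<open>0 \<le> C1 * ?T\<close> bzT by blast
    qed
    also have "\<dots> \<le> C * ?T"
      unfolding mult.assoc[symmetric] C_def using T(1) by (intro mult_right_mono) auto
    finally have 2: "?E \<le> C * ?T" .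
    show ?thesis by (rule comparableI[OF 1 2 C])
  qed
  with C show ?thesis by blast
qed

section \<open>Compact operators on the smallest Fock space\<close>

definition berezin_vanishes :: "real \<Rightarrow> (complex ^ 'n) measure \<Rightarrow> bool" where
  "berezin_vanishes \<gamma> \<mu> \<longleftrightarrow> (\<forall>\<epsilon>>0. \<exists>R. \<forall>z. R \<le> norm z \<longrightarrow> berezin \<gamma> \<mu> z \<le> ennreal \<epsilon>)"

lemma compact_operatorD:
  assumes K: "compact_operator X nX Y nY T" and s: "\<And>k. s k \<in> X" "\<And>k. nX (s k) \<le> B"
  shows "\<exists>r g. strict_mono (r :: nat \<Rightarrow> nat) \<and> g \<in> Y \<and> (\<lambda>k. nY (\<lambda>x. T (s (r k)) x - g x)) \<longlonglongrightarrow> 0"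
proof -
  have "(\<forall>k. s k \<in> X) \<and> (\<exists>B. \<forall>k. nX (s k) \<le> B)" using s by blast
  then show ?thesis
    using K[unfolded compact_operator_def, THEN conjunct2, THEN spec[of _ s]] by blast
qed

lemma not_berezin_vanishes:
  fixes \<mu> :: "(complex^'n) measure"
  assumes "\<not> berezin_vanishes \<gamma> \<mu>"
  shows "\<exists>\<epsilon>>0. \<exists>w. \<forall>k::nat. real k \<le> norm (w k) \<and> ennreal \<epsilon> < berezin \<gamma> \<mu> (w k)"
proof -
  obtain \<epsilon> where \<epsilon>: "\<epsilon> > 0" "\<And>R. \<exists>z. R \<le> norm z \<and> \<not> berezin \<gamma> \<mu> z \<le> ennreal \<epsilon>"
    using assms unfolding berezin_vanishes_def by blast
  have "\<forall>k::nat. \<exists>z. real k \<le> norm z \<and> ennreal \<epsilon> < berezin \<gamma> \<mu> z"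
    using \<epsilon>(2) by (meson not_le)
  then obtain w where "\<forall>k. real k \<le> norm (w k) \<and> ennreal \<epsilon> < berezin \<gamma> \<mu> (w k)" by metis
  then show ?thesis using \<epsilon>(1) by blast
qed

lemma berezin_vanishes_antimono: "berezin_vanishes \<gamma> \<mu> \<Longrightarrow> \<gamma> \<le> \<delta> \<Longrightarrow> berezin_vanishes \<delta> \<mu>"
  unfolding berezin_vanishes_def by (meson berezin_antimono order_trans)

text \<open>
Like boundedness, decay at infinity does not depend on the width. Boundedness on compact sets is not part of the
hypothesis; it comes from admissibility, after passing to a width of at least \<open>2\<alpha>\<close>. A Gaussian average of a
bounded function that tends to zero at infinity again tends to zero.
\<close>
lemma berezin_vanishes_change:
  fixes \<mu> :: "(complex^'n) measure"
  assumes \<alpha>: "\<alpha> > 0" and adm: "toeplitz_admissible \<alpha> \<mu>" and \<gamma>: "\<gamma> > 0" and \<delta>: "\<delta> > 0"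
    and v: "berezin_vanishes \<gamma> \<mu>"
  shows "berezin_vanishes \<delta> \<mu>" and "berezin_bounded \<delta> \<mu>"
proof -
  note s[measurable_cong] = admissible_sets[OF adm] and sf = admissible_sigma_finite[OF adm \<alpha>]
  \<comment> \<open>large enough for the local bound, and decay is inherited from \<open>\<gamma>\<close>\<close>
  define \<gamma>' where "\<gamma>' = max \<gamma> (2 * \<alpha>)"
  have \<gamma>': "\<gamma>' > 0" "\<gamma>' \<ge> 2 * \<alpha>" "\<gamma> \<le> \<gamma>'" using \<gamma> by (auto simp: \<gamma>'_def)
  have v': "berezin_vanishes \<gamma>' \<mu>" by (rule berezin_vanishes_antimono[OF v \<gamma>'(3)])
  obtain S where S: "S \<ge> 0" "\<And>z. berezin \<gamma>' \<mu> z \<le> ennreal S"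
  proof -
    obtain R where R: "\<And>z. R \<le> norm z \<Longrightarrow> berezin \<gamma>' \<mu> z \<le> ennreal 1"
      using v' unfolding berezin_vanishes_def by (meson zero_less_one)
    define b where "b = enn2real (berezin \<alpha> \<mu> 0)"
    have b: "berezin \<alpha> \<mu> 0 = ennreal b"
      unfolding b_def using admissible_berezin_finite[OF adm, of 0] by (simp add: less_top)
    have b0: "b \<ge> 0" by (simp add: b_def)
    have "berezin \<gamma>' \<mu> z \<le> ennreal (1 + exp (2 * \<alpha> * R\<^sup>2) * b)" for z
    proof (cases "R \<le> norm z")
      case True
      have "ennreal 1 \<le> ennreal (1 + exp (2 * \<alpha> * R\<^sup>2) * b)"
        using b0 by (intro ennreal_leI) simp
      then show ?thesis using R[OF True] by (rule order_trans[rotated])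
    next
      case False
      then have "(norm z)\<^sup>2 \<le> R\<^sup>2" by (intro power_mono) auto
      then have "exp (2 * \<alpha> * (norm z)\<^sup>2) \<le> exp (2 * \<alpha> * R\<^sup>2)"
        using \<alpha> by simp
      then have "exp (2 * \<alpha> * (norm z)\<^sup>2) * b \<le> exp (2 * \<alpha> * R\<^sup>2) * b"
        using b0 by (rule mult_right_mono)
      then have "exp (2 * \<alpha> * (norm z)\<^sup>2) * b \<le> 1 + exp (2 * \<alpha> * R\<^sup>2) * b"
        by linarith
      moreover have "berezin \<gamma>' \<mu> z \<le> ennreal (exp (2 * \<alpha> * (norm z)\<^sup>2) * b)"
        using berezin_local_bound[OF \<alpha> \<gamma>'(2) s, of z 0] b0 unfolding b by (simp add: ennreal_mult)
      ultimately show ?thesis by (meson ennreal_leI order_trans)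
    qed
    moreover have "1 + exp (2 * \<alpha> * R\<^sup>2) * b \<ge> 0" using b0 by simp
    ultimately show ?thesis using that by blast
  qed
  let ?c = "inverse (gauss_mass TYPE(complex^'n) (\<gamma>' + \<delta>))"
  have c: "?c > 0" using \<gamma>' \<delta> by (simp add: gauss_mass_pos)
  show "berezin_bounded \<delta> \<mu>"
    unfolding berezin_bounded_def
  proof (intro exI conjI allI)
    show "berezin \<delta> \<mu> z \<le> ennreal (?c * gauss_mass TYPE(complex^'n) (\<delta> / 2) * S)" for z
      by (rule berezin_bounded_compare[OF \<gamma>'(1) \<delta> s sf S(2,1)])
    show "0 \<le> ?c * gauss_mass TYPE(complex^'n) (\<delta> / 2) * S"
      using c S(1) \<delta> by (simp add: less_imp_le[OF gauss_mass_pos])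
  qed
  let ?g = "gauss_mass TYPE(complex^'n) (\<delta> / 4)"
  have g: "?g > 0" using \<delta> by (simp add: gauss_mass_pos)
  show "berezin_vanishes \<delta> \<mu>"
    unfolding berezin_vanishes_def
  proof (intro allI impI)
    fix \<epsilon> :: real assume \<epsilon>: "\<epsilon> > 0"
    define \<eta> where "\<eta> = \<epsilon> / (2 * ?c * ?g)"
    have \<eta>: "\<eta> > 0" using \<epsilon> c g by (simp add: \<eta>_def)
    obtain R0 where R0: "\<And>z. R0 \<le> norm z \<Longrightarrow> berezin \<gamma>' \<mu> z \<le> ennreal \<eta>"
      using v' \<eta> unfolding berezin_vanishes_def by meson
    define R where "R = max R0 0"
    have R: "\<And>z. R \<le> norm z \<Longrightarrow> berezin \<gamma>' \<mu> z \<le> ennreal \<eta>" "R \<ge> 0" using R0 by (auto simp: R_def)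
    have "((\<lambda>t. S * exp (- (\<delta> / 4) * t\<^sup>2)) \<longlongrightarrow> S * 0) at_top"
    proof (intro tendsto_mult tendsto_const filterlim_compose[OF exp_at_bot])
      show "filterlim (\<lambda>t. - (\<delta> / 4) * t\<^sup>2) at_bot at_top"
        using \<delta> by real_asymp
    qed
    then have "\<forall>\<^sub>F t in at_top. S * exp (- (\<delta> / 4) * t\<^sup>2) < \<eta>"
      using \<eta> by (intro order_tendstoD) auto
    then obtain t0 where t0: "\<And>t. t \<ge> t0 \<Longrightarrow> S * exp (- (\<delta> / 4) * t\<^sup>2) < \<eta>"
      unfolding eventually_at_top_linorder by blast
    show "\<exists>R'. \<forall>w. R' \<le> norm w \<longrightarrow> berezin \<delta> \<mu> w \<le> ennreal \<epsilon>"
    proof (intro exI allI impI)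
      fix w :: "complex^'n" assume w: "R + max t0 0 \<le> norm w"
      have "berezin \<gamma>' \<mu> z * ennreal (gauss (\<delta> / 2) z w) \<le>
          ennreal (2 * \<eta>) * ennreal (gauss (\<delta> / 4) z w)" for z
      proof (cases "R \<le> norm z")
        case True
        have "berezin \<gamma>' \<mu> z * ennreal (gauss (\<delta> / 2) z w) \<le>
          ennreal \<eta> * ennreal (gauss (\<delta> / 4) z w)"
          using R(1)[OF True] \<delta> by (intro mult_mono ennreal_leI) (auto intro: mult_right_mono)
        also have "\<dots> \<le> ennreal (2 * \<eta>) * ennreal (gauss (\<delta> / 4) z w)"
          using \<eta> by (intro mult_right_mono ennreal_leI) auto
        finally show ?thesis .
      next
        case False
        have "norm w \<le> norm z + norm (z - w)" by norm
        with False w have d: "norm (z - w) \<ge> max t0 0" by linarith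
        have "gauss (\<delta> / 2) z w = gauss (\<delta> / 4) z w * gauss (\<delta> / 4) z w"
          unfolding mult_exp_exp by (rule arg_cong[of _ _ exp]) (simp add: field_simps)
        then have "berezin \<gamma>' \<mu> z * ennreal (gauss (\<delta> / 2) z w) \<le>
          ennreal S * (ennreal (gauss (\<delta> / 4) z w) * ennreal (gauss (\<delta> / 4) z w))"
          using S(2)[of z] by (simp only: ennreal_mult[OF exp_ge_zero exp_ge_zero]) (rule mult_right_mono, auto)
        also have "\<dots> = ennreal (S * gauss (\<delta> / 4) z w) * ennreal (gauss (\<delta> / 4) z w)"
          using S(1) by (simp add: ennreal_mult mult.assoc)
        also have "\<dots> \<le> ennreal (2 * \<eta>) * ennreal (gauss (\<delta> / 4) z w)"
          using t0[of "norm (z - w)"] d \<eta> by (intro mult_right_mono ennreal_leI) auto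
        finally show ?thesis .
      qed
      then have "(\<integral>\<^sup>+ z. berezin \<gamma>' \<mu> z * ennreal (gauss (\<delta> / 2) z w) \<partial>lborel)
        \<le> (\<integral>\<^sup>+ z. ennreal (2 * \<eta>) * ennreal (gauss (\<delta> / 4) z w) \<partial>lborel)"
        by (intro nn_integral_mono)
      also have "\<dots> = ennreal (2 * \<eta>) * ennreal ?g"
        using \<delta> by (subst nn_integral_cmult) (auto simp: gauss_nn_integral[of "\<delta> / 4" w, simplified])
      finally have "berezin \<delta> \<mu> w \<le> ennreal ?c * (ennreal (2 * \<eta>) * ennreal ?g)"
        using berezin_compare[OF \<gamma>'(1) \<delta> s sf, of w] by (meson mult_left_mono order_trans zero_le)
      also have "\<dots> = ennreal (?c * (2 * \<eta> * ?g))"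
        using c g \<eta> by (simp add: ennreal_mult[symmetric] del: ennreal_mult')
      also have "?c * (2 * \<eta> * ?g) = \<epsilon>"
        using c g unfolding \<eta>_def by (simp add: field_simps)
      finally show "berezin \<delta> \<mu> w \<le> ennreal \<epsilon>" .
    qed
  qed
qed

lemma toeplitz_diff:
  assumes "integrable \<mu> (toeplitz_integrand \<alpha> f z)" "integrable \<mu> (toeplitz_integrand \<alpha> g z)"
  shows "toeplitz \<alpha> \<mu> (\<lambda>x. f x - g x) z = toeplitz \<alpha> \<mu> f z - toeplitz \<alpha> \<mu> g z"
proof -
  have "toeplitz_integrand \<alpha> (\<lambda>x. f x - g x) z = (\<lambda>w. toeplitz_integrand \<alpha> f z w - toeplitz_integrand \<alpha> g z w)"
    by (simp add: fun_eq_iff toeplitz_integrand_def algebra_simps)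
  then show ?thesis unfolding toeplitz_def by (simp add: Bochner_Integration.integral_diff assms)
qed

lemma wt_tendsto_0:
  assumes "(\<lambda>k. s k z) \<longlonglongrightarrow> f z"
  shows "(\<lambda>k. wt \<alpha> (\<lambda>x. s k x - f x) z) \<longlonglongrightarrow> 0"
proof -
  have "(\<lambda>k. norm (s k z - f z) * exp (- (\<alpha> / 2) * (norm z)\<^sup>2)) \<longlonglongrightarrow> norm (f z - f z) * exp (- (\<alpha> / 2) * (norm z)\<^sup>2)"
    by (intro tendsto_intros assms)
  then show ?thesis by (simp add: wt_def)
qed

lemma wt_diff_le_bound:
  assumes "wt \<alpha> f z \<le> M" "wt \<alpha> g z \<le> M"
  shows "wt \<alpha> (\<lambda>x. f x - g x) z \<le> 2 * M"
  using wt_diff_le[of \<alpha> f g z] assms by linarith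

text \<open>
Transfers convergence to zero from Lebesgue measure, where dominated convergence applies, to \<open>\<mu>\<close>.
\<close>
lemma integral_wt_tendsto_0_of_berezin:
  fixes \<mu> :: "(complex^'n) measure" and d :: "nat \<Rightarrow> complex^'n \<Rightarrow> complex"
  assumes \<alpha>: "\<alpha> > 0" and \<gamma>: "\<gamma> > 0" and s: "sets \<mu> = sets borel" and sf: "sigma_finite_measure \<mu>"
    and d: "\<And>k. entire (d k)" and b: "\<And>z. berezin \<gamma> \<mu> z = ennreal (b z)" "\<And>z. b z \<ge> 0"
    and lim: "(\<lambda>k. \<integral>\<^sup>+ z. ennreal (wt \<alpha> (d k) z * b z) \<partial>lborel) \<longlonglongrightarrow> 0"
  shows "(\<lambda>k. \<integral>\<^sup>+ z. ennreal (wt \<alpha> (d k) z) \<partial>\<mu>) \<longlonglongrightarrow> 0"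
proof -
  let ?c = "ennreal (inverse (gauss_mass TYPE(complex^'n) (\<gamma> + \<alpha> / 2)))"
  have "(\<lambda>k. ?c * (\<integral>\<^sup>+ z. ennreal (wt \<alpha> (d k) z * b z) \<partial>lborel)) \<longlonglongrightarrow> ?c * 0"
    by (rule ennreal_tendsto_cmult[OF _ lim]) simp
  then have 0: "(\<lambda>k. ?c * (\<integral>\<^sup>+ z. ennreal (wt \<alpha> (d k) z * b z) \<partial>lborel)) \<longlonglongrightarrow> 0" by simp
  have le: "(\<integral>\<^sup>+ z. ennreal (wt \<alpha> (d k) z) \<partial>\<mu>) \<le> ?c * (\<integral>\<^sup>+ z. ennreal (wt \<alpha> (d k) z * b z) \<partial>lborel)" for k
    using integral_wt_le_berezin[OF \<alpha> \<gamma> d s sf, of k] b by (simp add: ennreal_mult)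
  show ?thesis
    by (rule tendsto_sandwich[OF _ _ tendsto_const 0]) (use le in auto)
qed

text \<open>
Compactness into every \<open>F\<^sup>t\<close> reduces to a statement about integrals: along a pointwise convergent bounded sequence
the weighted moduli of the differences tend to zero in \<open>L\<^sup>1(\<mu>)\<close>.
\<close>
lemma toeplitz_compact_of_integrals:
  fixes \<mu> :: "(complex^'n) measure"
  assumes \<alpha>: "\<alpha> > 0" and p: "1 \<le> p" and t: "1 \<le> t"
    and s: "sets \<mu> = sets borel" and sf: "sigma_finite_measure \<mu>"
    and fin: "\<And>f. f \<in> fock_space \<alpha> p \<Longrightarrow> (\<integral>\<^sup>+ z. ennreal (wt \<alpha> f z) \<partial>\<mu>) < \<infinity>"
    and small: "\<And>s f M. (\<And>k. s k \<in> fock_space \<alpha> p) \<Longrightarrow> f \<in> fock_space \<alpha> p \<Longrightarrow> (\<exists>B. \<forall>k. fock_norm \<alpha> p (s k) \<le> B) \<Longrightarrow>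
        (\<And>z. (\<lambda>k. s k z) \<longlonglongrightarrow> f z) \<Longrightarrow> (\<And>k z. wt \<alpha> (s k) z \<le> M) \<Longrightarrow> (\<And>z. wt \<alpha> f z \<le> M) \<Longrightarrow>
        (\<lambda>k. \<integral>\<^sup>+ z. ennreal (wt \<alpha> (\<lambda>x. s k x - f x) z) \<partial>\<mu>) \<longlonglongrightarrow> 0"
  shows "toeplitz_compact \<alpha> \<mu> p t"
proof -
  obtain C where C: "C > 0" "\<forall>f\<in>(fock_space \<alpha> 1 :: (complex^'n \<Rightarrow> complex) set).
      f \<in> fock_space \<alpha> t \<and> fock_norm \<alpha> t f \<le> C * fock_norm \<alpha> 1 f"
    using fock_1_subset[OF \<alpha> t, where 'n='n] by blast
  let ?k = "kern_norm TYPE('n) \<alpha>"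
  have k: "?k > 0" by (rule kern_norm_pos[OF \<alpha>])
  have T: "(\<forall>z. integrable \<mu> (toeplitz_integrand \<alpha> f z)) \<and> toeplitz \<alpha> \<mu> f \<in> fock_space \<alpha> t \<and>
      fock_norm \<alpha> t (toeplitz \<alpha> \<mu> f) \<le> C * (?k * enn2real (\<integral>\<^sup>+ z. ennreal (wt \<alpha> f z) \<partial>\<mu>))"
    if f: "f \<in> fock_space \<alpha> p" for f
  proof -
    let ?I = "enn2real (\<integral>\<^sup>+ z. ennreal (wt \<alpha> f z) \<partial>\<mu>)"
    have "(\<integral>\<^sup>+ z. ennreal (wt \<alpha> f z) \<partial>\<mu>) \<le> ennreal ?I" using fin[OF f] by (simp add: less_top)
    note T = toeplitz_into_fock_1[OF \<alpha> s sf fock_space_entire[OF f] enn2real_nonneg this]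
    have "fock_norm \<alpha> t (toeplitz \<alpha> \<mu> f) \<le> C * fock_norm \<alpha> 1 (toeplitz \<alpha> \<mu> f)"
      using C(2) T(2) by blast
    also have "\<dots> \<le> C * (?k * ?I)"
      using C(1) T(3) by (intro mult_left_mono) auto
    finally show ?thesis using T(1,2) C(2) by blast
  qed
  show ?thesis
    unfolding toeplitz_compact_def compact_operator_def toeplitz_converges_def
  proof (intro conjI ballI allI impI)
    fix f :: "complex^'n \<Rightarrow> complex" and z assume "f \<in> fock_space \<alpha> p"
    then show "integrable \<mu> (toeplitz_integrand \<alpha> f z)" "toeplitz \<alpha> \<mu> f \<in> fock_space \<alpha> t" using T by auto
  next
    fix s :: "nat \<Rightarrow> complex^'n \<Rightarrow> complex"
    assume "(\<forall>k. s k \<in> fock_space \<alpha> p) \<and> (\<exists>B. \<forall>k. fock_norm \<alpha> p (s k) \<le> B)"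
    then obtain B where sk: "\<And>k. s k \<in> fock_space \<alpha> p" and B: "\<And>k. fock_norm \<alpha> p (s k) \<le> B" by blast
    obtain r f M where r: "strict_mono (r :: nat \<Rightarrow> nat)" and f: "f \<in> fock_space \<alpha> p"
      and lim: "\<And>z. (\<lambda>k. s (r k) z) \<longlonglongrightarrow> f z" and M: "\<And>k z. wt \<alpha> (s k) z \<le> M" "\<And>z. wt \<alpha> f z \<le> M"
      using fock_normal_family[OF \<alpha> p, of s B, OF sk B] by blast
    have 0: "(\<lambda>k. \<integral>\<^sup>+ z. ennreal (wt \<alpha> (\<lambda>x. s (r k) x - f x) z) \<partial>\<mu>) \<longlonglongrightarrow> 0"
      by (rule small[OF sk f _ lim M]) (use B in blast)
    have "(\<lambda>k. enn2real (\<integral>\<^sup>+ z. ennreal (wt \<alpha> (\<lambda>x. s (r k) x - f x) z) \<partial>\<mu>)) \<longlonglongrightarrow> 0"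
      by (rule tendsto_enn2real) (use 0 in auto)
    then have "(\<lambda>k. C * (?k * enn2real (\<integral>\<^sup>+ z. ennreal (wt \<alpha> (\<lambda>x. s (r k) x - f x) z) \<partial>\<mu>))) \<longlonglongrightarrow> C * (?k * 0)"
      by (intro tendsto_mult tendsto_const)
    then have up: "(\<lambda>k. C * (?k * enn2real (\<integral>\<^sup>+ z. ennreal (wt \<alpha> (\<lambda>x. s (r k) x - f x) z) \<partial>\<mu>))) \<longlonglongrightarrow> 0" by simp
    have dk: "(\<lambda>x. s (r k) x - f x) \<in> fock_space \<alpha> p" for k by (rule fock_diff(1)[OF p sk f])
    have eq: "toeplitz \<alpha> \<mu> (\<lambda>x. s (r k) x - f x) = (\<lambda>x. toeplitz \<alpha> \<mu> (s (r k)) x - toeplitz \<alpha> \<mu> f x)" for k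
      by (rule ext, rule toeplitz_diff) (use T sk f in auto)
    have "(\<lambda>k. fock_norm \<alpha> t (\<lambda>x. toeplitz \<alpha> \<mu> (s (r k)) x - toeplitz \<alpha> \<mu> f x)) \<longlonglongrightarrow> 0"
    proof (rule tendsto_sandwich[OF _ _ tendsto_const up])
      show "\<forall>\<^sub>F k in sequentially. 0 \<le> fock_norm \<alpha> t (\<lambda>x. toeplitz \<alpha> \<mu> (s (r k)) x - toeplitz \<alpha> \<mu> f x)"
        unfolding eq[symmetric] using fock_norm_nonneg[OF t] T[OF dk] by (intro always_eventually) auto
      show "\<forall>\<^sub>F k in sequentially. fock_norm \<alpha> t (\<lambda>x. toeplitz \<alpha> \<mu> (s (r k)) x - toeplitz \<alpha> \<mu> f x) \<le>
         C * (?k * enn2real (\<integral>\<^sup>+ z. ennreal (wt \<alpha> (\<lambda>x. s (r k) x - f x) z) \<partial>\<mu>))"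
        unfolding eq[symmetric] using T[OF dk] by (intro always_eventually) auto
    qed
    then show "\<exists>r g. strict_mono r \<and> g \<in> fock_space \<alpha> t \<and> (\<lambda>k. fock_norm \<alpha> t (\<lambda>x. toeplitz \<alpha> \<mu> (s (r k)) x - g x)) \<longlonglongrightarrow> 0"
      using r T[OF f] by blast
  qed
qed

text \<open>
Outside a large ball the Berezin transform is small and the differences are bounded in \<open>F\<^sup>1\<close>; inside it
dominated convergence applies.
\<close>
lemma integral_wt_small_of_vanishing:
  fixes \<mu> :: "(complex^'n) measure" and s :: "nat \<Rightarrow> complex^'n \<Rightarrow> complex"
  assumes \<alpha>: "\<alpha> > 0" and adm: "toeplitz_admissible \<alpha> \<mu>" and v: "berezin_vanishes \<alpha> \<mu>"
    and sk: "\<And>k. s k \<in> fock_space \<alpha> 1" and f: "f \<in> fock_space \<alpha> 1" and B: "\<exists>B. \<forall>k. fock_norm \<alpha> 1 (s k) \<le> B"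
    and lim: "\<And>z. (\<lambda>k. s k z) \<longlonglongrightarrow> f z" and M: "\<And>k z. wt \<alpha> (s k) z \<le> M" "\<And>z. wt \<alpha> f z \<le> M"
  shows "(\<lambda>k. \<integral>\<^sup>+ z. ennreal (wt \<alpha> (\<lambda>x. s k x - f x) z) \<partial>\<mu>) \<longlonglongrightarrow> 0"
proof -
  note s[measurable_cong] = admissible_sets[OF adm] and sf = admissible_sigma_finite[OF adm \<alpha>]
  obtain S where S: "S \<ge> 0" "\<And>z. berezin \<alpha> \<mu> z \<le> ennreal S"
    using berezin_vanishes_change(2)[OF \<alpha> adm \<alpha> \<alpha> v] unfolding berezin_bounded_def by blast
  define b where "b z = enn2real (berezin \<alpha> \<mu> z)" for z
  have b: "berezin \<alpha> \<mu> z = ennreal (b z)" "b z \<ge> 0" "b z \<le> S" for z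
    using admissible_berezin_finite[OF adm, of z] S(1) enn2real_leI[OF S(1) S(2)[of z]]
    by (auto simp: b_def less_top)
  have [measurable]: "b \<in> borel_measurable borel"
    unfolding b_def using berezin_measurable[OF s sf, of \<alpha>] by measurable
  let ?d = "\<lambda>k x. s k x - f x"
  have de: "entire (?d k)" for k by (intro entire_diff fock_space_entire[OF sk] fock_space_entire[OF f])
  note [measurable] = entire_measurable[OF de]
  have M0: "M \<ge> 0" using M(2)[of 0] wt_nonneg[of \<alpha> f 0] by linarith
  obtain B where B: "\<And>k. fock_norm \<alpha> 1 (s k) \<le> B" using B by blast
  let ?c = "fock_const TYPE('n) \<alpha> 1"
  have c: "?c > 0" using \<alpha> by (simp add: fock_const_pos)
  define L where "L = 2 * (B / ?c + (LINT z|lborel. wt \<alpha> f z))"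
  have B0: "B \<ge> 0" using fock_norm_nonneg[OF order_refl sk] B[of 0] by (rule order_trans)
  have L0: "L \<ge> 0" unfolding L_def using B0 c by simp
  have L: "(\<integral>\<^sup>+ z. ennreal (wt \<alpha> (?d k) z) \<partial>lborel) \<le> ennreal L" for k
  proof -
    have i: "integrable lborel (wt \<alpha> (?d k))"
      using fock_diff(1)[OF order_refl sk f] by (simp add: fock_space_1)
    have "(LINT z|lborel. wt \<alpha> (?d k) z) \<le> 2 * ((LINT z|lborel. wt \<alpha> (s k) z) + (LINT z|lborel. wt \<alpha> f z))"
      using fock_diff(2)[OF order_refl sk f, of 1 k] by simp
    moreover have "(LINT z|lborel. wt \<alpha> (s k) z) \<le> B / ?c"
      using B[of k] c unfolding fock_norm_1[OF \<alpha>] by (simp add: field_simps)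
    then have "2 * ((LINT z|lborel. wt \<alpha> (s k) z) + (LINT z|lborel. wt \<alpha> f z)) \<le> L"
      unfolding L_def by (intro mult_left_mono add_right_mono) auto
    ultimately have "(LINT z|lborel. wt \<alpha> (?d k) z) \<le> L" by (rule order_trans)
    then show ?thesis by (simp add: nn_integral_eq_integral[OF i] ennreal_leI)
  qed
  show ?thesis
  proof (rule integral_wt_tendsto_0_of_berezin[OF \<alpha> \<alpha> s sf de b(1,2)], rule integrals_tendsto_0[OF _ _ _ _ _ _ _ L0 L])
    show "(\<lambda>k. wt \<alpha> (?d k) x) \<longlonglongrightarrow> 0" for x by (rule wt_tendsto_0[OF lim])
    fix \<epsilon> :: real assume \<epsilon>: "\<epsilon> > 0"
    obtain R where R: "\<And>z. R \<le> norm z \<Longrightarrow> berezin \<alpha> \<mu> z \<le> ennreal \<epsilon>"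
      using v \<epsilon> unfolding berezin_vanishes_def by meson
    let ?g = "\<lambda>z::complex^'n. 2 * M * S * indicator (cball 0 R) z :: real"
    show "\<exists>g\<in>borel_measurable lborel. (\<forall>x. 0 \<le> g x) \<and> (\<integral>\<^sup>+ x. ennreal (g x) \<partial>lborel) < \<infinity> \<and>
        (\<forall>k x. wt \<alpha> (?d k) x * b x \<le> \<epsilon> * wt \<alpha> (?d k) x + g x)"
    proof (intro bexI[of _ ?g] conjI allI)
      show "0 \<le> ?g x" for x using M0 S(1) by simp
      show "?g \<in> borel_measurable lborel"
        by (intro borel_measurable_times borel_measurable_const borel_measurable_indicator) auto
      have "(\<integral>\<^sup>+ x. ennreal (?g x) \<partial>lborel) = (\<integral>\<^sup>+ x. ennreal (2 * M * S) * indicator (cball 0 R) x \<partial>(lborel :: (complex^'n) measure))"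
        by (intro nn_integral_cong) (simp add: indicator_def)
      also have "\<dots> = ennreal (2 * M * S) * emeasure lborel (cball (0::complex^'n) R)"
        by (rule nn_integral_cmult_indicator) simp
      also have "\<dots> < \<infinity>"
        using emeasure_bounded_finite[OF bounded_cball, of "0::complex^'n" R]
        by (simp add: ennreal_mult_less_top)
      finally show "(\<integral>\<^sup>+ x. ennreal (?g x) \<partial>lborel) < \<infinity>" .
      show "wt \<alpha> (?d k) x * b x \<le> \<epsilon> * wt \<alpha> (?d k) x + ?g x" for k x
      proof (cases "norm x \<le> R")
        case True
        have "wt \<alpha> (?d k) x * b x \<le> 2 * M * S"
          using b[of x] M0 by (intro mult_mono wt_diff_le_bound M) auto
        moreover have "0 \<le> \<epsilon> * wt \<alpha> (?d k) x" using \<epsilon> by simp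
        ultimately show ?thesis using True by (simp add: indicator_def)
      next
        case False
        then have "b x \<le> \<epsilon>" using R[of x] \<epsilon> unfolding b_def by (intro enn2real_leI) auto
        then have "wt \<alpha> (?d k) x * b x \<le> \<epsilon> * wt \<alpha> (?d k) x"
          by (subst mult.commute) (rule mult_right_mono, auto)
        then show ?thesis using M0 S(1) False by (simp add: indicator_def)
      qed
    qed
  qed (use b in auto)
qed

lemma toeplitz_compact_of_vanishing:
  fixes \<mu> :: "(complex^'n) measure"
  assumes \<alpha>: "\<alpha> > 0" and p: "1 \<le> p" and adm: "toeplitz_admissible \<alpha> \<mu>" and v: "berezin_vanishes \<alpha> \<mu>"
  shows "toeplitz_compact \<alpha> \<mu> 1 p"
proof (rule toeplitz_compact_of_integrals[OF \<alpha> order_refl p admissible_sets[OF adm] admissible_sigma_finite[OF adm \<alpha>]])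
  fix f :: "complex^'n \<Rightarrow> complex" assume f: "f \<in> fock_space \<alpha> 1"
  have "fock_carleson \<alpha> 1 1 \<mu>"
    unfolding fock_carleson_1_iff[OF \<alpha> order_refl adm] by (rule berezin_vanishes_change(2)[OF \<alpha> adm \<alpha> \<alpha> v])
  then obtain C where "(\<integral>\<^sup>+ z. ennreal (wt \<alpha> f z powr 1) \<partial>\<mu>) \<le> ennreal (C * fock_norm \<alpha> 1 f powr 1)"
    unfolding fock_carleson_wt using f by blast
  then show "(\<integral>\<^sup>+ z. ennreal (wt \<alpha> f z) \<partial>\<mu>) < \<infinity>"
    using le_less_trans by fastforce
next
  fix s :: "nat \<Rightarrow> complex^'n \<Rightarrow> complex" and f M
  assume a: "\<And>k. s k \<in> fock_space \<alpha> 1" "f \<in> fock_space \<alpha> 1" "\<exists>B. \<forall>k. fock_norm \<alpha> 1 (s k) \<le> B"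
    "\<And>z. (\<lambda>k. s k z) \<longlonglongrightarrow> f z" "\<And>k z. wt \<alpha> (s k) z \<le> M" "\<And>z. wt \<alpha> f z \<le> M"
  show "(\<lambda>k. \<integral>\<^sup>+ z. ennreal (wt \<alpha> (\<lambda>x. s k x - f x) z) \<partial>\<mu>) \<longlonglongrightarrow> 0"
    by (rule integral_wt_small_of_vanishing[OF \<alpha> adm v a])
qed

lemma vanishing_carleson_of_vanishing:
  fixes \<mu> :: "(complex^'n) measure"
  assumes \<alpha>: "\<alpha> > 0" and q: "1 \<le> q" and adm: "toeplitz_admissible \<alpha> \<mu>" and v: "berezin_vanishes \<alpha> \<mu>"
  shows "vanishing_fock_carleson \<alpha> 1 q \<mu>"
proof -
  note s[measurable_cong] = admissible_sets[OF adm]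
  have "fock_carleson \<alpha> 1 q \<mu>"
    unfolding fock_carleson_1_iff[OF \<alpha> q adm] by (rule berezin_vanishes_change(2)[OF \<alpha> adm \<alpha> \<alpha> v])
  then obtain C where C: "\<And>f. f \<in> fock_space \<alpha> 1 \<Longrightarrow> (\<integral>\<^sup>+ z. ennreal (wt \<alpha> f z powr q) \<partial>\<mu>) \<le> ennreal (C * fock_norm \<alpha> 1 f powr q)"
    unfolding fock_carleson_wt by blast
  let ?\<sigma> = "weighted_measure \<alpha> q \<mu>"
  have mem: "f \<in> Lq_space q ?\<sigma>" if f: "f \<in> fock_space \<alpha> 1" for f
  proof -
    note fm[measurable] = entire_measurable[OF fock_space_entire[OF f]]
    have "(\<integral>\<^sup>+ z. ennreal (wt \<alpha> f z powr q) \<partial>\<mu>) < \<infinity>"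
      by (rule le_less_trans[OF C[OF f]]) simp
    then have "integrable \<mu> (\<lambda>z. wt \<alpha> f z powr q)"
      by (auto simp: integrable_iff_bounded)
    moreover have "f \<in> borel_measurable ?\<sigma>"
      unfolding weighted_measure_def by measurable
    ultimately show ?thesis
      unfolding Lq_space_def using weighted_integrable_iff(1)[OF fm s] by simp
  qed
  show ?thesis
    unfolding vanishing_fock_carleson_def compact_operator_def
  proof (intro conjI ballI allI impI)
    fix s' :: "nat \<Rightarrow> complex^'n \<Rightarrow> complex"
    assume "(\<forall>k. s' k \<in> fock_space \<alpha> 1) \<and> (\<exists>B. \<forall>k. fock_norm \<alpha> 1 (s' k) \<le> B)"
    then obtain B where sk: "\<And>k. s' k \<in> fock_space \<alpha> 1" and B: "\<And>k. fock_norm \<alpha> 1 (s' k) \<le> B" by blast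
    obtain r f M where r: "strict_mono (r :: nat \<Rightarrow> nat)" and f: "f \<in> fock_space \<alpha> 1"
      and lim: "\<And>z. (\<lambda>k. s' (r k) z) \<longlonglongrightarrow> f z" and M: "\<And>k z. wt \<alpha> (s' k) z \<le> M" "\<And>z. wt \<alpha> f z \<le> M"
      using fock_normal_family[OF \<alpha> order_refl, of s' B, OF sk B] by blast
    let ?d = "\<lambda>k x. s' (r k) x - f x"
    have 0: "(\<lambda>k. \<integral>\<^sup>+ z. ennreal (wt \<alpha> (?d k) z) \<partial>\<mu>) \<longlonglongrightarrow> 0"
      by (rule integral_wt_small_of_vanishing[OF \<alpha> adm v sk f _ lim M]) (use B in blast)
    have de: "entire (?d k)" for k by (intro entire_diff fock_space_entire[OF sk] fock_space_entire[OF f])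
    note dm[measurable] = entire_measurable[OF de]
    let ?m = "ennreal ((2 * M) powr (q - 1))"
    have "(\<lambda>k. ?m * (\<integral>\<^sup>+ z. ennreal (wt \<alpha> (?d k) z) \<partial>\<mu>)) \<longlonglongrightarrow> ?m * 0"
      by (rule ennreal_tendsto_cmult[OF _ 0]) simp
    then have 1: "(\<lambda>k. ?m * (\<integral>\<^sup>+ z. ennreal (wt \<alpha> (?d k) z) \<partial>\<mu>)) \<longlonglongrightarrow> 0" by simp
    have le: "(\<integral>\<^sup>+ z. ennreal (wt \<alpha> (?d k) z powr q) \<partial>\<mu>) \<le> ?m * (\<integral>\<^sup>+ z. ennreal (wt \<alpha> (?d k) z) \<partial>\<mu>)" for k
    proof -
      have "(\<integral>\<^sup>+ z. ennreal (wt \<alpha> (?d k) z powr q) \<partial>\<mu>) \<le> (\<integral>\<^sup>+ z. ?m * ennreal (wt \<alpha> (?d k) z) \<partial>\<mu>)"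
      proof (rule nn_integral_mono)
        fix z
        have "wt \<alpha> (?d k) z powr q \<le> wt \<alpha> (?d k) z * (2 * M) powr (q - 1)"
          by (rule powr_le_mult_powr[OF wt_nonneg wt_diff_le_bound[OF M] q])
        then show "ennreal (wt \<alpha> (?d k) z powr q) \<le> ?m * ennreal (wt \<alpha> (?d k) z)"
          by (simp add: ennreal_mult[symmetric] mult.commute)
      qed
      then show ?thesis by (subst (asm) nn_integral_cmult) auto
    qed
    have "(\<lambda>k. \<integral>\<^sup>+ z. ennreal (wt \<alpha> (?d k) z powr q) \<partial>\<mu>) \<longlonglongrightarrow> 0"
      by (rule tendsto_sandwich[OF _ _ tendsto_const 1]) (use le in auto)
    then have "(\<lambda>k. enn2real (\<integral>\<^sup>+ z. ennreal (wt \<alpha> (?d k) z powr q) \<partial>\<mu>)) \<longlonglongrightarrow> 0"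
      by (intro tendsto_enn2real) auto
    then have "(\<lambda>k. enn2real (\<integral>\<^sup>+ z. ennreal (wt \<alpha> (?d k) z powr q) \<partial>\<mu>) powr (1 / q)) \<longlonglongrightarrow> 0 powr (1 / q)"
      by (rule tendsto_powr') (use q in auto)
    then have "(\<lambda>k. Lq_norm q ?\<sigma> (?d k)) \<longlonglongrightarrow> 0"
      unfolding Lq_norm_weighted[OF dm s] by simp
    then show "\<exists>r g. strict_mono r \<and> g \<in> Lq_space q ?\<sigma> \<and> (\<lambda>k. Lq_norm q ?\<sigma> (\<lambda>x. s' (r k) x - g x)) \<longlonglongrightarrow> 0"
      using r mem[OF f] by blast
  qed (rule mem)
qed

lemma nkern_tendsto_0:
  fixes w :: "nat \<Rightarrow> complex^'n"
  assumes \<alpha>: "\<alpha> > 0" and w: "\<And>k. real k \<le> norm (w k)"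
  shows "(\<lambda>k. gauss \<alpha> z (w k)) \<longlonglongrightarrow> 0"
proof -
  have 1: "filterlim (\<lambda>k. real k - norm z) at_top sequentially" by real_asymp
  have "filterlim (\<lambda>k. norm (z - w k)) at_top sequentially"
  proof (rule filterlim_at_top_mono[OF 1], rule always_eventually, rule allI)
    fix k
    have "norm (w k) \<le> norm z + norm (z - w k)" by norm
    then show "real k - norm z \<le> norm (z - w k)" using w[of k] by linarith
  qed
  moreover have "((\<lambda>t. exp (- \<alpha> * t\<^sup>2)) \<longlongrightarrow> 0) at_top"
    using \<alpha> by real_asymp
  ultimately show ?thesis by (rule filterlim_compose[rotated])
qed

lemma filterlim_subseq_norm:
  assumes "strict_mono (r :: nat \<Rightarrow> nat)" "\<And>k. real k \<le> norm (w k)"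
  shows "real k \<le> norm (w (r k))"
  using assms(2)[of "r k"] seq_suble[OF assms(1), of k] by linarith

text \<open>
Apply the operator to kernels whose centres go to infinity. A limit \<open>g\<close> of a subsequence of the images vanishes, because the images
tend to zero pointwise; this covers \<open>p = \<infinity>\<close> as well, where \<open>g\<close> need not decay. Hence the images tend to zero
in norm, and so do their values at the centres, which are Berezin transforms. The pointwise decay needs
a bounded Berezin transform, which follows from the same compactness.
\<close>
lemma vanishing_of_toeplitz_compact:
  fixes \<mu> :: "(complex^'n) measure"
  assumes \<alpha>: "\<alpha> > 0" and p: "1 \<le> p" and adm: "toeplitz_admissible \<alpha> \<mu>" and K: "toeplitz_compact \<alpha> \<mu> 1 p"
  shows "berezin_vanishes \<alpha> \<mu>"
proof -
  note s = admissible_sets[OF adm]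
  let ?T = "\<lambda>w. toeplitz \<alpha> \<mu> (nkern \<alpha> w)"
  obtain C where C: "C > 0" "\<forall>f\<in>(fock_space \<alpha> p :: (complex^'n \<Rightarrow> complex) set). \<forall>z. wt \<alpha> f z \<le> C * fock_norm \<alpha> p f"
    using fock_sup_bound[OF \<alpha> p, where 'n='n] by blast
  have TY: "?T a \<in> fock_space \<alpha> p" for a
    using K nkern_fock_1(1)[OF \<alpha>] unfolding toeplitz_compact_def compact_operator_def by blast
  have TI: "integrable \<mu> (toeplitz_integrand \<alpha> (nkern \<alpha> a) z)" for a z
    using K nkern_fock_1(1)[OF \<alpha>] unfolding toeplitz_compact_def toeplitz_converges_def by blast
  have bf: "berezin \<alpha> \<mu> a = ennreal (wt \<alpha> (?T a) a)" for a
    using admissible_berezin_finite[OF adm, of a] unfolding wt_toeplitz_nkern_diag[OF s] by (simp add: less_top)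
  have sub: "\<exists>r g. strict_mono (r :: nat \<Rightarrow> nat) \<and> g \<in> fock_space \<alpha> p \<and> (\<lambda>k. fock_norm \<alpha> p (\<lambda>x. ?T (w (r k)) x - g x)) \<longlonglongrightarrow> 0"
    for w :: "nat \<Rightarrow> complex^'n"
    by (rule compact_operatorD[where s = "\<lambda>k. nkern \<alpha> (w k)" and B = "kern_norm TYPE('n) \<alpha>"])
      (use K in \<open>auto simp: toeplitz_compact_def nkern_fock_1(1)[OF \<alpha>] fock_norm_nkern[OF \<alpha>]\<close>)
  have close: "wt \<alpha> (?T a) z \<le> C * fock_norm \<alpha> p (\<lambda>x. ?T a x - g x) + wt \<alpha> g z" if "g \<in> fock_space \<alpha> p" for a g z
  proof -
    have "wt \<alpha> (\<lambda>x. ?T a x - g x) z \<le> C * fock_norm \<alpha> p (\<lambda>x. ?T a x - g x)"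
      using C(2) fock_diff(1)[OF p TY that] by blast
    moreover have "wt \<alpha> (?T a) z \<le> wt \<alpha> (\<lambda>x. ?T a x - g x) z + wt \<alpha> g z"
      unfolding wt_def distrib_right[symmetric] using norm_triangle_sub[of "?T a z" "g z"]
      by (intro mult_right_mono) (auto simp: add.commute)
    ultimately show ?thesis by linarith
  qed
  \<comment> \<open>centres where the Berezin transform exceeds \<open>k\<close> would give images without a convergent subsequence\<close>
  obtain S where S: "S \<ge> 0" "\<And>z. berezin \<alpha> \<mu> z \<le> ennreal S"
  proof (rule ccontr)
    assume "\<not> thesis"
    then have "\<not> (\<forall>z. berezin \<alpha> \<mu> z \<le> ennreal (real k))" for k :: nat
      using that[of "real k"] of_nat_0_le_iff by blast
    then have "\<forall>k::nat. \<exists>z. real k < wt \<alpha> (?T z) z"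
      unfolding bf by (metis ennreal_leI linorder_not_le)
    then obtain w where w: "\<And>k::nat. real k < wt \<alpha> (?T (w k)) (w k)" by metis
    obtain r g where r: "strict_mono (r :: nat \<Rightarrow> nat)" and g: "g \<in> fock_space \<alpha> p"
      and lim: "(\<lambda>k. fock_norm \<alpha> p (\<lambda>x. ?T (w (r k)) x - g x)) \<longlonglongrightarrow> 0" using sub[of w] by blast
    have "\<forall>\<^sub>F k in sequentially. fock_norm \<alpha> p (\<lambda>x. ?T (w (r k)) x - g x) < 1"
      using lim by (rule order_tendstoD) simp
    then obtain N where N: "\<And>k. k \<ge> N \<Longrightarrow> fock_norm \<alpha> p (\<lambda>x. ?T (w (r k)) x - g x) < 1"
      unfolding eventually_sequentially by blast
    obtain k :: nat where k: "k \<ge> N" "real k \<ge> C + C * fock_norm \<alpha> p g"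
    proof -
      obtain k0 :: nat where "real k0 \<ge> C + C * fock_norm \<alpha> p g" using real_arch_simple by blast
      then show ?thesis using that[of "max N k0"] by (simp add: le_max_iff_disj)
    qed
    have "real k \<le> real (r k)" using seq_suble[OF r, of k] by simp
    also have "\<dots> < wt \<alpha> (?T (w (r k))) (w (r k))" by (rule w)
    also have "\<dots> \<le> C * fock_norm \<alpha> p (\<lambda>x. ?T (w (r k)) x - g x) + wt \<alpha> g (w (r k))"
      by (rule close[OF g])
    also have "\<dots> \<le> C * 1 + C * fock_norm \<alpha> p g"
      using C g N[OF k(1)] by (intro add_mono mult_left_mono) auto
    finally show False using k(2) by simp
  qed
  show ?thesis
  proof (rule ccontr)
    assume nv: "\<not> berezin_vanishes \<alpha> \<mu>"
    obtain \<epsilon> w where \<epsilon>: "\<epsilon> > 0" and w: "\<And>k::nat. real k \<le> norm (w k :: complex^'n)" "\<And>k. ennreal \<epsilon> < berezin \<alpha> \<mu> (w k)"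
      using not_berezin_vanishes[OF nv] by blast
    obtain r g where r: "strict_mono (r :: nat \<Rightarrow> nat)" and g: "g \<in> fock_space \<alpha> p"
      and lim: "(\<lambda>k. fock_norm \<alpha> p (\<lambda>x. ?T (w (r k)) x - g x)) \<longlonglongrightarrow> 0" using sub[of w] by blast
    have "wt \<alpha> g z = 0" for z
    proof -
      have T0: "(\<lambda>k. wt \<alpha> (?T (w (r k))) z) \<longlonglongrightarrow> 0"
      proof (rule tendsto_sandwich[OF _ _ tendsto_const])
        have "(\<lambda>k. gauss (\<alpha> / 4) z (w (r k)) * S) \<longlonglongrightarrow> 0 * S"
          by (intro tendsto_mult tendsto_const nkern_tendsto_0) (use \<alpha> filterlim_subseq_norm[OF r w(1)] in auto)
        then show "(\<lambda>k. gauss (\<alpha> / 4) z (w (r k)) * S) \<longlonglongrightarrow> 0" by simp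
        have "wt \<alpha> (?T a) z \<le> gauss (\<alpha> / 4) z a * S" for a
        proof -
          have "ennreal (wt \<alpha> (?T a) z) \<le> ennreal (gauss (\<alpha> / 4) z a) * ennreal S"
            by (rule order_trans[OF wt_toeplitz_nkern_le[OF \<alpha> s TI] mult_left_mono[OF S(2)]]) simp
          also have "\<dots> = ennreal (gauss (\<alpha> / 4) z a * S)"
            using S(1) by (simp add: ennreal_mult)
          finally show ?thesis using S(1) by simp
        qed
        then show "\<forall>\<^sub>F k in sequentially. wt \<alpha> (?T (w (r k))) z \<le> gauss (\<alpha> / 4) z (w (r k)) * S"
          by (intro always_eventually allI)
      qed simp
      have "(\<lambda>k. C * fock_norm \<alpha> p (\<lambda>x. ?T (w (r k)) x - g x) + wt \<alpha> (?T (w (r k))) z) \<longlonglongrightarrow> C * 0 + 0"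
        by (intro tendsto_intros lim T0)
      moreover have "wt \<alpha> g z \<le> C * fock_norm \<alpha> p (\<lambda>x. ?T (w (r k)) x - g x) + wt \<alpha> (?T (w (r k))) z" for k
      proof -
        have "wt \<alpha> (\<lambda>x. ?T (w (r k)) x - g x) z \<le> C * fock_norm \<alpha> p (\<lambda>x. ?T (w (r k)) x - g x)"
          using C(2) fock_diff(1)[OF p TY g] by blast
        moreover have "wt \<alpha> g z \<le> wt \<alpha> (\<lambda>x. ?T (w (r k)) x - g x) z + wt \<alpha> (?T (w (r k))) z"
          unfolding wt_def distrib_right[symmetric] using norm_triangle_sub[of "g z" "?T (w (r k)) z"]
          by (intro mult_right_mono) (auto simp: add.commute norm_minus_commute)
        ultimately show ?thesis by linarith
      qed
      ultimately have "wt \<alpha> g z \<le> C * 0 + 0"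
        by (intro LIMSEQ_le_const[of _ _ "wt \<alpha> g z"]) auto
      then show ?thesis using wt_nonneg[of \<alpha> g z] by simp
    qed
    then have le: "wt \<alpha> (?T (w (r k))) (w (r k)) \<le> C * fock_norm \<alpha> p (\<lambda>x. ?T (w (r k)) x - g x)" for k
      using close[OF g, of "w (r k)" "w (r k)"] by simp
    have "(\<lambda>k. C * fock_norm \<alpha> p (\<lambda>x. ?T (w (r k)) x - g x)) \<longlonglongrightarrow> C * 0"
      by (intro tendsto_intros lim)
    then have "\<forall>\<^sub>F k in sequentially. C * fock_norm \<alpha> p (\<lambda>x. ?T (w (r k)) x - g x) < \<epsilon>"
      using \<epsilon> by (intro order_tendstoD) auto
    then obtain k where "C * fock_norm \<alpha> p (\<lambda>x. ?T (w (r k)) x - g x) < \<epsilon>"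
      by (meson eventually_sequentially order_refl)
    with le[of k] have "berezin \<alpha> \<mu> (w (r k)) \<le> ennreal \<epsilon>" unfolding bf by (intro ennreal_leI) linarith
    with w(2)[of "r k"] show False by simp
  qed
qed

text \<open>
As for the operator, but a limit in \<open>L\<^sup>q\<close> is only known almost everywhere to be zero; this is Fatou's lemma.
\<close>
lemma vanishing_of_vanishing_carleson:
  fixes \<mu> :: "(complex^'n) measure"
  assumes \<alpha>: "\<alpha> > 0" and q: "1 \<le> q" and adm: "toeplitz_admissible \<alpha> \<mu>" and K: "vanishing_fock_carleson \<alpha> 1 q \<mu>"
  shows "berezin_vanishes \<alpha> \<mu>"
proof -
  note s[measurable_cong] = admissible_sets[OF adm]
  let ?\<sigma> = "weighted_measure \<alpha> q \<mu>"
  have "berezin_vanishes (\<alpha> * q / 2) \<mu>"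
  proof (rule ccontr)
    assume nv: "\<not> berezin_vanishes (\<alpha> * q / 2) \<mu>"
    obtain \<epsilon> w where \<epsilon>: "\<epsilon> > 0" and w: "\<And>k::nat. real k \<le> norm (w k :: complex^'n)" "\<And>k. ennreal \<epsilon> < berezin (\<alpha> * q / 2) \<mu> (w k)"
      using not_berezin_vanishes[OF nv] by blast
    have "\<exists>r g. strict_mono (r :: nat \<Rightarrow> nat) \<and> g \<in> Lq_space q ?\<sigma> \<and>
        (\<lambda>k. Lq_norm q ?\<sigma> (\<lambda>x. nkern \<alpha> (w (r k)) x - g x)) \<longlonglongrightarrow> 0"
      by (rule compact_operatorD[where s = "\<lambda>k. nkern \<alpha> (w k)" and B = "kern_norm TYPE('n) \<alpha>",
            OF K[unfolded vanishing_fock_carleson_def]])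
        (auto simp: nkern_fock_1(1)[OF \<alpha>] fock_norm_nkern[OF \<alpha>])
    then obtain r g where r: "strict_mono (r :: nat \<Rightarrow> nat)" and g: "g \<in> Lq_space q ?\<sigma>"
      and lim: "(\<lambda>k. Lq_norm q ?\<sigma> (\<lambda>x. nkern \<alpha> (w (r k)) x - g x)) \<longlonglongrightarrow> 0"
      by blast
    let ?s = "\<lambda>k. nkern \<alpha> (w (r k))"
    have X: "?s k \<in> Lq_space q ?\<sigma>" for k
      using K nkern_fock_1(1)[OF \<alpha>] unfolding vanishing_fock_carleson_def compact_operator_def by blast
    have gm[measurable]: "g \<in> borel_measurable ?\<sigma>" and gi: "integrable ?\<sigma> (\<lambda>x. norm (g x) powr q)"
      and sm[measurable]: "\<And>k. ?s k \<in> borel_measurable ?\<sigma>" and si: "\<And>k. integrable ?\<sigma> (\<lambda>x. norm (?s k x) powr q)"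
      using g X by (auto simp: Lq_space_def)
    have di: "integrable ?\<sigma> (\<lambda>x. norm (?s k x - g x) powr q)" for k
    proof (rule Bochner_Integration.integrable_bound)
      show "integrable ?\<sigma> (\<lambda>x. 2 powr q * (norm (?s k x) powr q + norm (g x) powr q))" using si gi by auto
      have "norm (?s k x - g x) powr q \<le> 2 powr q * (norm (?s k x) powr q + norm (g x) powr q)" for x
        by (rule order_trans[OF powr_mono2[OF _ _ norm_triangle_ineq4] powr_add_le]) (use q in auto)
      then show "AE x in ?\<sigma>. norm (norm (?s k x - g x) powr q) \<le> norm (2 powr q * (norm (?s k x) powr q + norm (g x) powr q))"
        by (intro AE_I2) auto
    qed measurable
    have "(\<lambda>k. Lq_norm q ?\<sigma> (\<lambda>x. ?s k x - g x) powr q) \<longlonglongrightarrow> 0 powr q"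
      by (rule tendsto_powr'[OF lim tendsto_const]) (use q in \<open>auto simp: Lq_norm_def\<close>)
    then have "(\<lambda>k. LINT x|?\<sigma>. norm (?s k x - g x) powr q) \<longlonglongrightarrow> 0"
      using q unfolding Lq_norm_def by (simp add: powr_powr)
    then have "(\<lambda>k. ennreal (LINT x|?\<sigma>. norm (?s k x - g x) powr q)) \<longlonglongrightarrow> ennreal 0"
      by (rule tendsto_ennrealI)
    then have lim': "(\<lambda>k. \<integral>\<^sup>+ x. ennreal (norm (?s k x - g x) powr q) \<partial>?\<sigma>) \<longlonglongrightarrow> 0"
      using nn_integral_eq_integral[OF di] by simp
    have s0: "(\<lambda>k. ?s k x) \<longlonglongrightarrow> 0" for x
    proof -
      have "(\<lambda>k. gauss (\<alpha> / 2) x (w (r k))) \<longlonglongrightarrow> 0"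
        by (rule nkern_tendsto_0) (use \<alpha> filterlim_subseq_norm[OF r w(1)] in auto)
      then have "(\<lambda>k. norm (?s k x) * exp (- (\<alpha> / 2) * (norm x)\<^sup>2) * exp (\<alpha> / 2 * (norm x)\<^sup>2)) \<longlonglongrightarrow> 0 * exp (\<alpha> / 2 * (norm x)\<^sup>2)"
        unfolding wt_nkern[symmetric] wt_def by (intro tendsto_intros)
      then have "(\<lambda>k. norm (?s k x)) \<longlonglongrightarrow> 0"
        by (simp add: mult.assoc mult_exp_exp)
      then show ?thesis by (rule tendsto_norm_zero_cancel)
    qed
    have wl: "(\<lambda>k. ennreal (norm (?s k x - g x) powr q)) \<longlonglongrightarrow> ennreal (norm (0 - g x) powr q)" for x
      by (intro tendsto_ennrealI tendsto_powr' tendsto_norm tendsto_diff s0 tendsto_const) (use q in auto)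
    have "(\<integral>\<^sup>+ x. ennreal (norm (g x) powr q) \<partial>?\<sigma>) = (\<integral>\<^sup>+ x. liminf (\<lambda>k. ennreal (norm (?s k x - g x) powr q)) \<partial>?\<sigma>)"
      using lim_imp_Liminf[OF sequentially_bot wl] by simp
    also have "\<dots> \<le> liminf (\<lambda>k. \<integral>\<^sup>+ x. ennreal (norm (?s k x - g x) powr q) \<partial>?\<sigma>)"
      by (rule nn_integral_liminf) measurable
    also have "\<dots> = 0" by (rule lim_imp_Liminf[OF sequentially_bot lim'])
    finally have "AE x in ?\<sigma>. ennreal (norm (g x) powr q) = 0"
      by (subst (asm) le_zero_eq, subst (asm) nn_integral_0_iff_AE) auto
    then have g0: "AE x in ?\<sigma>. g x = 0" by eventually_elim (auto simp: ennreal_eq_0_iff)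
    have "(\<integral>\<^sup>+ x. ennreal (norm (?s k x - g x) powr q) \<partial>?\<sigma>) = berezin (\<alpha> * q / 2) \<mu> (w (r k))" for k
    proof -
      note em = entire_measurable[OF entire_nkern]
      have "(\<integral>\<^sup>+ x. ennreal (norm (?s k x - g x) powr q) \<partial>?\<sigma>) = (\<integral>\<^sup>+ x. ennreal (norm (?s k x) powr q) \<partial>?\<sigma>)"
        by (intro nn_integral_cong_AE) (use g0 in eventually_elim, simp)
      also have "\<dots> = ennreal (LINT x|?\<sigma>. norm (?s k x) powr q)"
        by (rule nn_integral_eq_integral[OF si]) simp
      also have "\<dots> = ennreal (LINT x|\<mu>. wt \<alpha> (?s k) x powr q)"
        unfolding weighted_integrable_iff(2)[OF em s] ..
      also have "\<dots> = (\<integral>\<^sup>+ x. ennreal (wt \<alpha> (?s k) x powr q) \<partial>\<mu>)"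
        by (rule nn_integral_eq_integral[symmetric]) (use si weighted_integrable_iff(1)[OF em s] in auto)
      also have "\<dots> = berezin (\<alpha> * q / 2) \<mu> (w (r k))"
        by (rule nn_integral_wt_nkern_powr)
      finally show ?thesis .
    qed
    then have "(\<lambda>k. berezin (\<alpha> * q / 2) \<mu> (w (r k))) \<longlonglongrightarrow> 0" using lim' by simp
    then have "\<forall>\<^sub>F k in sequentially. berezin (\<alpha> * q / 2) \<mu> (w (r k)) < ennreal \<epsilon>"
      using \<epsilon> by (intro order_tendstoD) auto
    then obtain k where "berezin (\<alpha> * q / 2) \<mu> (w (r k)) < ennreal \<epsilon>"
      by (meson eventually_sequentially order_refl)
    with w(2)[of "r k"] show False by simp
  qed
  note v = this
  have "\<alpha> * q / 2 > 0" using \<alpha> q by simp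
  then show ?thesis by (rule berezin_vanishes_change(1)[OF \<alpha> adm _ \<alpha> v])
qed

lemma toeplitz_compact_1_iff:
  fixes \<mu> :: "(complex^'n) measure"
  assumes "\<alpha> > 0" "1 \<le> p" "toeplitz_admissible \<alpha> \<mu>"
  shows "toeplitz_compact \<alpha> \<mu> 1 p \<longleftrightarrow> berezin_vanishes \<alpha> \<mu>"
  using vanishing_of_toeplitz_compact[OF assms] toeplitz_compact_of_vanishing[OF assms] by blast

lemma vanishing_fock_carleson_1_iff:
  fixes \<mu> :: "(complex^'n) measure"
  assumes "\<alpha> > 0" "1 \<le> q" "toeplitz_admissible \<alpha> \<mu>"
  shows "vanishing_fock_carleson \<alpha> 1 q \<mu> \<longleftrightarrow> berezin_vanishes \<alpha> \<mu>"
  using vanishing_of_vanishing_carleson[OF assms] vanishing_carleson_of_vanishing[OF assms] by blast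

section \<open>The Gaussian integers as a sampling lattice\<close>

text \<open>
The lower left corner of the unit cell that contains \<open>z\<close>. Its range is the lattice of Gaussian integers.
\<close>
definition corner :: "complex ^ 'n \<Rightarrow> complex ^ 'n" where
  "corner z = (\<chi> i. Complex (of_int \<lfloor>Re (z $ i)\<rfloor>) (of_int \<lfloor>Im (z $ i)\<rfloor>))"

lemma countable_range_corner: "countable (range (corner :: complex ^ 'n \<Rightarrow> complex ^ 'n))"
proof -
  define \<phi> :: "('n \<Rightarrow> int \<times> int) \<Rightarrow> complex ^ 'n" where
    "\<phi> m = (\<chi> i. Complex (of_int (fst (m i))) (of_int (snd (m i))))" for m
  have "corner z = \<phi> (\<lambda>i. (\<lfloor>Re (z $ i)\<rfloor>, \<lfloor>Im (z $ i)\<rfloor>))" for z :: "complex ^ 'n"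
    by (simp add: corner_def \<phi>_def)
  then have "range (corner :: complex ^ 'n \<Rightarrow> complex ^ 'n) \<subseteq> range \<phi>" by auto
  then show ?thesis by (rule countable_subset) simp
qed

lemma corner_measurable [measurable]: "corner \<in> borel_measurable (borel :: (complex ^ 'n) measure)"
proof (subst borel_measurable_euclidean_space, rule ballI)
  fix b :: "complex ^ 'n" assume "b \<in> Basis"
  then obtain i c where b: "b = axis i c" "c \<in> Basis" by (auto simp: Basis_vec_def)
  have [measurable]: "(\<lambda>z::complex^'n. z $ i) \<in> borel_measurable borel"
    by (intro borel_measurable_continuous_onI continuous_intros)
  have "(\<lambda>z::complex^'n. real_of_int \<lfloor>Re (z $ i)\<rfloor>) \<in> borel_measurable borel"
    "(\<lambda>z::complex^'n. real_of_int \<lfloor>Im (z $ i)\<rfloor>) \<in> borel_measurable borel"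
    by measurable
  then show "(\<lambda>z. corner z \<bullet> b) \<in> borel_measurable borel"
    using b by (auto simp: corner_def inner_axis Basis_complex_def inner_complex_def)
qed

lemma norm_diff_corner_le: "norm (z - corner z) \<le> 2 * real CARD('n)" for z :: "complex ^ 'n"
proof -
  have "norm (z - corner z) \<le> (\<Sum>i\<in>UNIV. norm ((z - corner z) $ i))"
    unfolding norm_vec_def by (rule L2_set_le_sum) simp
  also have "\<dots> \<le> (\<Sum>i\<in>(UNIV :: 'n set). 2)"
  proof (rule sum_mono)
    fix i
    have "norm ((z - corner z) $ i) \<le> \<bar>Re ((z - corner z) $ i)\<bar> + \<bar>Im ((z - corner z) $ i)\<bar>"
      by (rule cmod_le)
    also have "\<dots> \<le> 1 + 1"
      by (intro add_mono) (simp_all add: corner_def, linarith+)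
    finally show "norm ((z - corner z) $ i) \<le> 2" by simp
  qed
  finally show ?thesis by simp
qed

definition cell :: "complex ^ 'n \<Rightarrow> (complex ^ 'n) set" where
  "cell a = {z. corner z = a}"

lemma cell_measurable [measurable]: "cell (a :: complex ^ 'n) \<in> sets borel"
proof -
  have "corner -` {a} \<inter> space borel \<in> sets borel"
    by (rule measurable_sets[OF corner_measurable]) simp
  moreover have "cell a = corner -` {a} \<inter> space borel" by (auto simp: cell_def)
  ultimately show ?thesis by simp
qed

lemma corner_shift: "corner (z + corner w) = corner z + corner w"
  by (simp add: corner_def vec_eq_iff complex_eq_iff)

lemma emeasure_cell_eq:
  fixes a :: "complex ^ 'n"
  assumes "a \<in> range corner"
  shows "emeasure lborel (cell a) = emeasure lborel (cell (0 :: complex ^ 'n))"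
proof -
  obtain w where w: "a = corner w" using assms by blast
  have "emeasure lborel (cell a) = (\<integral>\<^sup>+ z. indicator (cell a) z \<partial>lborel)" by simp
  also have "\<dots> = (\<integral>\<^sup>+ z. indicator (cell a) (z + a) \<partial>lborel)"
    by (rule nn_integral_lborel_shift[symmetric]) measurable
  also have "(\<lambda>z. indicator (cell a) (z + a) :: ennreal) = indicator (cell 0)"
    by (auto simp: fun_eq_iff indicator_def cell_def w corner_shift)
  finally show ?thesis by simp
qed

definition cell_vol :: "'n::finite itself \<Rightarrow> real" where
  "cell_vol _ = measure lborel (cell (0 :: complex ^ 'n))"

text \<open>
The cells are translates of each other and countably many of them cover the space, so a cell cannot be a null set.
\<close>
lemma cell_vol:
  shows "cell_vol TYPE('n::finite) > 0"
    and "a \<in> range corner \<Longrightarrow> emeasure lborel (cell (a :: complex ^ 'n)) = ennreal (cell_vol TYPE('n))"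
proof -
  have "cell (0 :: complex ^ 'n) \<subseteq> cball 0 (2 * real CARD('n))"
  proof
    fix z :: "complex ^ 'n" assume "z \<in> cell 0"
    then show "z \<in> cball 0 (2 * real CARD('n))" using norm_diff_corner_le[of z] by (simp add: cell_def)
  qed
  then have "bounded (cell (0 :: complex ^ 'n))" using bounded_cball bounded_subset by blast
  then have fin: "emeasure lborel (cell (0 :: complex ^ 'n)) < \<infinity>" by (rule emeasure_bounded_finite)
  then have e: "emeasure lborel (cell (0 :: complex ^ 'n)) = ennreal (cell_vol TYPE('n))"
    unfolding cell_vol_def by (intro emeasure_eq_ennreal_measure) simp
  show "a \<in> range corner \<Longrightarrow> emeasure lborel (cell (a :: complex ^ 'n)) = ennreal (cell_vol TYPE('n))"
    unfolding e[symmetric] by (rule emeasure_cell_eq)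
  have "cell_vol TYPE('n) \<noteq> 0"
  proof
    assume "cell_vol TYPE('n) = 0"
    then have 0: "emeasure lborel (cell (0 :: complex ^ 'n)) = 0" using e by simp
    have "(\<Union>a\<in>range corner. cell (a :: complex ^ 'n)) \<in> null_sets lborel"
      by (rule null_sets_UN'[OF countable_range_corner]) (simp add: null_sets_def emeasure_cell_eq 0)
    moreover have "(\<Union>a\<in>range corner. cell (a :: complex ^ 'n)) = UNIV" by (auto simp: cell_def)
    ultimately show False by (simp add: null_sets_def)
  qed
  moreover have "cell_vol TYPE('n) \<ge> 0" by (simp add: cell_vol_def)
  ultimately show "cell_vol TYPE('n) > 0" by simp
qed

text \<open>
Turns sums over lattice points into integrals of functions that are constant on the cells.
\<close>
lemma sum_indicator_cells:
  assumes "finite J"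
  shows "(\<Sum>a\<in>J. g a * indicator (cell a) z) = (if corner z \<in> J then g (corner z) else (0::ennreal))"
proof -
  have "(\<Sum>a\<in>J. g a * indicator (cell a) z) = (\<Sum>a\<in>J. if a = corner z then g a else 0)"
    by (intro sum.cong refl) (auto simp: cell_def indicator_def)
  then show ?thesis using assms by simp
qed

text \<open>
On the cell of \<open>a\<close> the Gaussian centred at \<open>a\<close> is dominated by a wider one that is integrable over the whole space, and
the cells are disjoint.
\<close>
lemma lattice_gauss_sum:
  assumes \<gamma>: "\<gamma> > 0"
  shows "\<exists>C>0. \<forall>J. finite J \<longrightarrow> J \<subseteq> range corner \<longrightarrow> (\<forall>w :: complex ^ 'n. (\<Sum>a\<in>J. gauss \<gamma> w a) \<le> C)"
proof -
  let ?D = "2 * real CARD('n)" and ?v = "cell_vol TYPE('n)"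
  let ?g = "gauss_mass TYPE(complex ^ 'n) (\<gamma> / 2)"
  have v: "?v > 0" by (rule cell_vol)
  have g: "?g > 0" using \<gamma> by (simp add: gauss_mass_pos)
  let ?C = "exp (\<gamma> * ?D\<^sup>2) * ?g / ?v"
  have "(\<Sum>a\<in>J. gauss \<gamma> w a) \<le> ?C" if J: "finite J" "J \<subseteq> range corner" for J and w :: "complex ^ 'n"
  proof -
    have one: "ennreal (gauss \<gamma> w a) * ennreal ?v
        \<le> ennreal (exp (\<gamma> * ?D\<^sup>2)) * (\<integral>\<^sup>+ z. ennreal (gauss (\<gamma> / 2) z w) * indicator (cell a) z \<partial>lborel)"
      if a: "a \<in> J" for a
    proof -
      have "ennreal (gauss \<gamma> w a) * ennreal ?v = (\<integral>\<^sup>+ z. ennreal (gauss \<gamma> w a) * indicator (cell a) z \<partial>lborel)"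
        using cell_vol(2)[of a] J(2) a by (subst nn_integral_cmult_indicator) auto
      also have "\<dots> \<le> (\<integral>\<^sup>+ z. ennreal (exp (\<gamma> * ?D\<^sup>2)) * (ennreal (gauss (\<gamma> / 2) z w) * indicator (cell a) z) \<partial>lborel)"
      proof (rule nn_integral_mono)
        fix z
        show "ennreal (gauss \<gamma> w a) * indicator (cell a) z \<le>
          ennreal (exp (\<gamma> * ?D\<^sup>2)) * (ennreal (gauss (\<gamma> / 2) z w) * indicator (cell a) z)"
        proof (cases "z \<in> cell a")
          case True
          then have "norm (z - a) \<le> ?D" using norm_diff_corner_le[of z] by (simp add: cell_def)
          moreover have "norm (z - w) \<le> norm (w - a) + norm (z - a)" by norm
          ultimately have "norm (z - w) \<le> norm (w - a) + ?D" by linarith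
          then have "(norm (z - w))\<^sup>2 \<le> (norm (w - a) + ?D)\<^sup>2" by (intro power_mono) auto
          also have "\<dots> \<le> 2 * (norm (w - a))\<^sup>2 + 2 * ?D\<^sup>2"
            using sum_squares_bound[of "norm (w - a)" ?D] unfolding power2_sum by linarith
          finally have "\<gamma> / 2 * (norm (z - w))\<^sup>2 \<le> \<gamma> / 2 * (2 * (norm (w - a))\<^sup>2 + 2 * ?D\<^sup>2)"
            using \<gamma> by (intro mult_left_mono) auto
          also have "\<dots> = \<gamma> * (norm (w - a))\<^sup>2 + \<gamma> * ?D\<^sup>2" by (simp add: algebra_simps)
          finally have "gauss \<gamma> w a \<le> exp (\<gamma> * ?D\<^sup>2) * gauss (\<gamma> / 2) z w"
            unfolding mult_exp_exp exp_le_cancel_iff by linarith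
          then show ?thesis
            using True unfolding mult.assoc[symmetric] ennreal_mult[OF exp_ge_zero exp_ge_zero, symmetric]
            by (intro mult_right_mono ennreal_leI) auto
        qed simp
      qed
      also have "\<dots> = ennreal (exp (\<gamma> * ?D\<^sup>2)) * (\<integral>\<^sup>+ z. ennreal (gauss (\<gamma> / 2) z w) * indicator (cell a) z \<partial>lborel)"
        by (rule nn_integral_cmult) measurable
      finally show ?thesis .
    qed
    have "ennreal ((\<Sum>a\<in>J. gauss \<gamma> w a) * ?v) = (\<Sum>a\<in>J. ennreal (gauss \<gamma> w a) * ennreal ?v)"
      using v by (simp add: ennreal_mult sum_nonneg sum_distrib_right sum_ennreal[symmetric])
    also have "\<dots> \<le> (\<Sum>a\<in>J. ennreal (exp (\<gamma> * ?D\<^sup>2)) * (\<integral>\<^sup>+ z. ennreal (gauss (\<gamma> / 2) z w) * indicator (cell a) z \<partial>lborel))"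
      by (intro sum_mono one)
    also have "\<dots> = ennreal (exp (\<gamma> * ?D\<^sup>2)) * (\<integral>\<^sup>+ z. (\<Sum>a\<in>J. ennreal (gauss (\<gamma> / 2) z w) * indicator (cell a) z) \<partial>lborel)"
      by (subst nn_integral_sum) (auto simp: sum_distrib_left)
    also have "\<dots> \<le> ennreal (exp (\<gamma> * ?D\<^sup>2)) * (\<integral>\<^sup>+ z. ennreal (gauss (\<gamma> / 2) z w) \<partial>lborel)"
    proof (intro mult_left_mono nn_integral_mono)
      show "(\<Sum>a\<in>J. ennreal (gauss (\<gamma> / 2) z w) * indicator (cell a) z)
          \<le> ennreal (gauss (\<gamma> / 2) z w)" for z
        by (subst sum_indicator_cells[OF J(1)]) simp
    qed simp
    also have "\<dots> = ennreal (exp (\<gamma> * ?D\<^sup>2)) * ennreal ?g"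
      using \<gamma> by (subst gauss_nn_integral) auto
    also have "\<dots> = ennreal (exp (\<gamma> * ?D\<^sup>2) * ?g)"
      using g by (simp add: ennreal_mult)
    finally have "(\<Sum>a\<in>J. gauss \<gamma> w a) * ?v \<le> exp (\<gamma> * ?D\<^sup>2) * ?g"
      using g by (subst (asm) ennreal_le_iff) auto
    then show ?thesis using v by (simp add: pos_le_divide_eq)
  qed
  moreover have "?C > 0" using g v by simp
  ultimately show ?thesis by blast
qed

text \<open>
Sum the mean value inequality over the lattice.
\<close>
lemma lattice_sample:
  assumes \<alpha>: "\<alpha> > 0"
  shows "\<exists>C>0. \<forall>J. finite J \<longrightarrow> J \<subseteq> range corner \<longrightarrow> (\<forall>h\<in>(fock_space \<alpha> 1 :: (complex ^ 'n \<Rightarrow> complex) set).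
    (\<Sum>a\<in>J. wt \<alpha> h a) \<le> C * fock_norm \<alpha> 1 h)"
proof -
  obtain C where C: "C > 0" "\<forall>J. finite J \<longrightarrow> J \<subseteq> range corner \<longrightarrow> (\<forall>w :: complex ^ 'n. (\<Sum>a\<in>J. gauss \<alpha> w a) \<le> C)"
    using lattice_gauss_sum[OF \<alpha>, where 'n='n] by blast
  let ?k = "inverse (gauss_mass TYPE(complex ^ 'n) (\<alpha> + \<alpha> / 2))" and ?c = "fock_const TYPE('n) \<alpha> 1"
  have k: "?k > 0" using \<alpha> by (simp add: gauss_mass_pos)
  have c: "?c > 0" using \<alpha> by (simp add: fock_const_pos)
  have "(\<Sum>a\<in>J. wt \<alpha> h a) \<le> (?k * C / ?c) * fock_norm \<alpha> 1 h"
    if J: "finite J" "J \<subseteq> range corner" and h: "h \<in> fock_space \<alpha> 1" for J and h :: "complex ^ 'n \<Rightarrow> complex"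
  proof -
    have e: "entire h" and i: "integrable lborel (wt \<alpha> h)" using h by (auto simp: fock_space_1)
    note [measurable] = entire_measurable[OF e]
    have I: "0 \<le> (LINT z|lborel. wt \<alpha> h z)" by simp
    have "ennreal (\<Sum>a\<in>J. wt \<alpha> h a) = (\<Sum>a\<in>J. ennreal (wt \<alpha> h a))"
      by (simp add: sum_ennreal)
    also have "\<dots> \<le> (\<Sum>a\<in>J. ennreal ?k * (\<integral>\<^sup>+ z. ennreal (wt \<alpha> h z * gauss \<alpha> z a) \<partial>lborel))"
      by (intro sum_mono wt_le_gauss_mean e \<alpha>)
    also have "\<dots> = ennreal ?k * (\<integral>\<^sup>+ z. (\<Sum>a\<in>J. ennreal (wt \<alpha> h z * gauss \<alpha> z a)) \<partial>lborel)"
      by (subst nn_integral_sum) (auto simp: sum_distrib_left)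
    also have "\<dots> \<le> ennreal ?k * (\<integral>\<^sup>+ z. ennreal C * ennreal (wt \<alpha> h z) \<partial>lborel)"
    proof (intro mult_left_mono nn_integral_mono)
      fix z
      have "(\<Sum>a\<in>J. ennreal (wt \<alpha> h z * gauss \<alpha> z a)) = ennreal (wt \<alpha> h z * (\<Sum>a\<in>J. gauss \<alpha> z a))"
        by (subst sum_ennreal) (auto simp: sum_distrib_left)
      also have "\<dots> \<le> ennreal (wt \<alpha> h z * C)"
        by (intro ennreal_leI mult_left_mono C(2)[rule_format, OF J]) simp
      also have "\<dots> = ennreal C * ennreal (wt \<alpha> h z)"
        using C(1) by (simp add: ennreal_mult mult.commute)
      finally show "(\<Sum>a\<in>J. ennreal (wt \<alpha> h z * gauss \<alpha> z a)) \<le> ennreal C * ennreal (wt \<alpha> h z)" .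
    qed simp
    also have "\<dots> = ennreal ?k * (ennreal C * ennreal (LINT z|lborel. wt \<alpha> h z))"
      by (subst nn_integral_cmult) (auto simp: nn_integral_eq_integral[OF i])
    also have "\<dots> = ennreal (?k * (C * (LINT z|lborel. wt \<alpha> h z)))"
      using k C(1) I by (simp add: ennreal_mult[symmetric] del: ennreal_mult')
    finally have "(\<Sum>a\<in>J. wt \<alpha> h a) \<le> ?k * (C * (LINT z|lborel. wt \<alpha> h z))"
      using k C(1) I by (subst (asm) ennreal_le_iff) auto
    also have "\<dots> = (?k * C / ?c) * fock_norm \<alpha> 1 h"
      unfolding fock_norm_1[OF \<alpha>] using c by (simp add: field_simps)
    finally show ?thesis .
  qed
  moreover have "?k * C / ?c > 0" using k C c by simp
  ultimately show ?thesis by blast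
qed

section \<open>Sums of normalised kernels over the lattice\<close>

text \<open>
Replaces an average over random signs. The signs are chosen one after the other: a new index \<open>x\<close> contributes
\<open>M x x\<close> and \<open>\<epsilon>\<^sub>x\<close> times a number fixed by the earlier choices, whose sign \<open>\<epsilon>\<^sub>x\<close> can match.
\<close>
lemma exists_signs:
  fixes M :: "'a \<Rightarrow> 'a \<Rightarrow> real"
  assumes "finite J"
  shows "\<exists>\<epsilon> :: 'a \<Rightarrow> real. (\<forall>a. \<bar>\<epsilon> a\<bar> = 1) \<and> (\<Sum>a\<in>J. M a a) \<le> (\<Sum>a\<in>J. \<Sum>b\<in>J. \<epsilon> a * \<epsilon> b * M a b)"
  using assms
proof (induction J rule: finite_induct)
  case empty
  show ?case by (intro exI[of _ "\<lambda>_. 1"]) simp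
next
  case (insert x J)
  obtain \<epsilon> :: "'a \<Rightarrow> real" where \<epsilon>: "\<And>a. \<bar>\<epsilon> a\<bar> = 1" "(\<Sum>a\<in>J. M a a) \<le> (\<Sum>a\<in>J. \<Sum>b\<in>J. \<epsilon> a * \<epsilon> b * M a b)"
    using insert.IH by blast
  define X where "X = (\<Sum>a\<in>J. \<epsilon> a * (M x a + M a x))"
  define s :: real where "s = (if X \<ge> 0 then 1 else -1)"
  have s: "\<bar>s\<bar> = 1" "s * s = 1" "s * X \<ge> 0" by (auto simp: s_def)
  define \<delta> where "\<delta> = \<epsilon>(x := s)"
  have \<delta>: "\<delta> x = s" "\<And>a. a \<in> J \<Longrightarrow> \<delta> a = \<epsilon> a" using insert.hyps by (auto simp: \<delta>_def)
  have "(\<Sum>a\<in>insert x J. \<Sum>b\<in>insert x J. \<delta> a * \<delta> b * M a b)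
    = s * s * M x x + (\<Sum>b\<in>J. s * \<epsilon> b * M x b) + ((\<Sum>a\<in>J. \<epsilon> a * s * M a x) + (\<Sum>a\<in>J. \<Sum>b\<in>J. \<epsilon> a * \<epsilon> b * M a b))"
    using insert.hyps \<delta> by (simp add: sum.distrib)
  also have "(\<Sum>b\<in>J. s * \<epsilon> b * M x b) = s * (\<Sum>b\<in>J. \<epsilon> b * M x b)"
    by (simp add: sum_distrib_left mult.assoc)
  also have "(\<Sum>a\<in>J. \<epsilon> a * s * M a x) = s * (\<Sum>b\<in>J. \<epsilon> b * M b x)"
    by (simp add: sum_distrib_left mult_ac)
  finally have "(\<Sum>a\<in>insert x J. \<Sum>b\<in>insert x J. \<delta> a * \<delta> b * M a b)
    = M x x + s * X + (\<Sum>a\<in>J. \<Sum>b\<in>J. \<epsilon> a * \<epsilon> b * M a b)"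
    using s(2) by (simp add: X_def distrib_left sum.distrib)
  then have "(\<Sum>a\<in>insert x J. M a a) \<le> (\<Sum>a\<in>insert x J. \<Sum>b\<in>insert x J. \<delta> a * \<delta> b * M a b)"
    using insert.hyps \<epsilon>(2) s(3) by simp
  moreover have "\<forall>a. \<bar>\<delta> a\<bar> = 1" using \<epsilon>(1) s(1) by (simp add: \<delta>_def)
  ultimately show ?case by blast
qed

text \<open>
Hoelder's inequality for counting measure, with the weight \<open>g\<close> split between the factors.
\<close>
lemma weighted_power_mean:
  fixes c g :: "'a \<Rightarrow> real"
  assumes J: "finite J" and r: "r > 1" and c: "\<And>a. c a \<ge> 0" and g: "\<And>a. g a \<ge> 0" and G: "(\<Sum>a\<in>J. g a) \<le> G"
  shows "(\<Sum>a\<in>J. c a * g a) powr r \<le> G powr (r - 1) * (\<Sum>a\<in>J. c a powr r * g a)"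
proof -
  define q where "q = r / (r - 1)"
  have q: "1 / r + 1 / q = 1" using r by (simp add: q_def field_simps)
  have q0: "q > 0" using r by (simp add: q_def)
  have e1: "(c a * g a powr (1 / r)) powr r = c a powr r * g a" for a
    using c g r by (simp add: powr_mult powr_powr)
  have e2: "(g a powr (1 / q)) powr q = g a" for a
    using g q0 by (simp add: powr_powr)
  have e3: "c a * g a powr (1 / r) * g a powr (1 / q) = c a * g a" for a
    using g[of a] q by (simp add: mult.assoc powr_add[symmetric])
  have "(LINT a|count_space J. (c a * g a powr (1 / r)) * g a powr (1 / q)) \<le>
     (LINT a|count_space J. (c a * g a powr (1 / r)) powr r) powr (1 / r) * (LINT a|count_space J. (g a powr (1 / q)) powr q) powr (1 / q)"
    by (rule holder_integral(2)[OF r q]) (use J c in \<open>auto intro: integrable_count_space\<close>)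
  then have "(\<Sum>a\<in>J. c a * g a) \<le> (\<Sum>a\<in>J. c a powr r * g a) powr (1 / r) * (\<Sum>a\<in>J. g a) powr (1 / q)"
    unfolding e1 e2 e3 by (simp add: lebesgue_integral_count_space_finite[OF J])
  then have "(\<Sum>a\<in>J. c a * g a) powr r \<le> ((\<Sum>a\<in>J. c a powr r * g a) powr (1 / r) * (\<Sum>a\<in>J. g a) powr (1 / q)) powr r"
    using r c g by (intro powr_mono2) (auto intro!: sum_nonneg)
  also have "\<dots> = (\<Sum>a\<in>J. c a powr r * g a) * (\<Sum>a\<in>J. g a) powr (r - 1)"
  proof -
    have "1 / q * r = r - 1" using r by (simp add: q_def)
    then show ?thesis using r c g by (simp add: powr_mult powr_powr sum_nonneg)
  qed
  also have "\<dots> \<le> (\<Sum>a\<in>J. c a powr r * g a) * G powr (r - 1)"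
    using G g c r by (intro mult_left_mono powr_mono2) (auto intro!: sum_nonneg)
  finally show ?thesis by (simp add: mult.commute)
qed

text \<open>
The coefficients are normalised so that one estimate serves all exponents: with \<open>q\<close> conjugate to
\<open>p\<close>, \<open>(b\<^sup>q\<^sup>-\<^sup>1)\<^sup>p = b\<^sup>q\<close> if \<open>p\<close> is finite, and \<open>b\<^sup>q\<^sup>-\<^sup>1\<close> is at most 1 if \<open>p\<close> is infinite. The number
\<open>1 - 1/q\<close> stands for \<open>1/p\<close>.
\<close>
lemma lattice_synthesis:
  assumes \<alpha>: "\<alpha> > 0" and p: "1 < p"
  shows "\<exists>C>0. \<forall>J d b. finite J \<longrightarrow> J \<subseteq> range corner \<longrightarrow> (\<forall>a. 0 \<le> b a \<and> norm (d a) \<le> b a powr (conj_exp p - 1)) \<longrightarrow>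
    0 < (\<Sum>a\<in>J. b a powr conj_exp p) \<longrightarrow>
    (\<lambda>z :: complex ^ 'n. \<Sum>a\<in>J. d a * nkern \<alpha> a z) \<in> fock_space \<alpha> p \<and>
    fock_norm \<alpha> p (\<lambda>z. \<Sum>a\<in>J. d a * nkern \<alpha> a z) \<le> C * (\<Sum>a\<in>J. b a powr conj_exp p) powr (1 - 1 / conj_exp p)"
proof -
  have \<alpha>2: "\<alpha> / 2 > 0" using \<alpha> by simp
  obtain C where C: "C > 0" "\<forall>J. finite J \<longrightarrow> J \<subseteq> range corner \<longrightarrow> (\<forall>w :: complex ^ 'n. (\<Sum>a\<in>J. gauss (\<alpha> / 2) w a) \<le> C)"
    using lattice_gauss_sum[OF \<alpha>2, where 'n='n] by blast
  have e: "entire (\<lambda>z :: complex ^ 'n. \<Sum>a\<in>J. d a * nkern \<alpha> a z)" for J d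
    by (rule entire_sum, rule entire_scale, rule entire_nkern)
  have w: "wt \<alpha> (\<lambda>z. \<Sum>a\<in>J. d a * nkern \<alpha> a z) z \<le> (\<Sum>a\<in>J. b a powr (conj_exp p - 1) * gauss (\<alpha> / 2) z a)"
    if d: "\<forall>a. 0 \<le> b a \<and> norm (d a) \<le> b a powr (conj_exp p - 1)" for J d b and z :: "complex ^ 'n"
  proof -
    have "wt \<alpha> (\<lambda>z. \<Sum>a\<in>J. d a * nkern \<alpha> a z) z \<le> (\<Sum>a\<in>J. norm (d a * nkern \<alpha> a z)) * exp (- (\<alpha> / 2) * (norm z)\<^sup>2)"
      unfolding wt_def by (intro mult_right_mono norm_sum) simp
    also have "\<dots> = (\<Sum>a\<in>J. norm (d a) * wt \<alpha> (nkern \<alpha> a) z)"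
      unfolding wt_def by (simp add: sum_distrib_right norm_mult mult.assoc)
    also have "\<dots> \<le> (\<Sum>a\<in>J. b a powr (conj_exp p - 1) * gauss (\<alpha> / 2) z a)"
      unfolding wt_nkern using d by (intro sum_mono mult_right_mono) auto
    finally show ?thesis .
  qed
  from p show ?thesis
  proof (cases rule: exponent_gt_1_cases)
    case 1
    have q: "conj_exp p = 1" by (simp add: 1 conj_exp_def)
    have "(\<lambda>z. \<Sum>a\<in>J. d a * nkern \<alpha> a z) \<in> fock_space \<alpha> p \<and>
      fock_norm \<alpha> p (\<lambda>z. \<Sum>a\<in>J. d a * nkern \<alpha> a z) \<le> C * (\<Sum>a\<in>J. b a powr conj_exp p) powr (1 - 1 / conj_exp p)"
      if J: "finite J" "J \<subseteq> range corner" and d: "\<forall>a. 0 \<le> b a \<and> norm (d a) \<le> b a powr (conj_exp p - 1)"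
        and X: "0 < (\<Sum>a\<in>J. b a powr conj_exp p)" for J d and b :: "complex ^ 'n \<Rightarrow> real"
    proof -
      have le: "wt \<alpha> (\<lambda>z. \<Sum>a\<in>J. d a * nkern \<alpha> a z) z \<le> C" for z
      proof -
        have "(\<Sum>a\<in>J. b a powr (conj_exp p - 1) * gauss (\<alpha> / 2) z a) \<le> (\<Sum>a\<in>J. 1 * gauss (\<alpha> / 2) z a)"
          unfolding q by (intro sum_mono mult_right_mono) auto
        then show ?thesis using w[OF d, of J z] C(2)[rule_format, OF J, of z] by simp
      qed
      show ?thesis
        unfolding q unfolding 1 fock_space_infty fock_norm_infty using e le X[unfolded q]
        by (auto intro!: cSUP_least bdd_aboveI2)
    qed
    then show ?thesis using C(1) by blast
  next
    case (2 r)
    let ?c = "fock_const TYPE('n) \<alpha> r" and ?g = "gauss_mass TYPE(complex ^ 'n) (\<alpha> / 2)"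
    have c: "?c > 0" using \<alpha> 2 by (simp add: fock_const_pos)
    have g: "?g > 0" using \<alpha> by (simp add: gauss_mass_pos)
    have r1: "r \<ge> 1" using 2 by simp
    define q where "q = conj_exp p"
    have q: "q = r / (r - 1)" using 2 by (simp add: q_def conj_exp_def)
    have qr: "(q - 1) * r = q" "1 - 1 / q = 1 / r" using 2 by (auto simp: q field_simps)
    let ?K = "(?c * (C powr (r - 1) * ?g)) powr (1 / r)"
    have "(\<lambda>z. \<Sum>a\<in>J. d a * nkern \<alpha> a z) \<in> fock_space \<alpha> p \<and>
      fock_norm \<alpha> p (\<lambda>z. \<Sum>a\<in>J. d a * nkern \<alpha> a z) \<le> ?K * (\<Sum>a\<in>J. b a powr conj_exp p) powr (1 - 1 / conj_exp p)"
      if J: "finite J" "J \<subseteq> range corner" and d: "\<forall>a. 0 \<le> b a \<and> norm (d a) \<le> b a powr (conj_exp p - 1)"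
      for J d and b :: "complex ^ 'n \<Rightarrow> real"
    proof -
      let ?f = "\<lambda>z. \<Sum>a\<in>J. d a * nkern \<alpha> a z"
      let ?X = "\<Sum>a\<in>J. b a powr q"
      note [measurable] = entire_measurable[OF e[of d J]]
      have X: "?X \<ge> 0" by (simp add: sum_nonneg)
      have bq: "(b a powr (q - 1)) powr r = b a powr q" for a by (simp add: powr_powr qr)
      let ?h = "\<lambda>z. C powr (r - 1) * (\<Sum>a\<in>J. b a powr q * gauss (\<alpha> / 2) z a)"
      have le: "wt \<alpha> ?f z powr r \<le> ?h z" for z
      proof -
        have "wt \<alpha> ?f z powr r \<le> (\<Sum>a\<in>J. b a powr (q - 1) * gauss (\<alpha> / 2) z a) powr r"
          using w[OF d, of J z] r1 unfolding q_def by (intro powr_mono2) auto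
        also have "\<dots> \<le> C powr (r - 1) * (\<Sum>a\<in>J. (b a powr (q - 1)) powr r * gauss (\<alpha> / 2) z a)"
          by (rule weighted_power_mean[OF J(1) 2(2) _ _ C(2)[rule_format, OF J]]) auto
        finally show ?thesis unfolding bq .
      qed
      have hi: "integrable lborel ?h"
        by (intro integrable_mult_right Bochner_Integration.integrable_sum gauss_integrable \<alpha>2)
      have I: "integrable lborel (\<lambda>z. wt \<alpha> ?f z powr r)"
      proof (rule Bochner_Integration.integrable_bound[OF hi])
        show "AE z in lborel. norm (wt \<alpha> ?f z powr r) \<le> norm (?h z)"
        proof (rule AE_I2)
          fix z
          have "norm (wt \<alpha> ?f z powr r) = wt \<alpha> ?f z powr r" by simp
          also note le[of z]
          also have "?h z \<le> norm (?h z)" by (simp only: real_norm_def abs_ge_self)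
          finally show "norm (wt \<alpha> ?f z powr r) \<le> norm (?h z)" .
        qed
      qed measurable
      have "(LINT z|lborel. wt \<alpha> ?f z powr r) \<le> (LINT z|lborel. ?h z)"
        by (rule integral_mono[OF I hi le])
      also have "\<dots> = C powr (r - 1) * (\<Sum>a\<in>J. b a powr q * ?g)"
      proof -
        have "(LINT z|lborel. (\<Sum>a\<in>J. b a powr q * gauss (\<alpha> / 2) z a)) = (\<Sum>a\<in>J. b a powr q * ?g)"
        proof (subst Bochner_Integration.integral_sum)
          show "integrable lborel (\<lambda>z. b a powr q * gauss (\<alpha> / 2) z a)" for a
            by (intro integrable_mult_right gauss_integrable \<alpha>2)
          show "(\<Sum>a\<in>J. LINT z|lborel. b a powr q * gauss (\<alpha> / 2) z a) = (\<Sum>a\<in>J. b a powr q * ?g)"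
            by (simp only: integral_mult_right_zero gauss_integral[OF \<alpha>2])
        qed
        then show ?thesis by simp
      qed
      also have "\<dots> = C powr (r - 1) * ?g * ?X" by (simp add: sum_distrib_right mult_ac)
      finally have le2: "?c * (LINT z|lborel. wt \<alpha> ?f z powr r) \<le> ?c * (C powr (r - 1) * ?g) * ?X"
        using c by (simp add: mult.assoc)
      have "fock_norm \<alpha> p ?f \<le> (?c * (C powr (r - 1) * ?g) * ?X) powr (1 / r)"
        unfolding 2(1) fock_norm_real[OF r1] using le2 c r1 by (intro powr_mono2) auto
      also have "\<dots> = ?K * ?X powr (1 / r)"
        by (rule powr_mult)
      finally show ?thesis
        using I e r1 unfolding q_def[symmetric] qr(2) by (simp add: 2(1) fock_space_real)
    qed
    moreover have "?K > 0" using c g C(1) by simp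
    ultimately show ?thesis by blast
  qed
qed

section \<open>Operators into the smallest Fock space\<close>

lemma toeplitz_sum:
  assumes "finite J" "\<And>a. a \<in> J \<Longrightarrow> integrable \<mu> (toeplitz_integrand \<alpha> (g a) z)"
  shows "toeplitz \<alpha> \<mu> (\<lambda>x. \<Sum>a\<in>J. d a * g a x) z = (\<Sum>a\<in>J. d a * toeplitz \<alpha> \<mu> (g a) z)"
proof -
  have "toeplitz_integrand \<alpha> (\<lambda>x. \<Sum>a\<in>J. d a * g a x) z = (\<lambda>w. \<Sum>a\<in>J. d a * toeplitz_integrand \<alpha> (g a) z w)"
    by (simp add: fun_eq_iff toeplitz_integrand_def sum_distrib_left sum_distrib_right mult_ac)
  then show ?thesis
    unfolding toeplitz_def by (simp add: Bochner_Integration.integral_sum assms)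
qed

text \<open>
With \<open>X = \<Sum> b\<^sub>a\<^sup>q\<close>, the test function has norm at most \<open>B X\<^sup>1\<^sup>/\<^sup>p\<close>. The matrix \<open>M a c\<close> is the contribution of the
kernel at \<open>c\<close>, without its sign, to the image at \<open>a\<close>; its diagonal adds up to \<open>X\<close>. Sampling gives
\<open>X \<le> A N B X\<^sup>1\<^sup>/\<^sup>p\<close>, that is, \<open>X\<^sup>1\<^sup>/\<^sup>q \<le> A B N\<close>.
\<close>
lemma lattice_berezin_sum:
  assumes \<alpha>: "\<alpha> > 0" and p: "1 < p"
  shows "\<exists>C>0. \<forall>(\<mu> :: (complex^'n) measure) N. toeplitz_admissible \<alpha> \<mu> \<longrightarrow> 0 \<le> N \<longrightarrow>
    (\<forall>f\<in>fock_space \<alpha> p. toeplitz \<alpha> \<mu> f \<in> fock_space \<alpha> 1 \<and> fock_norm \<alpha> 1 (toeplitz \<alpha> \<mu> f) \<le> N * fock_norm \<alpha> p f) \<longrightarrow>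
    (\<forall>f\<in>fock_space \<alpha> p. \<forall>z. integrable \<mu> (toeplitz_integrand \<alpha> f z)) \<longrightarrow>
    (\<forall>J. finite J \<longrightarrow> J \<subseteq> range corner \<longrightarrow> (\<Sum>a\<in>J. enn2real (berezin \<alpha> \<mu> a) powr conj_exp p) \<le> (C * N) powr conj_exp p)"
proof -
  let ?q = "conj_exp p"
  have q: "?q \<ge> 1" by (rule conj_exp_ge[OF p])
  have p1: "1 \<le> p" using p by simp
  obtain A where A: "A > 0" "\<forall>J. finite J \<longrightarrow> J \<subseteq> range corner \<longrightarrow> (\<forall>h\<in>(fock_space \<alpha> 1 :: (complex ^ 'n \<Rightarrow> complex) set).
    (\<Sum>a\<in>J. wt \<alpha> h a) \<le> A * fock_norm \<alpha> 1 h)"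
    using lattice_sample[OF \<alpha>, where 'n='n] by blast
  obtain B where B: "B > 0" "\<forall>J d b. finite J \<longrightarrow> J \<subseteq> range corner \<longrightarrow> (\<forall>a. 0 \<le> b a \<and> norm (d a) \<le> b a powr (?q - 1)) \<longrightarrow>
    0 < (\<Sum>a\<in>J. b a powr ?q) \<longrightarrow>
    (\<lambda>z :: complex ^ 'n. \<Sum>a\<in>J. d a * nkern \<alpha> a z) \<in> fock_space \<alpha> p \<and>
    fock_norm \<alpha> p (\<lambda>z. \<Sum>a\<in>J. d a * nkern \<alpha> a z) \<le> B * (\<Sum>a\<in>J. b a powr ?q) powr (1 - 1 / ?q)"
    using lattice_synthesis[OF \<alpha> p, where 'n='n] by blast
  obtain E where E: "\<forall>f\<in>(fock_space \<alpha> 1 :: (complex^'n \<Rightarrow> complex) set). f \<in> fock_space \<alpha> p \<and> fock_norm \<alpha> p f \<le> E * fock_norm \<alpha> 1 f"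
    using fock_1_subset[OF \<alpha> p1, where 'n='n] by blast
  have "(\<Sum>a\<in>J. enn2real (berezin \<alpha> \<mu> a) powr ?q) \<le> (A * B * N) powr ?q"
    if adm: "toeplitz_admissible \<alpha> \<mu>" and N: "0 \<le> N"
      and T: "\<forall>f\<in>fock_space \<alpha> p. toeplitz \<alpha> \<mu> f \<in> fock_space \<alpha> 1 \<and> fock_norm \<alpha> 1 (toeplitz \<alpha> \<mu> f) \<le> N * fock_norm \<alpha> p f"
      and I: "\<forall>f\<in>fock_space \<alpha> p. \<forall>z. integrable \<mu> (toeplitz_integrand \<alpha> f z)"
      and J: "finite J" "J \<subseteq> range corner" for \<mu> :: "(complex^'n) measure" and N J
  proof -
    define b where "b a = enn2real (berezin \<alpha> \<mu> a)" for a
    have b0: "b a \<ge> 0" for a by (simp add: b_def)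
    define X where "X = (\<Sum>a\<in>J. b a powr ?q)"
    have X0: "X \<ge> 0" unfolding X_def by (simp add: sum_nonneg)
    define e where "e a = exp (- (\<alpha> / 2) * (norm a)\<^sup>2)" for a :: "complex^'n"
    define M where "M a c = b c powr (?q - 1) * (Re (toeplitz \<alpha> \<mu> (nkern \<alpha> c) a) * e a)" for a c
    have Maa: "M a a = b a powr ?q" for a
    proof -
      have "Re (toeplitz \<alpha> \<mu> (nkern \<alpha> a) a) * e a = Re (toeplitz \<alpha> \<mu> (nkern \<alpha> a) a * of_real (e a))" by simp
      also have "\<dots> = b a"
        unfolding e_def toeplitz_nkern_diag[OF admissible_sets[OF adm]] b_def by simp
      finally show ?thesis
        using b0[of a] unfolding M_def by (cases "b a = 0") (auto simp: powr_diff)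
    qed
    obtain \<epsilon> :: "complex^'n \<Rightarrow> real" where \<epsilon>: "\<forall>a. \<bar>\<epsilon> a\<bar> = 1" "(\<Sum>a\<in>J. M a a) \<le> (\<Sum>a\<in>J. \<Sum>c\<in>J. \<epsilon> a * \<epsilon> c * M a c)"
      using exists_signs[OF J(1), of M] by blast
    show ?thesis
    proof (cases "X = 0")
      case True
      then show ?thesis unfolding X_def b_def by simp
    next
      case False
      with X0 have X: "X > 0" by simp
      define d where "d a = complex_of_real (\<epsilon> a * b a powr (?q - 1))" for a
      have d: "\<forall>a. 0 \<le> b a \<and> norm (d a) \<le> b a powr (?q - 1)"
        using \<epsilon>(1) b0 unfolding d_def norm_of_real by (simp add: abs_mult)
      let ?f = "\<lambda>z. \<Sum>a\<in>J. d a * nkern \<alpha> a z"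
      have f: "?f \<in> fock_space \<alpha> p" "fock_norm \<alpha> p ?f \<le> B * X powr (1 - 1 / ?q)"
        using B(2)[rule_format, OF J, of b d] d X unfolding X_def by auto
      have kI: "integrable \<mu> (toeplitz_integrand \<alpha> (nkern \<alpha> a) z)" for a z
        using I E nkern_fock_1(1)[OF \<alpha>, of a] by blast
      let ?T = "toeplitz \<alpha> \<mu> ?f"
      have Tf: "?T a = (\<Sum>c\<in>J. d c * toeplitz \<alpha> \<mu> (nkern \<alpha> c) a)" for a
        by (rule toeplitz_sum[OF J(1) kI])
      have "X = (\<Sum>a\<in>J. M a a)" unfolding X_def Maa ..
      also have "\<dots> \<le> (\<Sum>a\<in>J. \<Sum>c\<in>J. \<epsilon> a * \<epsilon> c * M a c)" by (rule \<epsilon>(2))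
      also have "\<dots> = (\<Sum>a\<in>J. \<epsilon> a * (Re (?T a) * e a))"
      proof (rule sum.cong[OF refl])
        fix a
        have "Re (?T a) = (\<Sum>c\<in>J. \<epsilon> c * b c powr (?q - 1) * Re (toeplitz \<alpha> \<mu> (nkern \<alpha> c) a))"
          unfolding Tf by (simp add: d_def del: of_real_mult)
        then show "(\<Sum>c\<in>J. \<epsilon> a * \<epsilon> c * M a c) = \<epsilon> a * (Re (?T a) * e a)"
          unfolding M_def by (simp add: sum_distrib_left sum_distrib_right mult_ac)
      qed
      also have "\<dots> \<le> (\<Sum>a\<in>J. wt \<alpha> ?T a)"
      proof (rule sum_mono)
        fix a
        have "\<epsilon> a * (Re (?T a) * e a) \<le> \<bar>\<epsilon> a * (Re (?T a) * e a)\<bar>" by simp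
        also have "\<dots> = \<bar>Re (?T a)\<bar> * e a" using \<epsilon>(1) by (simp add: abs_mult e_def)
        also have "\<dots> \<le> norm (?T a) * e a"
          by (intro mult_right_mono abs_Re_le_cmod) (simp add: e_def)
        finally show "\<epsilon> a * (Re (?T a) * e a) \<le> wt \<alpha> ?T a" by (simp add: wt_def e_def)
      qed
      also have "\<dots> \<le> A * fock_norm \<alpha> 1 ?T"
        using A(2)[rule_format, OF J] T f(1) by blast
      also have "\<dots> \<le> A * (N * (B * X powr (1 - 1 / ?q)))"
        using A(1) N f T by (intro mult_left_mono order_trans[OF bspec[OF T f(1), THEN conjunct2]]) auto
      also have "\<dots> = (A * B * N) * X powr (1 - 1 / ?q)" by simp
      finally have "X \<le> (A * B * N) * (X / X powr (1 / ?q))"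
        using X by (simp add: powr_diff)
      then have "X powr (1 / ?q) \<le> A * B * N"
        using X by (simp add: field_simps)
      then have "(X powr (1 / ?q)) powr ?q \<le> (A * B * N) powr ?q"
        using q by (intro powr_mono2) auto
      then have "X \<le> (A * B * N) powr ?q"
        using q X by (simp add: powr_powr)
      then show ?thesis unfolding X_def b_def .
    qed
  qed
  moreover have "A * B > 0" using A(1) B(1) by simp
  ultimately show ?thesis by blast
qed

text \<open>
The Berezin transform of width \<open>2\<alpha>\<close> is, on each cell, dominated by the one of width \<open>\<alpha>\<close> at the corner.
\<close>
lemma berezin_Lq_of_lattice:
  assumes \<alpha>: "\<alpha> > 0" and q: "1 \<le> q"
  shows "\<exists>C>0. \<forall>(\<mu> :: (complex^'n) measure) L. toeplitz_admissible \<alpha> \<mu> \<longrightarrow> 0 \<le> L \<longrightarrow>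
    (\<forall>J. finite J \<longrightarrow> J \<subseteq> range corner \<longrightarrow> (\<Sum>a\<in>J. enn2real (berezin \<alpha> \<mu> a) powr q) \<le> L powr q) \<longrightarrow>
    (\<integral>\<^sup>+ z. ennreal (enn2real (berezin (2 * \<alpha>) \<mu> z) powr q) \<partial>lborel) \<le> ennreal ((C * L) powr q)"
proof -
  let ?D = "2 * real CARD('n)" and ?v = "cell_vol TYPE('n)"
  have v: "?v > 0" by (rule cell_vol)
  define E where "E = exp (2 * \<alpha> * ?D\<^sup>2)"
  have E: "E > 0" by (simp add: E_def)
  let ?C = "E * ?v powr (1 / q)"
  have "(\<integral>\<^sup>+ z. ennreal (enn2real (berezin (2 * \<alpha>) \<mu> z) powr q) \<partial>lborel) \<le> ennreal ((?C * L) powr q)"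
    if adm: "toeplitz_admissible \<alpha> \<mu>" and L: "0 \<le> L"
      and le: "\<forall>J. finite J \<longrightarrow> J \<subseteq> range corner \<longrightarrow> (\<Sum>a\<in>J. enn2real (berezin \<alpha> \<mu> a) powr q) \<le> L powr q"
    for \<mu> :: "(complex^'n) measure" and L
  proof -
    define b where "b a = enn2real (berezin \<alpha> \<mu> a)" for a
    have b: "b a \<ge> 0" "berezin \<alpha> \<mu> a = ennreal (b a)" for a
      using admissible_berezin_finite[OF adm, of a] by (auto simp: b_def less_top)
    have pt: "enn2real (berezin (2 * \<alpha>) \<mu> z) \<le> E * b (corner z)" for z
    proof (rule enn2real_leI)
      show "0 \<le> E * b (corner z)" using E b by simp
      have "berezin (2 * \<alpha>) \<mu> z \<le> ennreal (exp (2 * \<alpha> * (norm (z - corner z))\<^sup>2)) * berezin \<alpha> \<mu> (corner z)"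
        by (rule berezin_local_bound[OF \<alpha> order_refl admissible_sets[OF adm]])
      also have "\<dots> \<le> ennreal E * ennreal (b (corner z))"
      proof -
        have "(norm (z - corner z))\<^sup>2 \<le> ?D\<^sup>2" by (rule power_mono[OF norm_diff_corner_le]) simp
        then have "exp (2 * \<alpha> * (norm (z - corner z))\<^sup>2) \<le> E"
          unfolding E_def exp_le_cancel_iff using \<alpha> by (intro mult_left_mono) auto
        then show ?thesis unfolding b(2) by (intro mult_right_mono ennreal_leI) auto
      qed
      also have "\<dots> = ennreal (E * b (corner z))" using E b by (simp add: ennreal_mult)
      finally show "berezin (2 * \<alpha>) \<mu> z \<le> ennreal (E * b (corner z))" .
    qed
    \<comment> \<open>the finite sums over initial segments of an enumeration increase to the integral of a step function\<close>
    define en where "en = from_nat_into (range (corner :: complex^'n \<Rightarrow> complex^'n))"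
    have en: "range en = range (corner :: complex^'n \<Rightarrow> complex^'n)"
      unfolding en_def by (rule range_from_nat_into) (auto simp: countable_range_corner)
    define u where "u n z = (\<Sum>a\<in>en ` {..<n}. ennreal (b a powr q) * indicator (cell a) z)" for n :: nat and z :: "complex^'n"
    have u: "u n z = (if corner z \<in> en ` {..<n} then ennreal (b (corner z) powr q) else 0)" for n z
      unfolding u_def by (rule sum_indicator_cells) simp
    have [measurable]: "u n \<in> borel_measurable borel" for n unfolding u_def by measurable
    have inc: "incseq u"
    proof (rule incseq_SucI, rule le_funI)
      fix n z
      have "corner z \<in> en ` {..<n} \<Longrightarrow> corner z \<in> en ` {..<Suc n}" by auto
      then show "u n z \<le> u (Suc n) z" unfolding u by auto
    qed
    have sup: "(SUP n. u n z) = ennreal (b (corner z) powr q)" for z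
    proof (rule antisym)
      show "(SUP n. u n z) \<le> ennreal (b (corner z) powr q)" by (rule SUP_least) (simp add: u)
      have "corner z \<in> range en" unfolding en by simp
      then obtain m where m: "corner z = en m" by blast
      have "ennreal (b (corner z) powr q) = u (Suc m) z" unfolding u m by simp
      also have "\<dots> \<le> (SUP n. u n z)" by (rule SUP_upper) simp
      finally show "ennreal (b (corner z) powr q) \<le> (SUP n. u n z)" .
    qed
    have un: "(\<integral>\<^sup>+ z. u n z \<partial>lborel) \<le> ennreal (?v * L powr q)" for n
    proof -
      have J: "finite (en ` {..<n})" "en ` {..<n} \<subseteq> range corner" using en by auto
      have "(\<integral>\<^sup>+ z. u n z \<partial>lborel) = (\<Sum>a\<in>en ` {..<n}. ennreal (b a powr q) * emeasure lborel (cell a))"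
        unfolding u_def by (subst nn_integral_sum) (auto simp: nn_integral_cmult_indicator)
      also have "\<dots> = (\<Sum>a\<in>en ` {..<n}. ennreal (b a powr q) * ennreal ?v)"
        by (intro sum.cong refl arg_cong2[of _ _ _ _ "(*)"] cell_vol(2)) (use J in auto)
      also have "\<dots> = ennreal ((\<Sum>a\<in>en ` {..<n}. b a powr q) * ?v)"
      proof -
        have "(\<Sum>a\<in>en ` {..<n}. ennreal (b a powr q) * ennreal ?v) = (\<Sum>a\<in>en ` {..<n}. ennreal (b a powr q)) * ennreal ?v"
          by (rule sum_distrib_right[symmetric])
        also have "(\<Sum>a\<in>en ` {..<n}. ennreal (b a powr q)) = ennreal (\<Sum>a\<in>en ` {..<n}. b a powr q)"
          by (rule sum_ennreal) simp
        finally show ?thesis using v by (simp add: ennreal_mult sum_nonneg)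
      qed
      also have "\<dots> \<le> ennreal (?v * L powr q)"
        using le[rule_format, OF J] v unfolding b_def by (intro ennreal_leI) (simp add: mult.commute)
      finally show ?thesis .
    qed
    have "(\<integral>\<^sup>+ z. ennreal (enn2real (berezin (2 * \<alpha>) \<mu> z) powr q) \<partial>lborel) \<le> (\<integral>\<^sup>+ z. ennreal (E powr q) * (SUP n. u n z) \<partial>lborel)"
    proof (rule nn_integral_mono)
      fix z
      have "enn2real (berezin (2 * \<alpha>) \<mu> z) powr q \<le> (E * b (corner z)) powr q"
        using q by (intro powr_mono2 pt) auto
      also have "\<dots> = E powr q * b (corner z) powr q" using E b by (simp add: powr_mult)
      finally show "ennreal (enn2real (berezin (2 * \<alpha>) \<mu> z) powr q) \<le> ennreal (E powr q) * (SUP n. u n z)"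
        unfolding sup by (simp add: ennreal_mult[symmetric] ennreal_leI)
    qed
    also have "\<dots> = ennreal (E powr q) * (SUP n. \<integral>\<^sup>+ z. u n z \<partial>lborel)"
      by (subst nn_integral_cmult) (auto simp: nn_integral_monotone_convergence_SUP[OF inc])
    also have "\<dots> \<le> ennreal (E powr q) * ennreal (?v * L powr q)"
      by (intro mult_left_mono SUP_least un) simp
    also have "\<dots> = ennreal ((?C * L) powr q)"
      using E v L q by (simp add: ennreal_mult[symmetric] powr_mult powr_powr mult_ac)
    finally show ?thesis .
  qed
  moreover have "?C > 0" using E v by simp
  ultimately show ?thesis by blast
qed

lemma berezin_Lq_of_toeplitz:
  assumes \<alpha>: "\<alpha> > 0" and p: "1 < p"
  shows "\<exists>C>0. \<forall>(\<mu> :: (complex^'n) measure). toeplitz_admissible \<alpha> \<mu> \<longrightarrow> toeplitz_bounded \<alpha> \<mu> p 1 \<longrightarrow>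
    (\<integral>\<^sup>+ z. ennreal (enn2real (berezin (2 * \<alpha>) \<mu> z) powr conj_exp p) \<partial>lborel) \<le> ennreal ((C * toeplitz_norm \<alpha> \<mu> p 1) powr conj_exp p)"
proof -
  obtain C where C: "C > 0" "\<forall>(\<mu> :: (complex^'n) measure) N. toeplitz_admissible \<alpha> \<mu> \<longrightarrow> 0 \<le> N \<longrightarrow>
    (\<forall>f\<in>fock_space \<alpha> p. toeplitz \<alpha> \<mu> f \<in> fock_space \<alpha> 1 \<and> fock_norm \<alpha> 1 (toeplitz \<alpha> \<mu> f) \<le> N * fock_norm \<alpha> p f) \<longrightarrow>
    (\<forall>f\<in>fock_space \<alpha> p. \<forall>z. integrable \<mu> (toeplitz_integrand \<alpha> f z)) \<longrightarrow>
    (\<forall>J. finite J \<longrightarrow> J \<subseteq> range corner \<longrightarrow> (\<Sum>a\<in>J. enn2real (berezin \<alpha> \<mu> a) powr conj_exp p) \<le> (C * N) powr conj_exp p)"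
    using lattice_berezin_sum[OF \<alpha> p, where 'n='n] by blast
  obtain D where D: "D > 0" "\<forall>(\<mu> :: (complex^'n) measure) L. toeplitz_admissible \<alpha> \<mu> \<longrightarrow> 0 \<le> L \<longrightarrow>
    (\<forall>J. finite J \<longrightarrow> J \<subseteq> range corner \<longrightarrow> (\<Sum>a\<in>J. enn2real (berezin \<alpha> \<mu> a) powr conj_exp p) \<le> L powr conj_exp p) \<longrightarrow>
    (\<integral>\<^sup>+ z. ennreal (enn2real (berezin (2 * \<alpha>) \<mu> z) powr conj_exp p) \<partial>lborel) \<le> ennreal ((D * L) powr conj_exp p)"
    using berezin_Lq_of_lattice[OF \<alpha> conj_exp_ge[OF p], where 'n='n] by blast
  have "(\<integral>\<^sup>+ z. ennreal (enn2real (berezin (2 * \<alpha>) \<mu> z) powr conj_exp p) \<partial>lborel) \<le> ennreal ((D * C * toeplitz_norm \<alpha> \<mu> p 1) powr conj_exp p)"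
    if adm: "toeplitz_admissible \<alpha> \<mu>" and b: "toeplitz_bounded \<alpha> \<mu> p 1" for \<mu> :: "(complex^'n) measure"
  proof -
    have p1: "1 \<le> p" using p by simp
    note B = toeplitz_boundedD[OF p1 b]
    have "0 \<le> C * toeplitz_norm \<alpha> \<mu> p 1" using C(1) B(1) by simp
    moreover have "\<forall>J. finite J \<longrightarrow> J \<subseteq> range corner \<longrightarrow> (\<Sum>a\<in>J. enn2real (berezin \<alpha> \<mu> a) powr conj_exp p) \<le> (C * toeplitz_norm \<alpha> \<mu> p 1) powr conj_exp p"
      using C(2)[rule_format, OF adm B(1)] B(2,3,4) by simp
    ultimately have "(\<integral>\<^sup>+ z. ennreal (enn2real (berezin (2 * \<alpha>) \<mu> z) powr conj_exp p) \<partial>lborel) \<le> ennreal ((D * (C * toeplitz_norm \<alpha> \<mu> p 1)) powr conj_exp p)"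
      using D(2)[rule_format, OF adm] by simp
    then show ?thesis by (simp add: mult.assoc)
  qed
  moreover have "D * C > 0" using C(1) D(1) by simp
  ultimately show ?thesis by blast
qed

text \<open>
Mean value inequality with \<open>\<gamma> = 2\<alpha>\<close>, then Hoelder's inequality.
\<close>
lemma carleson_of_berezin_Lq:
  assumes \<alpha>: "\<alpha> > 0" and p: "1 < p"
  shows "\<exists>C>0. \<forall>(\<mu> :: (complex^'n) measure) L. toeplitz_admissible \<alpha> \<mu> \<longrightarrow> 0 \<le> L \<longrightarrow>
    (\<integral>\<^sup>+ z. ennreal (enn2real (berezin (2 * \<alpha>) \<mu> z) powr conj_exp p) \<partial>lborel) \<le> ennreal (L powr conj_exp p) \<longrightarrow>
    (\<forall>f\<in>fock_space \<alpha> p. (\<integral>\<^sup>+ z. ennreal (wt \<alpha> f z) \<partial>\<mu>) \<le> ennreal (C * L * fock_norm \<alpha> p f))"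
proof -
  let ?q = "conj_exp p"
  have q: "?q \<ge> 1" by (rule conj_exp_ge[OF p])
  obtain C where C: "C > 0"
    "\<forall>f\<in>(fock_space \<alpha> p :: (complex^'n \<Rightarrow> complex) set). \<forall>b\<in>borel_measurable borel.
     (\<forall>z. b z \<ge> 0) \<longrightarrow> integrable lborel (\<lambda>z. b z powr ?q) \<longrightarrow>
     integrable lborel (\<lambda>z. wt \<alpha> f z * b z) \<and>
     (LINT z|lborel. wt \<alpha> f z * b z) \<le> C * fock_norm \<alpha> p f * (LINT z|lborel. b z powr ?q) powr (1 / ?q)"
    using fock_holder[OF \<alpha> p, where 'n='n] by blast
  let ?k = "inverse (gauss_mass TYPE(complex^'n) (2 * \<alpha> + \<alpha> / 2))"
  have k: "?k > 0" using \<alpha> by (simp add: gauss_mass_pos)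
  have "(\<integral>\<^sup>+ z. ennreal (wt \<alpha> f z) \<partial>\<mu>) \<le> ennreal (?k * C * L * fock_norm \<alpha> p f)"
    if adm: "toeplitz_admissible \<alpha> \<mu>" and L: "0 \<le> L"
      and le: "(\<integral>\<^sup>+ z. ennreal (enn2real (berezin (2 * \<alpha>) \<mu> z) powr ?q) \<partial>lborel) \<le> ennreal (L powr ?q)"
      and f: "f \<in> fock_space \<alpha> p" for \<mu> :: "(complex^'n) measure" and L f
  proof -
    note s[measurable_cong] = admissible_sets[OF adm] and sf = admissible_sigma_finite[OF adm \<alpha>]
    note [measurable] = entire_measurable[OF fock_space_entire[OF f]]
    have N: "fock_norm \<alpha> p f \<ge> 0" using p by (intro fock_norm_nonneg f) simp
    define b where "b z = enn2real (berezin (2 * \<alpha>) \<mu> z)" for z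
    have bm[measurable]: "b \<in> borel_measurable borel"
      unfolding b_def using berezin_measurable[OF s sf, of "2 * \<alpha>"] by measurable
    have "berezin (2 * \<alpha>) \<mu> z < \<infinity>" for z
      using berezin_antimono[of \<alpha> "2 * \<alpha>" \<mu> z] admissible_berezin_finite[OF adm, of z] \<alpha> by (auto intro: le_less_trans)
    then have b: "berezin (2 * \<alpha>) \<mu> z = ennreal (b z)" "b z \<ge> 0" for z
      by (auto simp: b_def less_top)
    have i: "integrable lborel (\<lambda>z. b z powr ?q)"
      using le_less_trans[OF le[folded b_def]] by (auto simp: integrable_iff_bounded)
    have "(LINT z|lborel. b z powr ?q) \<le> L powr ?q"
      using le unfolding b_def[symmetric] nn_integral_eq_integral[OF i, simplified] by simp
    then have "(LINT z|lborel. b z powr ?q) powr (1 / ?q) \<le> (L powr ?q) powr (1 / ?q)"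
      using q by (intro powr_mono2) auto
    then have bL: "(LINT z|lborel. b z powr ?q) powr (1 / ?q) \<le> L"
      using q L by (simp add: powr_powr)
    have H: "integrable lborel (\<lambda>z. wt \<alpha> f z * b z)"
      "(LINT z|lborel. wt \<alpha> f z * b z) \<le> C * fock_norm \<alpha> p f * (LINT z|lborel. b z powr ?q) powr (1 / ?q)"
      using C(2)[rule_format, OF f bm b(2) i] by auto
    have "(\<integral>\<^sup>+ z. ennreal (wt \<alpha> f z) \<partial>\<mu>) \<le> ennreal ?k * (\<integral>\<^sup>+ z. ennreal (wt \<alpha> f z) * berezin (2 * \<alpha>) \<mu> z \<partial>lborel)"
      using \<alpha> by (intro integral_wt_le_berezin fock_space_entire[OF f] s sf) auto
    also have "(\<integral>\<^sup>+ z. ennreal (wt \<alpha> f z) * berezin (2 * \<alpha>) \<mu> z \<partial>lborel) = ennreal (LINT z|lborel. wt \<alpha> f z * b z)"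
      unfolding b(1) using b(2) by (subst nn_integral_eq_integral[OF H(1), symmetric]) (auto simp: ennreal_mult)
    also have "ennreal ?k * ennreal (LINT z|lborel. wt \<alpha> f z * b z) = ennreal (?k * (LINT z|lborel. wt \<alpha> f z * b z))"
      using k b(2) by (simp add: ennreal_mult integral_nonneg_AE)
    also have "\<dots> \<le> ennreal (?k * C * L * fock_norm \<alpha> p f)"
    proof (rule ennreal_leI)
      have "(LINT z|lborel. wt \<alpha> f z * b z) \<le> C * fock_norm \<alpha> p f * L"
        using C(1) N by (intro order_trans[OF H(2) mult_left_mono[OF bL]]) simp
      then have "?k * (LINT z|lborel. wt \<alpha> f z * b z) \<le> ?k * (C * fock_norm \<alpha> p f * L)"
        using k by (intro mult_left_mono) auto
      then show "?k * (LINT z|lborel. wt \<alpha> f z * b z) \<le> ?k * C * L * fock_norm \<alpha> p f"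
        by (simp only: mult_ac)
    qed
    finally show ?thesis .
  qed
  moreover have "?k * C > 0" using k C(1) by simp
  ultimately show ?thesis by blast
qed

lemma carleson_of_toeplitz:
  assumes \<alpha>: "\<alpha> > 0" and p: "1 < p"
  shows "\<exists>C>0. \<forall>(\<mu> :: (complex^'n) measure). toeplitz_admissible \<alpha> \<mu> \<longrightarrow> toeplitz_bounded \<alpha> \<mu> p 1 \<longrightarrow>
    (\<forall>f\<in>fock_space \<alpha> p. (\<integral>\<^sup>+ z. ennreal (wt \<alpha> f z powr 1) \<partial>\<mu>) \<le> ennreal (C * toeplitz_norm \<alpha> \<mu> p 1 * fock_norm \<alpha> p f powr 1))"
proof -
  have p1: "1 \<le> p" using p by simp
  obtain C where C: "C > 0" "\<forall>(\<mu> :: (complex^'n) measure). toeplitz_admissible \<alpha> \<mu> \<longrightarrow> toeplitz_bounded \<alpha> \<mu> p 1 \<longrightarrow>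
    (\<integral>\<^sup>+ z. ennreal (enn2real (berezin (2 * \<alpha>) \<mu> z) powr conj_exp p) \<partial>lborel) \<le> ennreal ((C * toeplitz_norm \<alpha> \<mu> p 1) powr conj_exp p)"
    using berezin_Lq_of_toeplitz[OF \<alpha> p, where 'n='n] by blast
  obtain D where D: "D > 0" "\<forall>(\<mu> :: (complex^'n) measure) L. toeplitz_admissible \<alpha> \<mu> \<longrightarrow> 0 \<le> L \<longrightarrow>
    (\<integral>\<^sup>+ z. ennreal (enn2real (berezin (2 * \<alpha>) \<mu> z) powr conj_exp p) \<partial>lborel) \<le> ennreal (L powr conj_exp p) \<longrightarrow>
    (\<forall>f\<in>fock_space \<alpha> p. (\<integral>\<^sup>+ z. ennreal (wt \<alpha> f z) \<partial>\<mu>) \<le> ennreal (D * L * fock_norm \<alpha> p f))"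
    using carleson_of_berezin_Lq[OF \<alpha> p, where 'n='n] by blast
  have "(\<integral>\<^sup>+ z. ennreal (wt \<alpha> f z powr 1) \<partial>\<mu>) \<le> ennreal (D * C * toeplitz_norm \<alpha> \<mu> p 1 * fock_norm \<alpha> p f powr 1)"
    if adm: "toeplitz_admissible \<alpha> \<mu>" and b: "toeplitz_bounded \<alpha> \<mu> p 1" and f: "f \<in> fock_space \<alpha> p"
    for \<mu> :: "(complex^'n) measure" and f
  proof -
    have "0 \<le> C * toeplitz_norm \<alpha> \<mu> p 1" using C(1) toeplitz_boundedD(1)[OF p1 b] by simp
    from D(2)[rule_format, OF adm this C(2)[rule_format, OF adm b] f]
    show ?thesis using fock_norm_nonneg[OF p1 f] by (simp add: mult.assoc)
  qed
  moreover have "D * C > 0" using C(1) D(1) by simp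
  ultimately show ?thesis by blast
qed

lemma toeplitz_of_carleson:
  fixes \<mu> :: "(complex^'n) measure"
  assumes \<alpha>: "\<alpha> > 0" and p: "1 \<le> p" and adm: "toeplitz_admissible \<alpha> \<mu>" and car: "fock_carleson \<alpha> p 1 \<mu>"
    and f: "f \<in> fock_space \<alpha> p"
  shows "integrable \<mu> (toeplitz_integrand \<alpha> f z)" and "toeplitz \<alpha> \<mu> f \<in> fock_space \<alpha> 1"
    and "fock_norm \<alpha> 1 (toeplitz \<alpha> \<mu> f) \<le> kern_norm TYPE('n) \<alpha> * embedding_norm \<alpha> p 1 \<mu> * fock_norm \<alpha> p f"
proof -
  note s = admissible_sets[OF adm] and sf = admissible_sigma_finite[OF adm \<alpha>]
  note E = embedding_norm_bounds[OF p zero_less_one s car]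
  have N: "fock_norm \<alpha> p f \<ge> 0" by (rule fock_norm_nonneg[OF p f])
  have I: "0 \<le> embedding_norm \<alpha> p 1 \<mu> * fock_norm \<alpha> p f" using E(3) N by simp
  have "(\<integral>\<^sup>+ z. ennreal (wt \<alpha> f z) \<partial>\<mu>) \<le> ennreal (embedding_norm \<alpha> p 1 \<mu> * fock_norm \<alpha> p f)"
    using E(1)[OF f] E(3) N by simp
  note T = toeplitz_into_fock_1[OF \<alpha> s sf fock_space_entire[OF f] I this]
  show "integrable \<mu> (toeplitz_integrand \<alpha> f z)" "toeplitz \<alpha> \<mu> f \<in> fock_space \<alpha> 1" by (rule T)+
  show "fock_norm \<alpha> 1 (toeplitz \<alpha> \<mu> f) \<le> kern_norm TYPE('n) \<alpha> * embedding_norm \<alpha> p 1 \<mu> * fock_norm \<alpha> p f"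
    using T(3) by (simp add: mult.assoc)
qed

lemma toeplitz_bounded_into_1_iff:
  fixes \<mu> :: "(complex^'n) measure"
  assumes \<alpha>: "\<alpha> > 0" and p: "1 < p" and adm: "toeplitz_admissible \<alpha> \<mu>"
  shows "toeplitz_bounded \<alpha> \<mu> p 1 \<longleftrightarrow> fock_carleson \<alpha> p 1 \<mu>"
proof
  assume b: "toeplitz_bounded \<alpha> \<mu> p 1"
  obtain C where C: "\<forall>(\<mu> :: (complex^'n) measure). toeplitz_admissible \<alpha> \<mu> \<longrightarrow> toeplitz_bounded \<alpha> \<mu> p 1 \<longrightarrow>
    (\<forall>f\<in>fock_space \<alpha> p. (\<integral>\<^sup>+ z. ennreal (wt \<alpha> f z powr 1) \<partial>\<mu>) \<le> ennreal (C * toeplitz_norm \<alpha> \<mu> p 1 * fock_norm \<alpha> p f powr 1))"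
    using carleson_of_toeplitz[OF \<alpha> p, where 'n='n] by blast
  then show "fock_carleson \<alpha> p 1 \<mu>"
    unfolding fock_carleson_wt using adm b by blast
next
  assume c: "fock_carleson \<alpha> p 1 \<mu>"
  have p1: "1 \<le> p" using p by simp
  show "toeplitz_bounded \<alpha> \<mu> p 1"
    unfolding toeplitz_bounded_def toeplitz_converges_def bounded_operator_def
    using toeplitz_of_carleson[OF \<alpha> p1 adm c] by blast
qed

lemma toeplitz_norm_comparable_into_1:
  assumes \<alpha>: "\<alpha> > 0" and p: "1 < p"
  shows "\<exists>C>0. \<forall>\<mu> :: (complex ^ 'n) measure. toeplitz_admissible \<alpha> \<mu> \<and> toeplitz_bounded \<alpha> \<mu> p 1 \<longrightarrow>
           comparable C (toeplitz_norm \<alpha> \<mu> p 1) (embedding_norm \<alpha> p 1 \<mu>)"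
proof -
  have p1: "1 \<le> p" using p by simp
  obtain C where C: "C > 0" "\<forall>(\<mu> :: (complex^'n) measure). toeplitz_admissible \<alpha> \<mu> \<longrightarrow> toeplitz_bounded \<alpha> \<mu> p 1 \<longrightarrow>
    (\<forall>f\<in>fock_space \<alpha> p. (\<integral>\<^sup>+ z. ennreal (wt \<alpha> f z powr 1) \<partial>\<mu>) \<le> ennreal (C * toeplitz_norm \<alpha> \<mu> p 1 * fock_norm \<alpha> p f powr 1))"
    using carleson_of_toeplitz[OF \<alpha> p, where 'n='n] by blast
  let ?k = "kern_norm TYPE('n) \<alpha>"
  have k: "?k > 0" by (rule kern_norm_pos[OF \<alpha>])
  have "comparable (max ?k C) (toeplitz_norm \<alpha> \<mu> p 1) (embedding_norm \<alpha> p 1 \<mu>)"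
    if adm: "toeplitz_admissible \<alpha> \<mu>" and b: "toeplitz_bounded \<alpha> \<mu> p 1" for \<mu> :: "(complex^'n) measure"
  proof -
    have car: "fock_carleson \<alpha> p 1 \<mu>" using b by (simp add: toeplitz_bounded_into_1_iff[OF \<alpha> p adm])
    note T = toeplitz_boundedD[OF p1 b]
    note E = embedding_norm_bounds[OF p1 zero_less_one admissible_sets[OF adm] car]
    have "toeplitz_norm \<alpha> \<mu> p 1 \<le> ?k * embedding_norm \<alpha> p 1 \<mu>"
      unfolding toeplitz_norm_def
      by (rule operator_norm_le) (use k E(3) toeplitz_of_carleson(3)[OF \<alpha> p1 adm car] in auto)
    also have "\<dots> \<le> max ?k C * embedding_norm \<alpha> p 1 \<mu>" using E(3) by (intro mult_right_mono) auto
    finally have 1: "toeplitz_norm \<alpha> \<mu> p 1 \<le> max ?k C * embedding_norm \<alpha> p 1 \<mu>" .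
    have "0 \<le> C * toeplitz_norm \<alpha> \<mu> p 1" using C(1) T(1) by simp
    from E(2)[OF this C(2)[rule_format, OF adm b]]
    have "embedding_norm \<alpha> p 1 \<mu> \<le> C * toeplitz_norm \<alpha> \<mu> p 1" using E(3) by simp
    also have "\<dots> \<le> max ?k C * toeplitz_norm \<alpha> \<mu> p 1" using T(1) by (intro mult_right_mono) auto
    finally have 2: "embedding_norm \<alpha> p 1 \<mu> \<le> max ?k C * toeplitz_norm \<alpha> \<mu> p 1" .
    show ?thesis by (rule comparableI[OF 1 2]) (use k in simp)
  qed
  moreover have "max ?k C > 0" using k by simp
  ultimately show ?thesis by blast
qed

text \<open>
The usual argument with a normalised sequence. A function of norm zero is zero, so that normalisation
is possible.
\<close>
lemma toeplitz_bounded_of_compact: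
  fixes \<mu> :: "(complex^'n) measure"
  assumes \<alpha>: "\<alpha> > 0" and p: "1 \<le> p" and adm: "toeplitz_admissible \<alpha> \<mu>" and K: "toeplitz_compact \<alpha> \<mu> p 1"
  shows "toeplitz_bounded \<alpha> \<mu> p 1"
proof -
  have co: "compact_operator (fock_space \<alpha> p) (fock_norm \<alpha> p) (fock_space \<alpha> 1) (fock_norm \<alpha> 1) (toeplitz \<alpha> \<mu>)"
    and conv: "toeplitz_converges \<alpha> \<mu> p"
    using K unfolding toeplitz_compact_def by auto
  have TY: "\<And>f. f \<in> fock_space \<alpha> p \<Longrightarrow> toeplitz \<alpha> \<mu> f \<in> fock_space \<alpha> 1"
    using co unfolding compact_operator_def by blast
  obtain A where A: "\<forall>f\<in>(fock_space \<alpha> p :: (complex^'n \<Rightarrow> complex) set). \<forall>z. wt \<alpha> f z \<le> A * fock_norm \<alpha> p f"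
    using fock_sup_bound[OF \<alpha> p, where 'n='n] by blast
  have Ts: "toeplitz \<alpha> \<mu> (\<lambda>z. c * f z) = (\<lambda>z. c * toeplitz \<alpha> \<mu> f z)" for c f
  proof -
    have "toeplitz_integrand \<alpha> (\<lambda>z. c * f z) z = (\<lambda>w. c * toeplitz_integrand \<alpha> f z w)" for z
      by (simp add: fun_eq_iff toeplitz_integrand_def mult_ac)
    then show ?thesis unfolding toeplitz_def by simp
  qed
  have "\<exists>C. \<forall>f\<in>fock_space \<alpha> p. fock_norm \<alpha> 1 (toeplitz \<alpha> \<mu> f) \<le> C * fock_norm \<alpha> p f"
  proof (rule ccontr)
    assume "\<not> ?thesis"
    then have "\<forall>k::nat. \<exists>f\<in>fock_space \<alpha> p. real k * fock_norm \<alpha> p f < fock_norm \<alpha> 1 (toeplitz \<alpha> \<mu> f)"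
      by (meson not_le)
    then obtain f where f: "\<And>k::nat. f k \<in> fock_space \<alpha> p" "\<And>k. real k * fock_norm \<alpha> p (f k) < fock_norm \<alpha> 1 (toeplitz \<alpha> \<mu> (f k))"
      by metis
    have pos: "fock_norm \<alpha> p (f k) > 0" for k
    proof (rule ccontr)
      assume "\<not> ?thesis"
      then have 0: "fock_norm \<alpha> p (f k) = 0" using fock_norm_nonneg[OF p f(1), of k] by simp
      have "wt \<alpha> (f k) z \<le> 0" for z using A[rule_format, OF f(1)[of k], of z] 0 by simp
      then have "f k z = 0" for z using wt_nonneg[of \<alpha> "f k" z] by (simp add: wt_def mult_le_0_iff)
      then have "toeplitz_integrand \<alpha> (f k) z = (\<lambda>w. 0)" for z by (simp add: fun_eq_iff toeplitz_integrand_def)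
      then have "toeplitz \<alpha> \<mu> (f k) = (\<lambda>z. 0)" by (simp add: toeplitz_def)
      then have "fock_norm \<alpha> 1 (toeplitz \<alpha> \<mu> (f k)) = 0"
        unfolding fock_norm_1[OF \<alpha>] by (simp add: wt_def[abs_def])
      then show False using f(2)[of k] 0 by simp
    qed
    define s where "s k = (\<lambda>z. complex_of_real (inverse (fock_norm \<alpha> p (f k))) * f k z)" for k
    have s: "s k \<in> fock_space \<alpha> p" "fock_norm \<alpha> p (s k) \<le> 1" for k
      using fock_scale[OF p f(1) \<alpha>, of "complex_of_real (inverse (fock_norm \<alpha> p (f k)))" k] pos[of k]
      unfolding s_def by (auto simp: norm_inverse)
    have ni: "norm (complex_of_real (inverse (fock_norm \<alpha> p (f k)))) = inverse (fock_norm \<alpha> p (f k))" for k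
      unfolding norm_of_real using pos[of k] by simp
    have big: "real k < fock_norm \<alpha> 1 (toeplitz \<alpha> \<mu> (s k))" for k
      unfolding s_def Ts fock_scale(2)[OF order_refl TY[OF f(1)] \<alpha>] ni
      using f(2)[of k] pos[of k] by (simp add: field_simps)
    obtain r g where r: "strict_mono (r :: nat \<Rightarrow> nat)" and g: "g \<in> fock_space \<alpha> 1"
      and lim: "(\<lambda>k. fock_norm \<alpha> 1 (\<lambda>x. toeplitz \<alpha> \<mu> (s (r k)) x - g x)) \<longlonglongrightarrow> 0"
      using compact_operatorD[OF co, of s 1, OF s] by blast
    have tri: "fock_norm \<alpha> 1 h \<le> fock_norm \<alpha> 1 (\<lambda>x. h x - g x) + fock_norm \<alpha> 1 g" if h: "h \<in> fock_space \<alpha> 1" for h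
    proof -
      have i: "integrable lborel (wt \<alpha> h)" "integrable lborel (wt \<alpha> g)" "integrable lborel (wt \<alpha> (\<lambda>x. h x - g x))"
        using h g fock_diff(1)[OF order_refl h g] by (auto simp: fock_space_1)
      have "(LINT z|lborel. wt \<alpha> h z) \<le> (LINT z|lborel. wt \<alpha> (\<lambda>x. h x - g x) z + wt \<alpha> g z)"
      proof (rule integral_mono)
        show "wt \<alpha> h z \<le> wt \<alpha> (\<lambda>x. h x - g x) z + wt \<alpha> g z" for z
          unfolding wt_def distrib_right[symmetric] using norm_triangle_sub[of "h z" "g z"]
          by (intro mult_right_mono) (auto simp: add.commute)
      qed (use i in auto)
      also have "\<dots> = (LINT z|lborel. wt \<alpha> (\<lambda>x. h x - g x) z) + (LINT z|lborel. wt \<alpha> g z)"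
        using i by simp
      finally show ?thesis
        unfolding fock_norm_1[OF \<alpha>] distrib_left[symmetric]
        using \<alpha> by (intro mult_left_mono) (auto intro!: less_imp_le[OF fock_const_pos])
    qed
    have "\<forall>\<^sub>F k in sequentially. fock_norm \<alpha> 1 (\<lambda>x. toeplitz \<alpha> \<mu> (s (r k)) x - g x) < 1"
      using lim by (rule order_tendstoD) simp
    then obtain n where n: "\<And>k. k \<ge> n \<Longrightarrow> fock_norm \<alpha> 1 (\<lambda>x. toeplitz \<alpha> \<mu> (s (r k)) x - g x) < 1"
      unfolding eventually_sequentially by blast
    obtain m :: nat where m: "real m \<ge> 1 + fock_norm \<alpha> 1 g" using real_arch_simple by blast
    let ?k = "max n m"
    have "real m \<le> real (r ?k)" using seq_suble[OF r, of ?k] by simp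
    also have "\<dots> < fock_norm \<alpha> 1 (toeplitz \<alpha> \<mu> (s (r ?k)))" by (rule big)
    also have "\<dots> \<le> fock_norm \<alpha> 1 (\<lambda>x. toeplitz \<alpha> \<mu> (s (r ?k)) x - g x) + fock_norm \<alpha> 1 g"
      by (rule tri[OF TY[OF s(1)]])
    also have "\<dots> \<le> 1 + fock_norm \<alpha> 1 g" using n[of ?k] by simp
    finally show False using m by simp
  qed
  then show ?thesis
    unfolding toeplitz_bounded_def bounded_operator_def using conv TY by blast
qed

text \<open>
Compactness is automatic because the conjugate exponent is finite: differences that are bounded in \<open>F\<^sup>p\<close> and tend to
zero pointwise pair to zero with a fixed function in \<open>L\<^sup>q\<close>. For finite \<open>p\<close> this uses Young's inequality, and for
\<open>p = \<infinity>\<close> dominated convergence.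
\<close>
lemma toeplitz_compact_into_1:
  fixes \<mu> :: "(complex^'n) measure"
  assumes \<alpha>: "\<alpha> > 0" and p: "1 < p" and adm: "toeplitz_admissible \<alpha> \<mu>" and b: "toeplitz_bounded \<alpha> \<mu> p 1"
  shows "toeplitz_compact \<alpha> \<mu> p 1"
proof (rule toeplitz_compact_of_integrals[OF \<alpha> _ order_refl admissible_sets[OF adm] admissible_sigma_finite[OF adm \<alpha>]])
  show p1: "1 \<le> p" using p by simp
  fix f :: "complex^'n \<Rightarrow> complex" assume f: "f \<in> fock_space \<alpha> p"
  have "fock_carleson \<alpha> p 1 \<mu>" using b by (simp add: toeplitz_bounded_into_1_iff[OF \<alpha> p adm])
  then obtain C where "(\<integral>\<^sup>+ z. ennreal (wt \<alpha> f z powr 1) \<partial>\<mu>) \<le> ennreal (C * fock_norm \<alpha> p f powr 1)"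
    unfolding fock_carleson_wt using f by blast
  then show "(\<integral>\<^sup>+ z. ennreal (wt \<alpha> f z) \<partial>\<mu>) < \<infinity>"
    using le_less_trans by fastforce
next
  fix s :: "nat \<Rightarrow> complex^'n \<Rightarrow> complex" and f M
  assume sk: "\<And>k. s k \<in> fock_space \<alpha> p" and f: "f \<in> fock_space \<alpha> p" and B: "\<exists>B. \<forall>k. fock_norm \<alpha> p (s k) \<le> B"
    and lim: "\<And>z. (\<lambda>k. s k z) \<longlonglongrightarrow> f z" and M: "\<And>k z. wt \<alpha> (s k) z \<le> M" "\<And>z. wt \<alpha> f z \<le> M"
  have p1: "1 \<le> p" using p by simp
  note se[measurable_cong] = admissible_sets[OF adm] and sf = admissible_sigma_finite[OF adm \<alpha>]
  let ?q = "conj_exp p"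
  define b where "b z = enn2real (berezin (2 * \<alpha>) \<mu> z)" for z
  have bm[measurable]: "b \<in> borel_measurable borel"
    unfolding b_def using berezin_measurable[OF se sf, of "2 * \<alpha>"] by measurable
  have "berezin (2 * \<alpha>) \<mu> z < \<infinity>" for z
    using berezin_antimono[of \<alpha> "2 * \<alpha>" \<mu> z] admissible_berezin_finite[OF adm, of z] \<alpha> by (auto intro: le_less_trans)
  then have bb: "berezin (2 * \<alpha>) \<mu> z = ennreal (b z)" "b z \<ge> 0" for z
    by (auto simp: b_def less_top)
  obtain C where "\<forall>(\<mu> :: (complex^'n) measure). toeplitz_admissible \<alpha> \<mu> \<longrightarrow> toeplitz_bounded \<alpha> \<mu> p 1 \<longrightarrow>
    (\<integral>\<^sup>+ z. ennreal (enn2real (berezin (2 * \<alpha>) \<mu> z) powr ?q) \<partial>lborel) \<le> ennreal ((C * toeplitz_norm \<alpha> \<mu> p 1) powr ?q)"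
    using berezin_Lq_of_toeplitz[OF \<alpha> p, where 'n='n] by blast
  from this[rule_format, OF adm b] have bq: "(\<integral>\<^sup>+ z. ennreal (b z powr ?q) \<partial>lborel) < \<infinity>"
    unfolding b_def by (rule le_less_trans) simp
  let ?d = "\<lambda>k x. s k x - f x"
  have de: "entire (?d k)" for k by (intro entire_diff fock_space_entire[OF sk] fock_space_entire[OF f])
  note [measurable] = entire_measurable[OF de]
  have d0: "(\<lambda>k. wt \<alpha> (?d k) x) \<longlonglongrightarrow> 0" for x by (rule wt_tendsto_0[OF lim])
  have M0: "M \<ge> 0" using M(2)[of 0] wt_nonneg[of \<alpha> f 0] by linarith
  have \<alpha>2: "2 * \<alpha> > 0" using \<alpha> by simp
  show "(\<lambda>k. \<integral>\<^sup>+ z. ennreal (wt \<alpha> (?d k) z) \<partial>\<mu>) \<longlonglongrightarrow> 0"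
  proof (rule integral_wt_tendsto_0_of_berezin[OF \<alpha> \<alpha>2 se sf de bb])
    from p show "(\<lambda>k. \<integral>\<^sup>+ z. ennreal (wt \<alpha> (?d k) z * b z) \<partial>lborel) \<longlonglongrightarrow> 0"
    proof (cases rule: exponent_gt_1_cases)
      case 1
      have q1: "?q = 1" by (simp add: 1 conj_exp_def)
      show ?thesis
      proof (rule integrals_tendsto_0[where \<psi> = "\<lambda>_ _. 0" and L = 0])
        fix \<epsilon> :: real
        show "\<exists>g\<in>borel_measurable lborel. (\<forall>x. 0 \<le> g x) \<and> (\<integral>\<^sup>+ x. ennreal (g x) \<partial>lborel) < \<infinity> \<and>
          (\<forall>k x. wt \<alpha> (?d k) x * b x \<le> \<epsilon> * 0 + g x)"
        proof (intro bexI[of _ "\<lambda>x. 2 * M * b x"] conjI allI)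
          show "0 \<le> 2 * M * b x" for x using M0 bb by simp
          have "(\<integral>\<^sup>+ x. ennreal (2 * M * b x) \<partial>lborel) = ennreal (2 * M) * (\<integral>\<^sup>+ x. ennreal (b x) \<partial>lborel)"
            using M0 bb by (subst nn_integral_cmult[symmetric]) (auto simp: ennreal_mult)
          also have "\<dots> < \<infinity>" using bq bb unfolding q1 by (simp add: ennreal_mult_less_top)
          finally show "(\<integral>\<^sup>+ x. ennreal (2 * M * b x) \<partial>lborel) < \<infinity>" .
          show "wt \<alpha> (?d k) x * b x \<le> \<epsilon> * 0 + 2 * M * b x" for k x
            using mult_right_mono[OF wt_diff_le_bound[OF M], of "b x" k x] bb by simp
        qed measurable
      qed (use bb d0 in auto)
    next
      case (2 r)
      have r1: "r \<ge> 1" "r > 0" using 2 by auto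
      let ?c = "fock_const TYPE('n) \<alpha> r"
      have c: "?c > 0" using \<alpha> 2 by (simp add: fock_const_pos)
      obtain B where B: "\<And>k. fock_norm \<alpha> p (s k) \<le> B" using B by blast
      have q: "?q = r / (r - 1)" using 2 by (simp add: conj_exp_def)
      have q1: "?q > 1" unfolding q using 2(2) by (simp add: field_simps)
      have rq: "1 / r + 1 / ?q = 1" using conj_exp_real[OF 2(2)] 2(1) by simp
      define L where "L = 2 powr r * (B powr r / ?c + (LINT z|lborel. wt \<alpha> f z powr r))"
      have L0: "L \<ge> 0" unfolding L_def using c by simp
      have L: "(\<integral>\<^sup>+ z. ennreal (wt \<alpha> (?d k) z powr r) \<partial>lborel) \<le> ennreal L" for k
      proof -
        have i: "integrable lborel (\<lambda>z. wt \<alpha> (?d k) z powr r)"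
          using fock_diff(1)[OF p1 sk f] 2 by (simp add: fock_space_real)
        have 3: "(LINT z|lborel. wt \<alpha> (?d k) z powr r) \<le> 2 powr r * ((LINT z|lborel. wt \<alpha> (s k) z powr r) + (LINT z|lborel. wt \<alpha> f z powr r))"
          by (rule fock_diff(2)[OF p1 sk f 2(1) r1(1)])
        have "fock_norm \<alpha> p (s k) powr r \<le> B powr r"
          using fock_norm_nonneg[OF p1 sk] B r1 by (intro powr_mono2) auto
        then have "(LINT z|lborel. wt \<alpha> (s k) z powr r) \<le> B powr r / ?c"
          unfolding 2(1) fock_norm_powr[OF r1(1) \<alpha>] using c by (simp add: field_simps)
        then have "2 powr r * ((LINT z|lborel. wt \<alpha> (s k) z powr r) + (LINT z|lborel. wt \<alpha> f z powr r)) \<le> L"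
          unfolding L_def by (intro mult_left_mono add_right_mono) auto
        with 3 have "(LINT z|lborel. wt \<alpha> (?d k) z powr r) \<le> L" by (rule order_trans)
        then show ?thesis by (simp add: nn_integral_eq_integral[OF i] ennreal_leI)
      qed
      show ?thesis
      proof (rule integrals_tendsto_0[where \<psi> = "\<lambda>k x. wt \<alpha> (?d k) x powr r", OF _ _ _ _ _ _ _ L0 L])
        fix \<epsilon> :: real assume \<epsilon>: "\<epsilon> > 0"
        \<comment> \<open>Young's inequality with a small weight on the first factor\<close>
        define \<eta> where "\<eta> = \<epsilon> powr (1 / r)"
        have \<eta>: "\<eta> > 0" "\<eta> powr r = \<epsilon>" using \<epsilon> r1 by (auto simp: \<eta>_def powr_powr)
        let ?g = "\<lambda>x. (1 / \<eta>) powr ?q * b x powr ?q"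
        show "\<exists>g\<in>borel_measurable lborel. (\<forall>x. 0 \<le> g x) \<and> (\<integral>\<^sup>+ x. ennreal (g x) \<partial>lborel) < \<infinity> \<and>
          (\<forall>k x. wt \<alpha> (?d k) x * b x \<le> \<epsilon> * wt \<alpha> (?d k) x powr r + g x)"
        proof (intro bexI[of _ ?g] conjI allI)
          show "0 \<le> ?g x" for x by simp
          have "(\<integral>\<^sup>+ x. ennreal (?g x) \<partial>lborel) = ennreal ((1 / \<eta>) powr ?q) * (\<integral>\<^sup>+ x. ennreal (b x powr ?q) \<partial>lborel)"
            by (subst nn_integral_cmult[symmetric]) (auto simp: ennreal_mult)
          also have "\<dots> < \<infinity>" using bq by (simp add: ennreal_mult_less_top)
          finally show "(\<integral>\<^sup>+ x. ennreal (?g x) \<partial>lborel) < \<infinity>" .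
          show "wt \<alpha> (?d k) x * b x \<le> \<epsilon> * wt \<alpha> (?d k) x powr r + ?g x" for k x
          proof -
            let ?w = "wt \<alpha> (?d k) x"
            have "?w * b x = (\<eta> * ?w) * (b x / \<eta>)" using \<eta>(1) by simp
            also have "\<dots> \<le> (\<eta> * ?w) powr r / r + (b x / \<eta>) powr ?q / ?q"
              using \<eta>(1) bb 2(2) q1 rq by (intro Youngs_inequality) auto
            also have "\<dots> \<le> (\<eta> * ?w) powr r + (b x / \<eta>) powr ?q"
              using r1 q1 by (intro add_mono) (auto simp: divide_le_eq mult_le_cancel_left1)
            also have "\<dots> = \<epsilon> * ?w powr r + ?g x"
              using \<eta> bb by (simp add: powr_mult powr_divide)
            finally show ?thesis .
          qed
        qed measurable
      qed (use bb d0 in auto)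
    qed
  qed
qed

theorem theorem2p5:
  fixes \<alpha> :: real
  assumes "\<alpha> > 0"
  shows
    "(\<forall>p::ennreal. 1 \<le> p \<longrightarrow>
        (\<forall>\<mu> :: (complex ^ 'n) measure. toeplitz_admissible \<alpha> \<mu> \<longrightarrow>
           (toeplitz_bounded \<alpha> \<mu> 1 p \<longleftrightarrow> (\<exists>q. admissible_exponent p q \<and> fock_carleson \<alpha> 1 q \<mu>)) \<and>
           (toeplitz_bounded \<alpha> \<mu> 1 p \<longleftrightarrow> (\<forall>q. admissible_exponent p q \<longrightarrow> fock_carleson \<alpha> 1 q \<mu>)) \<and>
           (toeplitz_compact \<alpha> \<mu> 1 p \<longleftrightarrow>
              (\<exists>q. admissible_exponent p q \<and> vanishing_fock_carleson \<alpha> 1 q \<mu>)) \<and>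
           (toeplitz_compact \<alpha> \<mu> 1 p \<longleftrightarrow>
              (\<forall>q. admissible_exponent p q \<longrightarrow> vanishing_fock_carleson \<alpha> 1 q \<mu>))) \<and>
        (let q = (if p = \<infinity> then 1 else enn2real p) in
           \<exists>C>0. \<forall>\<mu> :: (complex ^ 'n) measure.
             toeplitz_admissible \<alpha> \<mu> \<and> toeplitz_bounded \<alpha> \<mu> 1 p \<longrightarrow>
             comparable C (toeplitz_norm \<alpha> \<mu> 1 p) (embedding_norm \<alpha> 1 q \<mu> powr q)))
     \<and>
     (\<forall>p::ennreal. 1 < p \<longrightarrow>
        (\<forall>\<mu> :: (complex ^ 'n) measure. toeplitz_admissible \<alpha> \<mu> \<longrightarrow>
           (toeplitz_bounded \<alpha> \<mu> p 1 \<longleftrightarrow> fock_carleson \<alpha> p 1 \<mu>) \<and>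
           (toeplitz_compact \<alpha> \<mu> p 1 \<longleftrightarrow> fock_carleson \<alpha> p 1 \<mu>)) \<and>
        (\<exists>C>0. \<forall>\<mu> :: (complex ^ 'n) measure.
           toeplitz_admissible \<alpha> \<mu> \<and> toeplitz_bounded \<alpha> \<mu> p 1 \<longrightarrow>
           comparable C (toeplitz_norm \<alpha> \<mu> p 1) (embedding_norm \<alpha> p 1 \<mu>)))"
proof (rule conjI; intro allI impI)
  fix p :: ennreal assume p: "1 \<le> p"
  have adq: "admissible_exponent p q \<Longrightarrow> 1 \<le> q" for q
    using p by (cases rule: exponent_cases) (auto simp: admissible_exponent_def split: if_splits)
  define q0 where "q0 = (if p = \<infinity> then 1 else enn2real p)"
  have q0: "admissible_exponent p q0"
    by (simp add: admissible_exponent_def q0_def)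
  have main: "(toeplitz_bounded \<alpha> \<mu> 1 p \<longleftrightarrow> (\<exists>q. admissible_exponent p q \<and> fock_carleson \<alpha> 1 q \<mu>)) \<and>
           (toeplitz_bounded \<alpha> \<mu> 1 p \<longleftrightarrow> (\<forall>q. admissible_exponent p q \<longrightarrow> fock_carleson \<alpha> 1 q \<mu>)) \<and>
           (toeplitz_compact \<alpha> \<mu> 1 p \<longleftrightarrow>
              (\<exists>q. admissible_exponent p q \<and> vanishing_fock_carleson \<alpha> 1 q \<mu>)) \<and>
           (toeplitz_compact \<alpha> \<mu> 1 p \<longleftrightarrow>
              (\<forall>q. admissible_exponent p q \<longrightarrow> vanishing_fock_carleson \<alpha> 1 q \<mu>))"
    if adm: "toeplitz_admissible \<alpha> \<mu>" for \<mu> :: "(complex ^ 'n) measure"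
    using toeplitz_bounded_1_iff[OF assms p adm] toeplitz_compact_1_iff[OF assms p adm]
      fock_carleson_1_iff[OF assms adq adm] vanishing_fock_carleson_1_iff[OF assms adq adm] q0
    by blast
  have norms: "let q = (if p = \<infinity> then 1 else enn2real p) in
           \<exists>C>0. \<forall>\<mu> :: (complex ^ 'n) measure.
             toeplitz_admissible \<alpha> \<mu> \<and> toeplitz_bounded \<alpha> \<mu> 1 p \<longrightarrow>
             comparable C (toeplitz_norm \<alpha> \<mu> 1 p) (embedding_norm \<alpha> 1 q \<mu> powr q)"
    unfolding Let_def q0_def[symmetric] by (rule toeplitz_norm_comparable_1[OF assms p adq[OF q0]])
  show "(\<forall>\<mu> :: (complex ^ 'n) measure. toeplitz_admissible \<alpha> \<mu> \<longrightarrow>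
           (toeplitz_bounded \<alpha> \<mu> 1 p \<longleftrightarrow> (\<exists>q. admissible_exponent p q \<and> fock_carleson \<alpha> 1 q \<mu>)) \<and>
           (toeplitz_bounded \<alpha> \<mu> 1 p \<longleftrightarrow> (\<forall>q. admissible_exponent p q \<longrightarrow> fock_carleson \<alpha> 1 q \<mu>)) \<and>
           (toeplitz_compact \<alpha> \<mu> 1 p \<longleftrightarrow>
              (\<exists>q. admissible_exponent p q \<and> vanishing_fock_carleson \<alpha> 1 q \<mu>)) \<and>
           (toeplitz_compact \<alpha> \<mu> 1 p \<longleftrightarrow>
              (\<forall>q. admissible_exponent p q \<longrightarrow> vanishing_fock_carleson \<alpha> 1 q \<mu>))) \<and>
        (let q = (if p = \<infinity> then 1 else enn2real p) in
           \<exists>C>0. \<forall>\<mu> :: (complex ^ 'n) measure.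
             toeplitz_admissible \<alpha> \<mu> \<and> toeplitz_bounded \<alpha> \<mu> 1 p \<longrightarrow>
             comparable C (toeplitz_norm \<alpha> \<mu> 1 p) (embedding_norm \<alpha> 1 q \<mu> powr q))"
    using main norms by blast
next
  fix p :: ennreal assume p: "1 < p"
  then have p1: "1 \<le> p" by simp
  have "(toeplitz_bounded \<alpha> \<mu> p 1 \<longleftrightarrow> fock_carleson \<alpha> p 1 \<mu>) \<and> (toeplitz_compact \<alpha> \<mu> p 1 \<longleftrightarrow> fock_carleson \<alpha> p 1 \<mu>)"
    if adm: "toeplitz_admissible \<alpha> \<mu>" for \<mu> :: "(complex ^ 'n) measure"
    using toeplitz_bounded_into_1_iff[OF assms p adm] toeplitz_bounded_of_compact[OF assms p1 adm]
      toeplitz_compact_into_1[OF assms p adm] by blast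
  then show "(\<forall>\<mu> :: (complex ^ 'n) measure. toeplitz_admissible \<alpha> \<mu> \<longrightarrow>
           (toeplitz_bounded \<alpha> \<mu> p 1 \<longleftrightarrow> fock_carleson \<alpha> p 1 \<mu>) \<and>
           (toeplitz_compact \<alpha> \<mu> p 1 \<longleftrightarrow> fock_carleson \<alpha> p 1 \<mu>)) \<and>
        (\<exists>C>0. \<forall>\<mu> :: (complex ^ 'n) measure.
           toeplitz_admissible \<alpha> \<mu> \<and> toeplitz_bounded \<alpha> \<mu> p 1 \<longrightarrow>
           comparable C (toeplitz_norm \<alpha> \<mu> p 1) (embedding_norm \<alpha> p 1 \<mu>))"
    using toeplitz_norm_comparable_into_1[OF assms p, where 'n='n] by blast
qed

end
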